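(* Let $(x_i,y_0)\in\Gamma_3$ be a grid point on the side $\Gamma_3=(l_1,l_2)\times\{l_3\}$, with boundary condition $\mathcal{B}_3u=\frac{\partial u}{\partial\vec n}=g_3$ on $\Gamma_3$; take $(x_i,y_0)$ as base point. Let $$C^{\mathcal{B}_3}_{k,\ell}(h)=\sum_{i=0}^{6}c^{\mathcal{B}_3}_{k,\ell,i}h^i,\qquad k\in\{-1,0,1\},\ \ell\in\{0,1\},$$ be any non-trivial solution of the linear system induced by $$\sum_{k=-1}^1\sum_{\ell=0}^1C^{\mathcal{B}_3}_{k,\ell}(h)\,G^H_{5,n,0}(kh,\ell h)=\mathcal{O}(h^7),\quad n=0,1,\dots,6.$$ Put $$C^{\mathcal{B}_3}_{f,m,n}:=\sum_{k=-1}^1\sum_{\ell=0}^1C^{\mathcal{B}_3}_{k,\ell}Q^H_{5,m,n}(kh,\ell h),\ (m,n)\in\Lambda_4,\qquad C^{\mathcal{B}_3}_{g_3,n}:=-\sum_{k=-1}^1\sum_{\ell=0}^1C^{\mathcal{B}_3}_{k,\ell}G^H_{5,n,1}(kh,\ell h),\ n=0,\dots,5.$$ Then the 6-point scheme $$\sum_{k=-1}^1\sum_{\ell=0}^1C^{\mathcal{B}_3}_{k,\ell}(u_h)_{i+k,\ell}=\sum_{(m,n)\in\Lambda_4}f^{(m,n)}C^{\mathcal{B}_3}_{f,m,n}+\sum_{n=0}^5g_3^{(n)}C^{\mathcal{B}_3}_{g_3,n}$$ achieves sixth order of accuracy for $\mathcal{B}_3u=\frac{\partial u}{\partial\vec n}=g_3$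 at $(x_i,y_0)$. Moreover, the maximum accuracy order of a 6-point finite difference scheme for $\mathcal{B}_3u=\frac{\partial u}{\partial\vec n}=g_3$ at $(x_i,y_0)\in\Gamma_3$ with a smooth function $a(x,y)$ is six.
   Context: **Grid and problem.** $\Omega=(l_1,l_2)\times(l_3,l_4)$ with uniform grid $x_i=l_1+ih$ ($0\le i\le N_1$), $y_j=l_3+jh$ ($0\le j\le N_2$). The function $u$ solves $-\nabla\cdot(a\nabla u)=f$ (away from an interface in the interior across which $a$ may jump). Near the boundary point considered, $a$ is positive and smooth and $u,f$ are smooth up to the boundary. $\vec n$ is the outward normal, so on $\Gamma_3$ the condition reads $-u_y=g_3$. $(u_h)_{i,j}$ is the numerical approximation of $u(x_i,y_j)$. The analysis is local at the fixed base point as $h\to0^+$. **Notation.** $a^{(m,n)},u^{(m,n)},f^{(m,n)}$ denote $\partial_x^m\partial_y^n$ of $a,u,f$ at the base point $(x_i,y_0)$; $g_3^{(n)}$ is the $n$-th derivative in $x$ of $g_3$ at $x_i$. For an integer $N\ge0$: $\Lambda_N=\{(m,n)\in\mathbb{N}_0^2: m+n\le N\}$, $\Lambda_N^{H,1}=\{(m,n)\in\Lambda_N: n\in\{0,1\}\}$, $\Lambda_N^{H,2}=\Lambda_N\setminus\Lambda_N^{H,1}$. **The functions $G^H_{M,m,n}$ and $Q^H_{M,m,n}$.** For smooth $u$ and $f=-\nabla\cdot(a\nabla u)$, solving the equation for $u_{yy}$ and differentiating repeatedly, each $u^{(m',n')}$ with $(m',n')\in\Lambda_{M+1}^{H,2}$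 is written uniquely (identically in $u$) as $$u^{(m',n')}=\sum_{(m,n)\in\Lambda_{M+1}^{H,1},\,m+n\le m'+n'}A^{H,u}_{m',n',m,n}u^{(m,n)}+\sum_{(m,n)\in\Lambda_{M-1},\,m+n\le m'+n'-2}A^{H,f}_{m',n',m,n}f^{(m,n)},$$ with constants determined by $\{a^{(m,n)}:(m,n)\in\Lambda_M\}$. Then for $(m,n)\in\Lambda_{M+1}^{H,1}$, $$G^H_{M,m,n}(x,y)=\sum_{\ell=0}^{\lfloor m/2\rfloor}\frac{(-1)^\ell y^{n+2\ell}x^{m-2\ell}}{(n+2\ell)!(m-2\ell)!}+\sum_{(m',n')\in\Lambda_{M+1}^{H,2},\,m'+n'>m+n}A^{H,u}_{m',n',m,n}\frac{x^{m'}y^{n'}}{m'!n'!},$$ and for $(m,n)\in\Lambda_{M-1}$, $$Q^H_{M,m,n}(x,y)=\frac1{a^{(0,0)}}\sum_{\ell=1}^{1+\lfloor m/2\rfloor}\frac{(-1)^\ell y^{n+2\ell}x^{m-2\ell+2}}{(n+2\ell)!(m-2\ell+2)!}+\sum_{(m',n')\in\Lambda_{M+1}^{H,2},\,m'+n'>m+n+2}A^{H,f}_{m',n',m,n}\frac{x^{m'}y^{n'}}{m'!n'!}.$$ **Non-trivial and accuracy order.** A family $\{C_{k,\ell}(h)\}$ is non-trivial if $C_{k,\ell}(0)\ne0$ for at least one $(k,\ell)$. A 6-point scheme at $(x_i,y_0)$ is given by non-trivial polynomials $C_{k,\ell}(h)$, $k\in\{-1,0,1\}$, $\ell\in\{0,1\}$,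 and a right-hand side that is a finite linear combination of the $f^{(m,n)}$ and $g_3^{(n)}$ with coefficients depending only on $a,h$. It has accuracy order $p$ if, for every smooth $u$ near the point, with $f:=-\nabla\cdot(a\nabla u)$ and $g_3:=-u_y|_{\Gamma_3}$, the difference between $\sum_{k,\ell}C_{k,\ell}(h)u(x_i+kh,y_0+\ell h)$ and the right-hand side is $\mathcal{O}(h^{p+1})$ as $h\to0$ (i.e. $\mathcal{O}(h^p)$ after division by $h$). That the maximum accuracy order is six means that six is the largest $p$ such that for every positive smooth $a$ there is a 6-point scheme of accuracy order $p$. *)

theory Defs
  imports
    "HOL-Analysis.Analysis"
    "HOL-Library.Landau_Symbols"
    "HOL-Computational_Algebra.Polynomial"
begin

section \<open>Partial derivatives and smoothness up to the boundary\<close>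

text \<open>
  Functions are defined on the closed rectangle \<open>D\<close>. Derivatives are taken within the horizontal
  and vertical slices of \<open>D\<close>, so they are the ordinary partial derivatives in the interior and
  one-sided derivatives at the boundary.
\<close>

definition dx :: "(real \<times> real) set \<Rightarrow> (real \<times> real \<Rightarrow> real) \<Rightarrow> real \<times> real \<Rightarrow> real" where
  "dx D f = (\<lambda>(x, y). vector_derivative (\<lambda>t. f (t, y)) (at x within {t. (t, y) \<in> D}))"

definition dy :: "(real \<times> real) set \<Rightarrow> (real \<times> real \<Rightarrow> real) \<Rightarrow> real \<times> real \<Rightarrow> real" where
  "dy D f = (\<lambda>(x, y). vector_derivative (\<lambda>t. f (x, t)) (at y within {t. (x, t) \<in> D}))"

definition pd :: "(real \<times> real) set \<Rightarrow> nat \<Rightarrow> nat \<Rightarrow> (real \<times> real \<Rightarrow> real) \<Rightarrow> real \<times> real \<Rightarrow> real" where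
  "pd D m n f = (dx D ^^ m) ((dy D ^^ n) f)"

text \<open>
  \<open>Ck_on D S k f\<close>: all partial derivatives of \<open>f\<close> of order at most \<open>k\<close>, in every order of
  differentiation, exist and are continuous on \<open>S\<close>. It is used for \<open>S\<close> relatively open in \<open>D\<close>.
\<close>

primrec Ck_on :: "(real \<times> real) set \<Rightarrow> (real \<times> real) set \<Rightarrow> nat \<Rightarrow> (real \<times> real \<Rightarrow> real) \<Rightarrow> bool" where
  "Ck_on D S 0 f \<longleftrightarrow> continuous_on S f"
| "Ck_on D S (Suc k) f \<longleftrightarrow>
     continuous_on S f \<and>
     (\<forall>x y. (x, y) \<in> S \<longrightarrow>
        (\<lambda>t. f (t, y)) differentiable (at x within {t. (t, y) \<in> D}) \<and>
        (\<lambda>t. f (x, t)) differentiable (at y within {t. (x, t) \<in> D})) \<and>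
     Ck_on D S k (dx D f) \<and> Ck_on D S k (dy D f)"

definition smooth_near :: "(real \<times> real) set \<Rightarrow> real \<times> real \<Rightarrow> (real \<times> real \<Rightarrow> real) \<Rightarrow> bool" where
  "smooth_near D p f \<longleftrightarrow> (\<exists>U. open U \<and> p \<in> U \<and> (\<forall>k. Ck_on D (U \<inter> D) k f))"

definition pos_smooth_near :: "(real \<times> real) set \<Rightarrow> real \<times> real \<Rightarrow> (real \<times> real \<Rightarrow> real) \<Rightarrow> bool" where
  "pos_smooth_near D p a \<longleftrightarrow>
     smooth_near D p a \<and> (\<exists>U. open U \<and> p \<in> U \<and> (\<forall>q \<in> U \<inter> D. 0 < a q))"


section \<open>Source term and Neumann data\<close>

definition source :: "(real \<times> real) set \<Rightarrow> (real \<times> real \<Rightarrow> real) \<Rightarrow> (real \<times> real \<Rightarrow> real) \<Rightarrow> real \<times> real \<Rightarrow> real" where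
  "source D a u = (\<lambda>q. - (dx D (\<lambda>r. a r * dx D u r) q + dy D (\<lambda>r. a r * dy D u r) q))"

definition normal_deriv :: "(real \<times> real) set \<Rightarrow> real \<times> real \<Rightarrow> (real \<times> real \<Rightarrow> real) \<Rightarrow> real \<times> real \<Rightarrow> real" where
  "normal_deriv D \<nu> u q = (dx D u q, dy D u q) \<bullet> \<nu>"

text \<open>The outward normal on the bottom side is \<open>(0, -1)\<close>.\<close>

definition g3 :: "(real \<times> real) set \<Rightarrow> real \<Rightarrow> (real \<times> real \<Rightarrow> real) \<Rightarrow> real \<Rightarrow> real" where
  "g3 D y\<^sub>0 u = (\<lambda>x. normal_deriv D (0, -1) u (x, y\<^sub>0))"


section \<open>Index sets and the reduction coefficients\<close>

definition \<Lambda> :: "nat \<Rightarrow> (nat \<times> nat) set" where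
  "\<Lambda> N = {(m, n). m + n \<le> N}"

definition \<Lambda>H1 :: "nat \<Rightarrow> (nat \<times> nat) set" where
  "\<Lambda>H1 N = {(m, n) \<in> \<Lambda> N. n \<in> {0, 1}}"

definition \<Lambda>H2 :: "nat \<Rightarrow> (nat \<times> nat) set" where
  "\<Lambda>H2 N = \<Lambda> N - \<Lambda>H1 N"

text \<open>
  \<open>\<alpha>\<close> and \<open>\<beta>\<close> express \<open>pd D m' n' u p\<close> (where \<open>n' \<ge> 2\<close>) through the derivatives of \<open>u\<close> of order
  at most one in \<open>y\<close> and the derivatives of \<open>f = - div (a grad u)\<close>, identically in \<open>u\<close>.
  For \<open>m' + n' \<le> M + 1\<close> the index sets do not depend on \<open>M\<close>, which is therefore not a parameter.
  The values outside the index sets are fixed to zero so that the pair \<open>(\<alpha>, \<beta>)\<close> is unique.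
\<close>

definition is_reduction ::
  "(real \<times> real) set \<Rightarrow> (real \<times> real \<Rightarrow> real) \<Rightarrow> real \<times> real \<Rightarrow> nat \<Rightarrow> nat \<Rightarrow>
   (nat \<Rightarrow> nat \<Rightarrow> real) \<Rightarrow> (nat \<Rightarrow> nat \<Rightarrow> real) \<Rightarrow> bool" where
  "is_reduction D a p m' n' \<alpha> \<beta> \<longleftrightarrow>
     (\<forall>m n. (m, n) \<notin> \<Lambda>H1 (m' + n') \<longrightarrow> \<alpha> m n = 0) \<and>
     (\<forall>m n. (m, n) \<notin> \<Lambda> (m' + n' - 2) \<longrightarrow> \<beta> m n = 0) \<and>
     (\<forall>u. smooth_near D p u \<longrightarrow>
        pd D m' n' u p =
          (\<Sum>(m, n) \<in> \<Lambda>H1 (m' + n'). \<alpha> m n * pd D m n u p) +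
          (\<Sum>(m, n) \<in> \<Lambda> (m' + n' - 2). \<beta> m n * pd D m n (source D a u) p))"

definition reduction ::
  "(real \<times> real) set \<Rightarrow> (real \<times> real \<Rightarrow> real) \<Rightarrow> real \<times> real \<Rightarrow> nat \<Rightarrow> nat \<Rightarrow>
   (nat \<Rightarrow> nat \<Rightarrow> real) \<times> (nat \<Rightarrow> nat \<Rightarrow> real)" where
  "reduction D a p m' n' = (THE z. is_reduction D a p m' n' (fst z) (snd z))"

definition AHu ::
  "(real \<times> real) set \<Rightarrow> (real \<times> real \<Rightarrow> real) \<Rightarrow> real \<times> real \<Rightarrow> nat \<Rightarrow> nat \<Rightarrow> nat \<Rightarrow> nat \<Rightarrow> real" where
  "AHu D a p m' n' m n = fst (reduction D a p m' n') m n"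

definition AHf ::
  "(real \<times> real) set \<Rightarrow> (real \<times> real \<Rightarrow> real) \<Rightarrow> real \<times> real \<Rightarrow> nat \<Rightarrow> nat \<Rightarrow> nat \<Rightarrow> nat \<Rightarrow> real" where
  "AHf D a p m' n' m n = snd (reduction D a p m' n') m n"

definition GH ::
  "(real \<times> real) set \<Rightarrow> (real \<times> real \<Rightarrow> real) \<Rightarrow> real \<times> real \<Rightarrow> nat \<Rightarrow> nat \<Rightarrow> nat \<Rightarrow> real \<Rightarrow> real \<Rightarrow> real" where
  "GH D a p M m n x y =
     (\<Sum>l = 0..m div 2.
        (- 1) ^ l * y ^ (n + 2 * l) * x ^ (m - 2 * l) / (fact (n + 2 * l) * fact (m - 2 * l))) +
     (\<Sum>(m', n') \<in> {(m', n') \<in> \<Lambda>H2 (M + 1). m + n < m' + n'}.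
        AHu D a p m' n' m n * (x ^ m' * y ^ n' / (fact m' * fact n')))"

definition QH ::
  "(real \<times> real) set \<Rightarrow> (real \<times> real \<Rightarrow> real) \<Rightarrow> real \<times> real \<Rightarrow> nat \<Rightarrow> nat \<Rightarrow> nat \<Rightarrow> real \<Rightarrow> real \<Rightarrow> real" where
  "QH D a p M m n x y =
     1 / a p * (\<Sum>l = 1..1 + m div 2.
        (- 1) ^ l * y ^ (n + 2 * l) * x ^ (m + 2 - 2 * l) / (fact (n + 2 * l) * fact (m + 2 - 2 * l))) +
     (\<Sum>(m', n') \<in> {(m', n') \<in> \<Lambda>H2 (M + 1). m + n + 2 < m' + n'}.
        AHf D a p m' n' m n * (x ^ m' * y ^ n' / (fact m' * fact n')))"


section \<open>Six-point schemes and their accuracy order\<close>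

definition nontrivial :: "(int \<Rightarrow> nat \<Rightarrow> real poly) \<Rightarrow> bool" where
  "nontrivial C \<longleftrightarrow> (\<exists>k \<in> {-1, 0, 1}. \<exists>l \<in> {0, 1}. poly (C k l) 0 \<noteq> 0)"

definition stencil_sum :: "(int \<Rightarrow> nat \<Rightarrow> real poly) \<Rightarrow> (real \<Rightarrow> real \<Rightarrow> real) \<Rightarrow> real \<Rightarrow> real" where
  "stencil_sum C v h =
     (\<Sum>k \<in> {-1, 0, 1}. \<Sum>l \<in> {0, 1}. poly (C k l) h * v (of_int k * h) (of_nat l * h))"

text \<open>
  The scheme at \<open>p\<close> with left-hand side coefficients \<open>C\<close> and right-hand side
  \<open>\<Sum>(m, n) \<in> I. f\<^sup>(\<^sup>m\<^sup>,\<^sup>n\<^sup>) cf m n h + \<Sum>n \<in> J. g\<^sub>3\<^sup>(\<^sup>n\<^sup>) cg n h\<close> has accuracy order \<open>q\<close>; the residual is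
  not divided by \<open>h\<close>, hence the exponent \<open>q + 1\<close>.
\<close>

definition scheme_has_order ::
  "(real \<times> real) set \<Rightarrow> (real \<times> real \<Rightarrow> real) \<Rightarrow> real \<times> real \<Rightarrow> (int \<Rightarrow> nat \<Rightarrow> real poly) \<Rightarrow>
   (nat \<times> nat) set \<Rightarrow> (nat \<Rightarrow> nat \<Rightarrow> real \<Rightarrow> real) \<Rightarrow> nat set \<Rightarrow> (nat \<Rightarrow> real \<Rightarrow> real) \<Rightarrow> nat \<Rightarrow> bool" where
  "scheme_has_order D a p C I cf J cg q \<longleftrightarrow>
     nontrivial C \<and> finite I \<and> finite J \<and>
     (\<forall>u. smooth_near D p u \<longrightarrow>
        (\<lambda>h. stencil_sum C (\<lambda>x y. u (fst p + x, snd p + y)) h -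
             ((\<Sum>(m, n) \<in> I. pd D m n (source D a u) p * cf m n h) +
              (\<Sum>n \<in> J. (deriv ^^ n) (g3 D (snd p) u) (fst p) * cg n h)))
          \<in> O[at_right 0](\<lambda>h. h ^ (q + 1)))"

definition order_attainable :: "(real \<times> real) set \<Rightarrow> real \<times> real \<Rightarrow> nat \<Rightarrow> bool" where
  "order_attainable D p q \<longleftrightarrow>
     (\<forall>a. pos_smooth_near D p a \<longrightarrow> (\<exists>C I cf J cg. scheme_has_order D a p C I cf J cg q))"

end

theory Submission
  imports Defs
begin

text \<open>
  Solved for \<open>u\<^sub>y\<^sub>y\<close>, the equation \<open>f = - div (a grad u)\<close> turns a second \<open>y\<close>-derivative of \<open>u\<close> into two
\<open>x\<close>-derivatives, terms of lower order, and \<open>f\<close>. Repeating this, every derivative of \<open>u\<close> at the base point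
\<open>p\<close> becomes a combination of the Cauchy data \<open>u\<^sup>(\<^sup>m\<^sup>,\<^sup>0\<^sup>)\<close>, \<open>u\<^sup>(\<^sup>m\<^sup>,\<^sup>1\<^sup>)\<close> and of derivatives of \<open>f\<close>, and the
coefficients are unique, because Cauchy data and source jet can be prescribed independently. Collecting terms,
the Taylor polynomial of \<open>u\<close> at \<open>p\<close> is \<open>\<Sum> u\<^sup>(\<^sup>m\<^sup>,\<^sup>n\<^sup>) G\<^sub>m\<^sub>,\<^sub>n + \<Sum> f\<^sup>(\<^sup>m\<^sup>,\<^sup>n\<^sup>) Q\<^sub>m\<^sub>,\<^sub>n\<close> with \<open>n \<le> 1\<close> in the first sum
(\<open>taylor_polynomial_reduced\<close>).

Order six: on \<open>\<Gamma>\<^sub>3\<close> the Neumann datum is \<open>g\<^sub>3\<^sup>(\<^sup>m\<^sup>) = - u\<^sup>(\<^sup>m\<^sup>,\<^sup>1\<^sup>)\<close>. The right-hand side of the scheme therefore removes the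
\<open>f\<close>-part and the \<open>u\<^sup>(\<^sup>m\<^sup>,\<^sup>1\<^sup>)\<close>-part exactly, and what remains are the stencil sums of \<open>G\<^sub>m\<^sub>,\<^sub>0\<close>, small by
hypothesis, and the Taylor remainder (\<open>consistency_order\<close>).

Such stencils exist for every \<open>a\<close>. To leading order \<open>G\<^sub>n\<^sub>,\<^sub>0(kh, lh)\<close> is \<open>h\<^sup>n Re \<zeta>\<^sup>n / n!\<close> with \<open>\<zeta> = k + il\<close>, so
order by order in \<open>h\<close> the coefficients of the stencil have to solve \<open>\<Sum> c Re \<zeta>\<^sup>n = r\<^sub>n\<close>. The equations for
\<open>n \<le> 4\<close> are always solvable. At order \<open>h\<^sup>0\<close> the homogeneous equations for \<open>n \<le> 6\<close> are solved by the half of the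
nine-point stencil of the Laplacian that results from reflection in the boundary. At order \<open>h\<^sup>1\<close> there is
one surplus equation, \<open>n = 5\<close>, whose left-hand side depends on those for \<open>n = 1\<close> and \<open>n = 3\<close>. That it is compatible
is a cancellation which only involves \<open>a\<^sub>x / a\<close> (\<open>residual_leading_stencil_next\<close>). From order \<open>h\<^sup>2\<close> on only
\<open>n \<le> 4\<close> occurs (\<open>six_point_coefficients_exist\<close>).

Order seven fails for \<open>a = 1 / (1 + y - l\<^sub>3)\<^sup>2\<close>, although it is attainable for constant \<open>a\<close>. With \<open>z = (x - x\<^sub>0) + i (y - l\<^sub>3)\<close>, the polynomials
\<open>(1 + y - l\<^sub>3) Re z\<^sup>n - Im z\<^sup>n\<^sup>+\<^sup>1 / (n + 1)\<close> have zero source and zero Neumann datum for this \<open>a\<close>, so a scheme with any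
right-hand side must annihilate them up to its order. At order \<open>h\<^sup>0\<close> they force the stencil to be a multiple of
the reflected nine-point stencil. On the six nodes \<open>Re \<zeta>\<^sup>6 = Re \<zeta>\<^sup>2\<close>, so the order-\<open>h\<^sup>1\<close> equations for \<open>n = 2\<close>
and \<open>n = 6\<close> contain the same unknowns; their difference makes the multiple zero (\<open>no_scheme_of_order_7\<close>).
\<close>

section \<open>Calculus on a neighbourhood of a point of the bottom side\<close>

locale bottom_side_point =
  fixes l\<^sub>1 l\<^sub>2 l\<^sub>3 l\<^sub>4 x\<^sub>0 :: real
  assumes left: "l\<^sub>1 < x\<^sub>0" and right: "x\<^sub>0 < l\<^sub>2" and height: "l\<^sub>3 < l\<^sub>4"
begin

definition D :: "(real \<times> real) set" where
  "D = {l\<^sub>1..l\<^sub>2} \<times> {l\<^sub>3..l\<^sub>4}"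

declare Ck_on.simps [simp del]

abbreviation p :: "real \<times> real" where
  "p \<equiv> (x\<^sub>0, l\<^sub>3)"

text \<open>
  The relatively open sets of \<open>D\<close> on which the calculus takes place. Staying away from the other three sides
  makes \<open>x\<close>-derivatives two-sided, and makes every point the lower left corner of a small square in the set.
\<close>

definition nbhd :: "(real \<times> real) set \<Rightarrow> bool" where
  "nbhd S \<longleftrightarrow> (\<exists>U. open U \<and> U \<subseteq> {l\<^sub>1<..<l\<^sub>2} \<times> {..<l\<^sub>4} \<and> p \<in> U \<and> S = U \<inter> D)"

text \<open>
  Smoothness on a fixed set. \<open>smooth_near\<close> is recovered in \<open>smooth_near_iff\<close>, and two functions smooth near
  \<open>p\<close> are smooth on a common set by intersection.
\<close>

definition smooth :: "(real \<times> real) set \<Rightarrow> (real \<times> real \<Rightarrow> real) \<Rightarrow> bool" where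
  "smooth S f \<longleftrightarrow> (\<forall>k. Ck_on D S k f)"

lemma nbhd_D: "nbhd S \<Longrightarrow> S \<subseteq> D" and nbhd_p: "nbhd S \<Longrightarrow> p \<in> S"
  using left right height by (auto simp: nbhd_def D_def)

lemma nbhd_bounds: "nbhd S \<Longrightarrow> (x, y) \<in> S \<Longrightarrow> l\<^sub>1 < x \<and> x < l\<^sub>2 \<and> l\<^sub>3 \<le> y \<and> y < l\<^sub>4"
  by (auto simp: nbhd_def D_def)

lemma D_nbhd: "nbhd S \<Longrightarrow> (x, y) \<in> S \<Longrightarrow> (x, y) \<in> D"
  by (auto simp: nbhd_def)

lemma nbhd_Int: "nbhd S \<Longrightarrow> nbhd T \<Longrightarrow> nbhd (S \<inter> T)"
  unfolding nbhd_def by (elim exE, rule_tac x="U \<inter> Ua" in exI) auto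

lemma slice_x: "(x, y) \<in> D \<Longrightarrow> {t. (t, y) \<in> D} = {l\<^sub>1..l\<^sub>2}"
  and slice_y: "(x, y) \<in> D \<Longrightarrow> {t. (x, t) \<in> D} = {l\<^sub>3..l\<^sub>4}"
  by (auto simp: D_def)

lemma dx_eqI:
  assumes "(x, y) \<in> D" "((\<lambda>t. f (t, y)) has_real_derivative v) (at x within {l\<^sub>1..l\<^sub>2})"
  shows "dx D f (x, y) = v"
proof -
  have "x \<in> {l\<^sub>1..l\<^sub>2}" "l\<^sub>1 < l\<^sub>2" using assms(1) left right by (auto simp: D_def)
  then show ?thesis
    using vector_derivative_within_closed_interval[of "l\<^sub>1" "l\<^sub>2" x "\<lambda>t. f (t, y)" v] assms(2)
    unfolding dx_def prod.case slice_x[OF assms(1)] has_real_derivative_iff_has_vector_derivative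
    by blast
qed

lemma dy_eqI:
  assumes "(x, y) \<in> D" "((\<lambda>t. f (x, t)) has_real_derivative v) (at y within {l\<^sub>3..l\<^sub>4})"
  shows "dy D f (x, y) = v"
proof -
  have "y \<in> {l\<^sub>3..l\<^sub>4}" using assms(1) by (auto simp: D_def)
  then show ?thesis
    using vector_derivative_within_closed_interval[of "l\<^sub>3" "l\<^sub>4" y "\<lambda>t. f (x, t)" v] assms(2) height
    unfolding dy_def prod.case slice_y[OF assms(1)] has_real_derivative_iff_has_vector_derivative
    by blast
qed

lemma nbhd_eventually:
  assumes "nbhd S" "(x, y) \<in> S"
  shows "eventually (\<lambda>t. t \<in> {l\<^sub>1..l\<^sub>2} \<longrightarrow> (t, y) \<in> S) (nhds x)"
    and "eventually (\<lambda>t. t \<in> {l\<^sub>3..l\<^sub>4} \<longrightarrow> (x, t) \<in> S) (nhds y)"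
proof -
  obtain U where U: "open U" "S = U \<inter> D" using assms by (auto simp: nbhd_def)
  then have "(x, y) \<in> U" "(x, y) \<in> D" using assms(2) by auto
  moreover have "open ((\<lambda>t. (t, y)) -` U)" "open ((\<lambda>t. (x, t)) -` U)"
    using U(1) by (auto intro!: open_vimage continuous_intros)
  ultimately have "eventually (\<lambda>t. (t, y) \<in> U) (nhds x)" "eventually (\<lambda>t. (x, t) \<in> U) (nhds y)"
    by (auto simp: eventually_nhds)
  then show "eventually (\<lambda>t. t \<in> {l\<^sub>1..l\<^sub>2} \<longrightarrow> (t, y) \<in> S) (nhds x)"
    "eventually (\<lambda>t. t \<in> {l\<^sub>3..l\<^sub>4} \<longrightarrow> (x, t) \<in> S) (nhds y)"
    using \<open>(x, y) \<in> D\<close> U(2) by (auto simp: D_def elim!: eventually_mono)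
qed

text \<open>
  One-sided derivatives are local, so functions that agree on a relatively open set have the same derivatives
  there. This is what allows a derivative to be replaced by a formula valid only on \<open>S\<close> and then be
  differentiated again.
\<close>

lemma dx_cong:
  assumes "nbhd S" "\<And>q. q \<in> S \<Longrightarrow> f q = g q" "q \<in> S"
  shows "dx D f q = dx D g q"
proof -
  obtain x y where q: "q = (x, y)" by force
  have "(x, y) \<in> D" using assms D_nbhd q by auto
  then have "vector_derivative (\<lambda>t. f (t, y)) (at x within {l\<^sub>1..l\<^sub>2})
      = vector_derivative (\<lambda>t. g (t, y)) (at x within {l\<^sub>1..l\<^sub>2})"
    using nbhd_eventually(1)[of S x y] assms q
    by (intro vector_derivative_cong_eq) (auto simp: D_def elim!: eventually_mono)
  then show ?thesis unfolding q dx_def prod.case slice_x[OF \<open>(x, y) \<in> D\<close>] .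
qed

lemma dy_cong:
  assumes "nbhd S" "\<And>q. q \<in> S \<Longrightarrow> f q = g q" "q \<in> S"
  shows "dy D f q = dy D g q"
proof -
  obtain x y where q: "q = (x, y)" by force
  have "(x, y) \<in> D" using assms D_nbhd q by auto
  then have "vector_derivative (\<lambda>t. f (x, t)) (at y within {l\<^sub>3..l\<^sub>4})
      = vector_derivative (\<lambda>t. g (x, t)) (at y within {l\<^sub>3..l\<^sub>4})"
    using nbhd_eventually(2)[of S x y] assms q
    by (intro vector_derivative_cong_eq) (auto simp: D_def elim!: eventually_mono)
  then show ?thesis unfolding q dy_def prod.case slice_y[OF \<open>(x, y) \<in> D\<close>] .
qed

lemma has_deriv_cong:
  assumes "nbhd S" "\<And>q. q \<in> S \<Longrightarrow> f q = g q" "(x, y) \<in> S"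
  shows "((\<lambda>t. f (t, y)) has_real_derivative v) (at x within {l\<^sub>1..l\<^sub>2}) \<longleftrightarrow>
         ((\<lambda>t. g (t, y)) has_real_derivative v) (at x within {l\<^sub>1..l\<^sub>2})"
    and "((\<lambda>t. f (x, t)) has_real_derivative v) (at y within {l\<^sub>3..l\<^sub>4}) \<longleftrightarrow>
         ((\<lambda>t. g (x, t)) has_real_derivative v) (at y within {l\<^sub>3..l\<^sub>4})"
proof -
  have "(x, y) \<in> D" using assms D_nbhd by auto
  then show "((\<lambda>t. f (t, y)) has_real_derivative v) (at x within {l\<^sub>1..l\<^sub>2}) \<longleftrightarrow>
         ((\<lambda>t. g (t, y)) has_real_derivative v) (at x within {l\<^sub>1..l\<^sub>2})"
      "((\<lambda>t. f (x, t)) has_real_derivative v) (at y within {l\<^sub>3..l\<^sub>4}) \<longleftrightarrow>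
         ((\<lambda>t. g (x, t)) has_real_derivative v) (at y within {l\<^sub>3..l\<^sub>4})"
    using nbhd_eventually[OF assms(1,3)] assms
    unfolding has_real_derivative_iff_has_vector_derivative
    by (intro has_vector_derivative_cong_ev; auto elim!: eventually_mono)+
qed

lemma Ck_on_has_deriv:
  assumes "nbhd S" "Ck_on D S (Suc k) f" "(x, y) \<in> S"
  shows "((\<lambda>t. f (t, y)) has_real_derivative dx D f (x, y)) (at x within {l\<^sub>1..l\<^sub>2})"
    and "((\<lambda>t. f (x, t)) has_real_derivative dy D f (x, y)) (at y within {l\<^sub>3..l\<^sub>4})"
proof -
  have D: "(x, y) \<in> D" using assms D_nbhd by auto
  have "(\<lambda>t. f (t, y)) differentiable (at x within {t. (t, y) \<in> D})"
    "(\<lambda>t. f (x, t)) differentiable (at y within {t. (x, t) \<in> D})"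
    using assms by (auto simp: Ck_on.simps)
  then show "((\<lambda>t. f (t, y)) has_real_derivative dx D f (x, y)) (at x within {l\<^sub>1..l\<^sub>2})"
    "((\<lambda>t. f (x, t)) has_real_derivative dy D f (x, y)) (at y within {l\<^sub>3..l\<^sub>4})"
    unfolding slice_x[OF D] slice_y[OF D] dx_def dy_def prod.case
      has_real_derivative_iff_has_vector_derivative vector_derivative_works by auto
qed

lemma Ck_on_Suc_slicesI:
  assumes S: "nbhd S" and cont: "continuous_on S f"
    and fx: "\<And>x y. (x, y) \<in> S \<Longrightarrow> ((\<lambda>t. f (t, y)) has_real_derivative fx (x, y)) (at x within {l\<^sub>1..l\<^sub>2})"
    and fy: "\<And>x y. (x, y) \<in> S \<Longrightarrow> ((\<lambda>t. f (x, t)) has_real_derivative fy (x, y)) (at y within {l\<^sub>3..l\<^sub>4})"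
    and dxk: "Ck_on D S k (dx D f)" and dyk: "Ck_on D S k (dy D f)"
  shows "Ck_on D S (Suc k) f"
proof -
  have "(\<lambda>t. f (t, y)) differentiable (at x within {t. (t, y) \<in> D}) \<and>
        (\<lambda>t. f (x, t)) differentiable (at y within {t. (x, t) \<in> D})" if "(x, y) \<in> S" for x y
  proof -
    have D: "(x, y) \<in> D" using that S D_nbhd by auto
    show ?thesis using fx[OF that] fy[OF that]
      unfolding slice_x[OF D] slice_y[OF D]
      by (auto simp: differentiable_def has_field_derivative_def)
  qed
  then show ?thesis using cont dxk dyk by (simp add: Ck_on.simps)
qed

lemma Ck_on_cong:
  assumes "nbhd S"
  shows "Ck_on D S k f \<Longrightarrow> (\<And>q. q \<in> S \<Longrightarrow> f q = g q) \<Longrightarrow> Ck_on D S k g"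
proof (induction k arbitrary: f g)
  case 0
  then show ?case using continuous_on_cong[of S S f g] by (simp add: Ck_on.simps)
next
  case (Suc k)
  have c: "continuous_on S g" using Suc.prems continuous_on_cong[of S S f g] by (simp add: Ck_on.simps)
  show ?case
  proof (rule Ck_on_Suc_slicesI[OF assms c])
    show "((\<lambda>t. g (t, y)) has_real_derivative dx D f (x, y)) (at x within {l\<^sub>1..l\<^sub>2})"
      "((\<lambda>t. g (x, t)) has_real_derivative dy D f (x, y)) (at y within {l\<^sub>3..l\<^sub>4})"
      if "(x, y) \<in> S" for x y
      using Ck_on_has_deriv[OF assms Suc.prems(1) that]
        has_deriv_cong[where f=f and g=g, OF assms _ that] Suc.prems(2) by auto
    show "Ck_on D S k (dx D g)" "Ck_on D S k (dy D g)"
      using Suc.IH[of "dx D f" "dx D g"] Suc.IH[of "dy D f" "dy D g"] Suc.prems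
        dx_cong[OF assms, of f g] dy_cong[OF assms, of f g] by (auto simp: Ck_on.simps(2))
  qed
qed


text \<open>
  The way in which smoothness is proved below: it suffices to exhibit the partial derivatives on \<open>S\<close>, since their
  values outside \<open>S\<close> are irrelevant.
\<close>

lemma Ck_on_SucI:
  assumes S: "nbhd S" and cont: "continuous_on S f"
    and fx: "\<And>x y. (x, y) \<in> S \<Longrightarrow> ((\<lambda>t. f (t, y)) has_real_derivative fx (x, y)) (at x within {l\<^sub>1..l\<^sub>2})"
    and fy: "\<And>x y. (x, y) \<in> S \<Longrightarrow> ((\<lambda>t. f (x, t)) has_real_derivative fy (x, y)) (at y within {l\<^sub>3..l\<^sub>4})"
    and "Ck_on D S k fx" and "Ck_on D S k fy"
  shows "Ck_on D S (Suc k) f"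
proof (rule Ck_on_Suc_slicesI[where f=f and fx=fx and fy=fy, OF S cont])
  have fxy: "fx (x, y) = dx D f (x, y)" "fy (x, y) = dy D f (x, y)" if "(x, y) \<in> S" for x y
    by (rule dx_eqI[OF D_nbhd[OF S that], of f "fx (x, y)", OF fx[OF that], symmetric],
        rule dy_eqI[OF D_nbhd[OF S that], of f "fy (x, y)", OF fy[OF that], symmetric])
  show "((\<lambda>t. f (t, y)) has_real_derivative fx (x, y)) (at x within {l\<^sub>1..l\<^sub>2})"
    "((\<lambda>t. f (x, t)) has_real_derivative fy (x, y)) (at y within {l\<^sub>3..l\<^sub>4})"
    if "(x, y) \<in> S" for x y
    using fx[OF that] fy[OF that] by simp_all
  show "Ck_on D S k (dx D f)"
    by (rule Ck_on_cong[OF S assms(5)]) (case_tac q, simp add: fxy(1))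
  show "Ck_on D S k (dy D f)"
    by (rule Ck_on_cong[OF S assms(6)]) (case_tac q, simp add: fxy(2))
qed

lemma Ck_on_pred: "Ck_on D S (Suc k) f \<Longrightarrow> Ck_on D S k f"
proof (induction k arbitrary: f)
  case (Suc k)
  then show ?case using Ck_on.simps(2)[of D S "Suc k" f] Ck_on.simps(2)[of D S k f] by blast
qed (simp add: Ck_on.simps)

lemma Ck_on_continuous: "Ck_on D S k f \<Longrightarrow> continuous_on S f"
  by (cases k) (auto simp: Ck_on.simps)

lemma Ck_on_mono: "Ck_on D S k f \<Longrightarrow> T \<subseteq> S \<Longrightarrow> Ck_on D T k f"
proof (induction k arbitrary: f)
  case 0
  then show ?case using continuous_on_subset by (simp add: Ck_on.simps) blast
next
  case (Suc k)
  then show ?case using continuous_on_subset[of S f T] by (auto simp: Ck_on.simps(2))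
qed

lemma Ck_on_const: "nbhd S \<Longrightarrow> Ck_on D S k (\<lambda>_. c)"
proof (induction k arbitrary: c)
  case (Suc k)
  show ?case
    by (rule Ck_on_SucI[where fx="\<lambda>_. 0" and fy="\<lambda>_. 0"])
       (use Suc in simp_all)
qed (simp add: Ck_on.simps)

lemma Ck_on_add: "nbhd S \<Longrightarrow> Ck_on D S k f \<Longrightarrow> Ck_on D S k g \<Longrightarrow> Ck_on D S k (\<lambda>q. f q + g q)"
proof (induction k arbitrary: f g)
  case (Suc k)
  show ?case
  proof (rule Ck_on_SucI[where fx="\<lambda>q. dx D f q + dx D g q" and fy="\<lambda>q. dy D f q + dy D g q"])
    show "continuous_on S (\<lambda>q. f q + g q)"
      using Suc.prems(2,3)[THEN Ck_on_continuous] by (rule continuous_on_add)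
    show "Ck_on D S k (\<lambda>q. dx D f q + dx D g q)" "Ck_on D S k (\<lambda>q. dy D f q + dy D g q)"
      using Suc.prems by (auto simp: Ck_on.simps(2) intro!: Suc.IH)
    fix x y assume xy: "(x, y) \<in> S"
    note d = Ck_on_has_deriv[OF Suc.prems(1,2) xy] Ck_on_has_deriv[OF Suc.prems(1,3) xy]
    show "((\<lambda>t. f (t, y) + g (t, y)) has_real_derivative dx D f (x, y) + dx D g (x, y)) (at x within {l\<^sub>1..l\<^sub>2})"
      "((\<lambda>t. f (x, t) + g (x, t)) has_real_derivative dy D f (x, y) + dy D g (x, y)) (at y within {l\<^sub>3..l\<^sub>4})"
      using DERIV_add[OF d(1,3)] DERIV_add[OF d(2,4)] by simp_all
  qed (rule Suc.prems(1))
qed (auto simp: Ck_on.simps intro: continuous_on_add)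

lemma Ck_on_mult: "nbhd S \<Longrightarrow> Ck_on D S k f \<Longrightarrow> Ck_on D S k g \<Longrightarrow> Ck_on D S k (\<lambda>q. f q * g q)"
proof (induction k arbitrary: f g)
  case (Suc k)
  note k = Suc.prems(2)[THEN Ck_on_pred] Suc.prems(3)[THEN Ck_on_pred]
  show ?case
  proof (rule Ck_on_SucI[where fx="\<lambda>q. dx D f q * g q + dx D g q * f q" and fy="\<lambda>q. dy D f q * g q + dy D g q * f q"])
    show "continuous_on S (\<lambda>q. f q * g q)"
      using Suc.prems(2,3)[THEN Ck_on_continuous] by (rule continuous_on_mult)
    show "Ck_on D S k (\<lambda>q. dx D f q * g q + dx D g q * f q)" "Ck_on D S k (\<lambda>q. dy D f q * g q + dy D g q * f q)"
      using Suc.prems k by (auto simp: Ck_on.simps(2) intro!: Suc.IH Ck_on_add)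
    fix x y assume xy: "(x, y) \<in> S"
    note d = Ck_on_has_deriv[OF Suc.prems(1,2) xy] Ck_on_has_deriv[OF Suc.prems(1,3) xy]
    show "((\<lambda>t. f (t, y) * g (t, y)) has_real_derivative dx D f (x, y) * g (x, y) + dx D g (x, y) * f (x, y)) (at x within {l\<^sub>1..l\<^sub>2})"
      "((\<lambda>t. f (x, t) * g (x, t)) has_real_derivative dy D f (x, y) * g (x, y) + dy D g (x, y) * f (x, y)) (at y within {l\<^sub>3..l\<^sub>4})"
      using DERIV_mult[OF d(1,3)] DERIV_mult[OF d(2,4)] by simp_all
  qed (rule Suc.prems(1))
qed (auto simp: Ck_on.simps intro: continuous_on_mult)

text \<open>
  The partial derivatives of \<open>1 / f\<close> are \<open>- (1 / f) f' (1 / f)\<close>, which the induction hypothesis for \<open>1 / f\<close> itself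
  covers.
\<close>

lemma Ck_on_inverse:
  "nbhd S \<Longrightarrow> (\<And>q. q \<in> S \<Longrightarrow> f q \<noteq> 0) \<Longrightarrow> Ck_on D S k f \<Longrightarrow> Ck_on D S k (\<lambda>q. inverse (f q))"
proof (induction k)
  case (Suc k)
  let ?i = "\<lambda>q. inverse (f q)"
  note k = Suc.IH[OF Suc.prems(1,2) Suc.prems(3)[THEN Ck_on_pred]]
  show ?case
  proof (rule Ck_on_SucI[where fx="\<lambda>q. - 1 * (?i q * dx D f q * ?i q)" and fy="\<lambda>q. - 1 * (?i q * dy D f q * ?i q)"])
    show "continuous_on S ?i"
      using Suc.prems(2) Suc.prems(3)[THEN Ck_on_continuous] by (intro continuous_on_inverse) auto
    show "Ck_on D S k (\<lambda>q. - 1 * (?i q * dx D f q * ?i q))" "Ck_on D S k (\<lambda>q. - 1 * (?i q * dy D f q * ?i q))"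
      using Suc.prems(1,3) k by (intro Ck_on_mult Ck_on_const; simp add: Ck_on.simps(2))+
    fix x y assume xy: "(x, y) \<in> S"
    note d = Ck_on_has_deriv[OF Suc.prems(1,3) xy]
    show "((\<lambda>t. ?i (t, y)) has_real_derivative - 1 * (?i (x, y) * dx D f (x, y) * ?i (x, y))) (at x within {l\<^sub>1..l\<^sub>2})"
      "((\<lambda>t. ?i (x, t)) has_real_derivative - 1 * (?i (x, y) * dy D f (x, y) * ?i (x, y))) (at y within {l\<^sub>3..l\<^sub>4})"
      using DERIV_inverse'[OF d(1)] DERIV_inverse'[OF d(2)] Suc.prems(2)[OF xy] by simp_all
  qed (rule Suc.prems(1))
qed (auto simp: Ck_on.simps intro: continuous_on_inverse)

lemma Ck_on_fst: "nbhd S \<Longrightarrow> Ck_on D S k fst"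
proof (cases k)
  case (Suc k)
  assume "nbhd S"
  then show ?thesis unfolding Suc
    by (intro Ck_on_SucI[where fx="\<lambda>_. 1" and fy="\<lambda>_. 0"] Ck_on_const) (auto intro: continuous_on_fst)
qed (auto simp: Ck_on.simps intro: continuous_on_fst)

lemma Ck_on_snd: "nbhd S \<Longrightarrow> Ck_on D S k snd"
proof (cases k)
  case (Suc k)
  assume "nbhd S"
  then show ?thesis unfolding Suc
    by (intro Ck_on_SucI[where fx="\<lambda>_. 0" and fy="\<lambda>_. 1"] Ck_on_const) (auto intro: continuous_on_snd)
qed (auto simp: Ck_on.simps intro: continuous_on_snd)

lemma smooth_const: "nbhd S \<Longrightarrow> smooth S (\<lambda>_. c)"
  and smooth_add: "nbhd S \<Longrightarrow> smooth S f \<Longrightarrow> smooth S g \<Longrightarrow> smooth S (\<lambda>q. f q + g q)"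
  and smooth_mult: "nbhd S \<Longrightarrow> smooth S f \<Longrightarrow> smooth S g \<Longrightarrow> smooth S (\<lambda>q. f q * g q)"
  and smooth_inverse: "nbhd S \<Longrightarrow> (\<And>q. q \<in> S \<Longrightarrow> f q \<noteq> 0) \<Longrightarrow> smooth S f \<Longrightarrow> smooth S (\<lambda>q. inverse (f q))"
  and smooth_fst: "nbhd S \<Longrightarrow> smooth S fst"
  and smooth_snd: "nbhd S \<Longrightarrow> smooth S snd"
  and smooth_mono: "smooth S f \<Longrightarrow> T \<subseteq> S \<Longrightarrow> smooth T f"
  unfolding smooth_def
         apply (simp add: Ck_on_const)
        apply (simp add: Ck_on_add)
       apply (simp add: Ck_on_mult)
      apply (simp add: Ck_on_inverse)
     apply (simp add: Ck_on_fst)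
    apply (simp add: Ck_on_snd)
  apply (meson Ck_on_mono)
  done

lemma smooth_cmult: "nbhd S \<Longrightarrow> smooth S f \<Longrightarrow> smooth S (\<lambda>q. c * f q)"
  by (intro smooth_mult smooth_const)

lemma smooth_dx: "smooth S f \<Longrightarrow> smooth S (dx D f)"
  and smooth_dy: "smooth S f \<Longrightarrow> smooth S (dy D f)"
  and smooth_continuous: "smooth S f \<Longrightarrow> continuous_on S f"
proof -
  show "smooth S (dx D f)" if "smooth S f"
    using that Ck_on.simps(2)[of D S _ f] by (simp add: smooth_def)
  show "smooth S (dy D f)" if "smooth S f"
    using that Ck_on.simps(2)[of D S _ f] by (simp add: smooth_def)
  show "continuous_on S f" if "smooth S f"
    using that Ck_on_continuous by (simp add: smooth_def)
qed

lemma smooth_has_deriv: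
  assumes "nbhd S" "smooth S f" "(x, y) \<in> S"
  shows "((\<lambda>t. f (t, y)) has_real_derivative dx D f (x, y)) (at x within {l\<^sub>1..l\<^sub>2})"
    and "((\<lambda>t. f (x, t)) has_real_derivative dy D f (x, y)) (at y within {l\<^sub>3..l\<^sub>4})"
  using Ck_on_has_deriv[OF assms(1) assms(2)[unfolded smooth_def, rule_format] assms(3)] by simp_all

text \<open>
  A neighbourhood on which a function is smooth may be shrunk until it misses the other sides.
\<close>

lemma smooth_near_iff: "smooth_near D p f \<longleftrightarrow> (\<exists>S. nbhd S \<and> smooth S f)"
proof
  assume "smooth_near D p f"
  then obtain U where U: "open U" "p \<in> U" "\<And>k. Ck_on D (U \<inter> D) k f"
    by (auto simp: smooth_near_def)
  let ?V = "U \<inter> ({l\<^sub>1<..<l\<^sub>2} \<times> {..<l\<^sub>4})"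
  have "nbhd (?V \<inter> D)" unfolding nbhd_def
    
    by (rule exI[of _ ?V]) (use U left right height in \<open>simp add: open_Times open_Int\<close>)
  moreover have "smooth (?V \<inter> D) f" unfolding smooth_def
    by (intro allI Ck_on_mono[OF U(3)]) auto
  ultimately show "\<exists>S. nbhd S \<and> smooth S f" by blast
next
  assume "\<exists>S. nbhd S \<and> smooth S f"
  then obtain S U where "smooth S f" "open U" "p \<in> U" "S = U \<inter> D" by (auto simp: nbhd_def)
  then show "smooth_near D p f" unfolding smooth_near_def smooth_def by blast
qed

end

section \<open>Symmetry of mixed derivatives and the Leibniz rule\<close>

text \<open>
  The induction step of the Leibniz rule: Pascal's rule, applied to sequences that stand for the iterated
  derivatives of the two factors.
\<close>

lemma binomial_convolution_Suc:
  fixes F G :: "nat \<Rightarrow> real"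
  shows "(\<Sum>s\<le>n. real (n choose s) * (F (Suc s) * G (n - s) + F s * G (Suc (n - s))))
       = (\<Sum>s\<le>Suc n. real (Suc n choose s) * (F s * G (Suc n - s)))"
proof -
  let ?T = "\<lambda>s. real (n choose Suc s) * (F (Suc s) * G (n - s))"
  have "(\<Sum>s\<le>n. real (n choose s) * (F s * G (Suc (n - s))))
      = (\<Sum>s\<le>n. real (n choose s) * (F s * G (Suc n - s)))"
    by (intro sum.cong) (auto simp: Suc_diff_le)
  also have "\<dots> = F 0 * G (Suc n) + (\<Sum>s<n. ?T s)"
    by (subst sum.atMost_shift) simp
  also have "(\<Sum>s<n. ?T s) = (\<Sum>s\<le>n. ?T s)"
    by (simp flip: lessThan_Suc_atMost)
  finally have "(\<Sum>s\<le>n. real (n choose s) * (F s * G (Suc (n - s)))) = F 0 * G (Suc n) + (\<Sum>s\<le>n. ?T s)" .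
  then show ?thesis
    by (subst sum.atMost_Suc_shift) (simp add: algebra_simps sum.distrib)
qed

lemma real_mvt_within:
  fixes f :: "real \<Rightarrow> real"
  assumes "a < b" "\<And>t. a \<le> t \<Longrightarrow> t \<le> b \<Longrightarrow> (f has_real_derivative f' t) (at t within {a..b})"
  shows "\<exists>t. a < t \<and> t < b \<and> f b - f a = f' t * (b - a)"
proof -
  have "\<exists>t\<in>{a<..<b}. f b - f a = (*) (f' t) (b - a)"
    using assms by (intro mvt_simple) (auto simp: has_field_derivative_def)
  then show ?thesis by auto
qed

context bottom_side_point
begin

text \<open>
  The square extends to the upper right of the point, hence lies in \<open>D\<close> also for points on the bottom side.
\<close>

lemma nbhd_contains_box:
  assumes "nbhd S" "(x, y) \<in> S" "0 < e"
  obtains \<delta> where "0 < \<delta>" "\<And>s t. 0 \<le> s \<Longrightarrow> s \<le> \<delta> \<Longrightarrow> 0 \<le> t \<Longrightarrow> t \<le> \<delta> \<Longrightarrow>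
    (x + s, y + t) \<in> S \<and> dist (x + s, y + t) (x, y) < e"
proof -
  obtain U where U: "open U" "U \<subseteq> {l\<^sub>1<..<l\<^sub>2} \<times> {..<l\<^sub>4}" "S = U \<inter> D"
    using assms(1) by (auto simp: nbhd_def)
  then obtain r where r: "0 < r" "ball (x, y) r \<subseteq> U"
    using assms(2) by (auto simp: open_contains_ball)
  (* The diagonal of the square has length at most 2 * \<delta>. *)
  define \<delta> where "\<delta> = min r e / 3"
  have pos: "0 < \<delta>" "2 * \<delta> < r" "2 * \<delta> < e" using r(1) assms(3) by (auto simp: \<delta>_def)
  have "(x + s, y + t) \<in> S \<and> dist (x + s, y + t) (x, y) < e"
    if st: "0 \<le> s" "s \<le> \<delta>" "0 \<le> t" "t \<le> \<delta>" for s t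
  proof -
    have "dist (x + s, y + t) (x, y) \<le> s + t"
      using sqrt_sum_squares_le_sum[of s t] st by (simp add: dist_Pair_Pair dist_real_def)
    then have d: "dist (x + s, y + t) (x, y) < r" "dist (x + s, y + t) (x, y) < e"
      using st pos by linarith+
    then have "(x + s, y + t) \<in> U" using r(2) by (auto simp: dist_commute)
    moreover have "(x + s, y + t) \<in> D"
      using U(2) nbhd_bounds[OF assms(1,2)] \<open>(x + s, y + t) \<in> U\<close> st by (force simp: D_def)
    ultimately show ?thesis using d U(3) by auto
  qed
  then show thesis using that pos(1) by blast
qed

text \<open>
  Schwarz's theorem up to the boundary. The mixed second difference of \<open>f\<close> over a square of side \<open>\<delta>\<close> equals
  \<open>\<delta>\<^sup>2\<close> times a value of \<open>\<partial>\<^sub>y\<partial>\<^sub>x f\<close> and also \<open>\<delta>\<^sup>2\<close> times a value of \<open>\<partial>\<^sub>x\<partial>\<^sub>y f\<close> in that square, by the mean value theorem in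
  either order. Both derivatives are continuous, so they agree at the corner.
\<close>

lemma dx_dy_commute:
  assumes S: "nbhd S" and f: "smooth S f" and q: "q \<in> S"
  shows "dx D (dy D f) q = dy D (dx D f) q"
proof (rule ccontr)
  obtain x y where xy: "q = (x, y)" by force
  define A where "A = dx D (dy D f) q"
  define B where "B = dy D (dx D f) q"
  assume "dx D (dy D f) q \<noteq> dy D (dx D f) q"
  then have e: "0 < \<bar>A - B\<bar> / 2" by (simp add: A_def B_def)
  have "continuous_on S (dx D (dy D f))" "continuous_on S (dy D (dx D f))"
    using f by (auto intro: smooth_continuous smooth_dx smooth_dy)
  then obtain d1 d2 where d1: "0 < d1" "\<And>q'. q' \<in> S \<Longrightarrow> dist q' q < d1 \<Longrightarrow> \<bar>dx D (dy D f) q' - A\<bar> < \<bar>A - B\<bar> / 2"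
    and d2: "0 < d2" "\<And>q'. q' \<in> S \<Longrightarrow> dist q' q < d2 \<Longrightarrow> \<bar>dy D (dx D f) q' - B\<bar> < \<bar>A - B\<bar> / 2"
    using e q unfolding continuous_on_iff A_def B_def dist_real_def by metis
  obtain \<delta> where \<delta>: "0 < \<delta>" and box: "\<And>s t. 0 \<le> s \<Longrightarrow> s \<le> \<delta> \<Longrightarrow> 0 \<le> t \<Longrightarrow> t \<le> \<delta> \<Longrightarrow>
    (x + s, y + t) \<in> S \<and> dist (x + s, y + t) (x, y) < min d1 d2"
    using nbhd_contains_box[OF S, of x y "min d1 d2"] q xy d1(1) d2(1) by auto
  have inS: "(s, t) \<in> S" and near: "dist (s, t) q < d1" "dist (s, t) q < d2"
    if "x \<le> s" "s \<le> x + \<delta>" "y \<le> t" "t \<le> y + \<delta>" for s t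
    using box[of "s - x" "t - y"] that xy by auto
  have sub: "{x..x+\<delta>} \<subseteq> {l\<^sub>1..l\<^sub>2}" "{y..y+\<delta>} \<subseteq> {l\<^sub>3..l\<^sub>4}"
    using nbhd_bounds[OF S inS, of x y] nbhd_bounds[OF S inS, of "x + \<delta>" "y + \<delta>"] \<delta> by auto
  have Dx: "((\<lambda>t. g (t, b)) has_real_derivative dx D g (s, b)) (at s within {x..x+\<delta>})"
    if "smooth S g" "x \<le> s" "s \<le> x + \<delta>" "y \<le> b" "b \<le> y + \<delta>" for g s b
    using smooth_has_deriv(1)[OF S that(1) inS[OF that(2-5)]] sub by (auto intro: DERIV_subset)
  have Dy: "((\<lambda>t. g (s, t)) has_real_derivative dy D g (s, b)) (at b within {y..y+\<delta>})"
    if "smooth S g" "x \<le> s" "s \<le> x + \<delta>" "y \<le> b" "b \<le> y + \<delta>" for g s b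
    using smooth_has_deriv(2)[OF S that(1) inS[OF that(2-5)]] sub by (auto intro: DERIV_subset)
  let ?diff = "f (x + \<delta>, y + \<delta>) - f (x + \<delta>, y) - (f (x, y + \<delta>) - f (x, y))"
  have "\<exists>\<xi>. x < \<xi> \<and> \<xi> < x + \<delta> \<and> (f (x + \<delta>, y + \<delta>) - f (x + \<delta>, y)) - (f (x, y + \<delta>) - f (x, y))
      = (dx D f (\<xi>, y + \<delta>) - dx D f (\<xi>, y)) * (x + \<delta> - x)"
    by (rule real_mvt_within[of x "x + \<delta>" "\<lambda>s. f (s, y + \<delta>) - f (s, y)"
        "\<lambda>s. dx D f (s, y + \<delta>) - dx D f (s, y)"]) (use \<delta> in \<open>simp_all add: DERIV_diff Dx[OF f]\<close>)
  then obtain \<xi> where \<xi>: "x < \<xi>" "\<xi> < x + \<delta>"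
    "?diff = (dx D f (\<xi>, y + \<delta>) - dx D f (\<xi>, y)) * \<delta>" by auto
  have "\<exists>\<eta>. y < \<eta> \<and> \<eta> < y + \<delta> \<and>
      dx D f (\<xi>, y + \<delta>) - dx D f (\<xi>, y) = dy D (dx D f) (\<xi>, \<eta>) * (y + \<delta> - y)"
    by (rule real_mvt_within) (use \<delta> \<xi> in \<open>simp_all add: Dy[OF smooth_dx[OF f]]\<close>)
  then obtain \<eta> where \<eta>: "y < \<eta>" "\<eta> < y + \<delta>"
    "dx D f (\<xi>, y + \<delta>) - dx D f (\<xi>, y) = dy D (dx D f) (\<xi>, \<eta>) * \<delta>" by auto
  have "\<exists>\<eta>. y < \<eta> \<and> \<eta> < y + \<delta> \<and> (f (x + \<delta>, y + \<delta>) - f (x, y + \<delta>)) - (f (x + \<delta>, y) - f (x, y))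
      = (dy D f (x + \<delta>, \<eta>) - dy D f (x, \<eta>)) * (y + \<delta> - y)"
    by (rule real_mvt_within[of y "y + \<delta>" "\<lambda>t. f (x + \<delta>, t) - f (x, t)"
        "\<lambda>t. dy D f (x + \<delta>, t) - dy D f (x, t)"]) (use \<delta> in \<open>simp_all add: DERIV_diff Dy[OF f]\<close>)
  then obtain \<eta>' where \<eta>': "y < \<eta>'" "\<eta>' < y + \<delta>"
    "?diff = (dy D f (x + \<delta>, \<eta>') - dy D f (x, \<eta>')) * \<delta>" by auto
  have "\<exists>\<xi>. x < \<xi> \<and> \<xi> < x + \<delta> \<and>
      dy D f (x + \<delta>, \<eta>') - dy D f (x, \<eta>') = dx D (dy D f) (\<xi>, \<eta>') * (x + \<delta> - x)"
    by (rule real_mvt_within) (use \<delta> \<eta>' in \<open>simp_all add: Dx[OF smooth_dy[OF f]]\<close>)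
  then obtain \<xi>' where \<xi>': "x < \<xi>'" "\<xi>' < x + \<delta>"
    "dy D f (x + \<delta>, \<eta>') - dy D f (x, \<eta>') = dx D (dy D f) (\<xi>', \<eta>') * \<delta>" by auto
  have "dy D (dx D f) (\<xi>, \<eta>) * \<delta> * \<delta> = dx D (dy D f) (\<xi>', \<eta>') * \<delta> * \<delta>"
    using \<xi>(3) \<eta>(3) \<eta>'(3) \<xi>'(3) by auto
  then have "dy D (dx D f) (\<xi>, \<eta>) = dx D (dy D f) (\<xi>', \<eta>')" using \<delta> by simp
  moreover have "\<bar>dy D (dx D f) (\<xi>, \<eta>) - B\<bar> < \<bar>A - B\<bar> / 2"
    using \<xi> \<eta> by (intro d2 inS near) auto
  moreover have "\<bar>dx D (dy D f) (\<xi>', \<eta>') - A\<bar> < \<bar>A - B\<bar> / 2"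
    using \<xi>' \<eta>' by (intro d1 inS near) auto
  ultimately show False using e by (smt (verit) field_sum_of_halves)
qed

text \<open>
  The rules that \<open>\<partial>\<^sub>x\<close> and \<open>\<partial>\<^sub>y\<close> share on \<open>S\<close>. Iterates, finite sums and the Leibniz rule are derived from them once for both.
\<close>

definition derivation :: "(real \<times> real) set \<Rightarrow> ((real \<times> real \<Rightarrow> real) \<Rightarrow> real \<times> real \<Rightarrow> real) \<Rightarrow> bool" where
  "derivation S d \<longleftrightarrow>
     (\<forall>f. smooth S f \<longrightarrow> smooth S (d f)) \<and>
     (\<forall>f g q. (\<forall>r\<in>S. f r = g r) \<longrightarrow> q \<in> S \<longrightarrow> d f q = d g q) \<and>
     (\<forall>c. \<forall>q\<in>S. d (\<lambda>_. c) q = 0) \<and>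
     (\<forall>f g. smooth S f \<longrightarrow> smooth S g \<longrightarrow> (\<forall>q\<in>S. d (\<lambda>q. f q + g q) q = d f q + d g q)) \<and>
     (\<forall>f g. smooth S f \<longrightarrow> smooth S g \<longrightarrow> (\<forall>q\<in>S. d (\<lambda>q. f q * g q) q = d f q * g q + f q * d g q))"

lemma derivation_dx: assumes S: "nbhd S" shows "derivation S (dx D)"
  unfolding derivation_def
proof (intro conjI allI impI ballI)
  fix f g q assume *: "smooth S f" "smooth S g" "q \<in> S"
  obtain x y where q: "q = (x, y)" by force
  note d = smooth_has_deriv(1)[OF S *(1), of x y] smooth_has_deriv(1)[OF S *(2), of x y]
  have D: "(x, y) \<in> D" using D_nbhd[OF S] * q by auto
  show "dx D (\<lambda>q. f q + g q) q = dx D f q + dx D g q" unfolding q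
    by (rule dx_eqI[OF D]) (use DERIV_add[OF d] * q in auto)
  show "dx D (\<lambda>q. f q * g q) q = dx D f q * g q + f q * dx D g q" unfolding q
    by (rule dx_eqI[OF D]) (use DERIV_mult[OF d] * q in \<open>auto simp: algebra_simps\<close>)
next
  fix c q assume "q \<in> S"
  moreover obtain x y where q: "q = (x, y)" by force
  ultimately show "dx D (\<lambda>_. c) q = 0" unfolding q
    by (intro dx_eqI D_nbhd[OF S]) auto
qed (use S in \<open>auto intro: smooth_dx dx_cong\<close>)

lemma derivation_dy: assumes S: "nbhd S" shows "derivation S (dy D)"
  unfolding derivation_def
proof (intro conjI allI impI ballI)
  fix f g q assume *: "smooth S f" "smooth S g" "q \<in> S"
  obtain x y where q: "q = (x, y)" by force
  note d = smooth_has_deriv(2)[OF S *(1), of x y] smooth_has_deriv(2)[OF S *(2), of x y]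
  have D: "(x, y) \<in> D" using D_nbhd[OF S] * q by auto
  show "dy D (\<lambda>q. f q + g q) q = dy D f q + dy D g q" unfolding q
    by (rule dy_eqI[OF D]) (use DERIV_add[OF d] * q in auto)
  show "dy D (\<lambda>q. f q * g q) q = dy D f q * g q + f q * dy D g q" unfolding q
    by (rule dy_eqI[OF D]) (use DERIV_mult[OF d] * q in \<open>auto simp: algebra_simps\<close>)
next
  fix c q assume "q \<in> S"
  moreover obtain x y where q: "q = (x, y)" by force
  ultimately show "dy D (\<lambda>_. c) q = 0" unfolding q
    by (intro dy_eqI D_nbhd[OF S]) auto
qed (use S in \<open>auto intro: smooth_dy dy_cong\<close>)

context
  fixes S d
  assumes S: "nbhd S" and d: "derivation S d"
begin

lemma derivation_cong: "(\<And>r. r \<in> S \<Longrightarrow> f r = g r) \<Longrightarrow> q \<in> S \<Longrightarrow> d f q = d g q"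
  using d unfolding derivation_def by blast

lemma derivation_iter_smooth: "smooth S f \<Longrightarrow> smooth S ((d ^^ n) f)"
  using d by (induction n) (auto simp: derivation_def)

lemma derivation_iter_cong:
  "(\<And>r. r \<in> S \<Longrightarrow> f r = g r) \<Longrightarrow> q \<in> S \<Longrightarrow> (d ^^ n) f q = (d ^^ n) g q"
proof (induction n arbitrary: q)
  case (Suc n)
  then show ?case by (simp add: derivation_cong[of "(d ^^ n) f" "(d ^^ n) g"])
qed simp

lemma derivation_cmult: "smooth S f \<Longrightarrow> q \<in> S \<Longrightarrow> d (\<lambda>q. c * f q) q = c * d f q"
  using d smooth_const[OF S] by (simp add: derivation_def)

lemma derivation_sum:
  "finite I \<Longrightarrow> (\<And>i. i \<in> I \<Longrightarrow> smooth S (F i)) \<Longrightarrow>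
    smooth S (\<lambda>q. \<Sum>i\<in>I. F i q) \<and> (\<forall>q\<in>S. d (\<lambda>q. \<Sum>i\<in>I. F i q) q = (\<Sum>i\<in>I. d (F i) q))"
proof (induction I rule: finite_induct)
  case empty
  then show ?case using d smooth_const[OF S] by (simp add: derivation_def)
next
  case (insert i I)
  then show ?case using d smooth_add[OF S, of "F i" "\<lambda>q. \<Sum>i\<in>I. F i q"]
    by (simp add: derivation_def)
qed

lemma derivation_iter_cmult:
  "smooth S f \<Longrightarrow> q \<in> S \<Longrightarrow> (d ^^ n) (\<lambda>q. c * f q) q = c * (d ^^ n) f q"
proof (induction n arbitrary: q)
  case (Suc n)
  have "d ((d ^^ n) (\<lambda>q. c * f q)) q = d (\<lambda>q. c * (d ^^ n) f q) q"
    using Suc by (intro derivation_cong) simp_all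
  then show ?case using Suc.prems derivation_cmult derivation_iter_smooth by simp
qed simp

lemma derivation_iter_sum:
  "finite I \<Longrightarrow> (\<And>i. i \<in> I \<Longrightarrow> smooth S (F i)) \<Longrightarrow> q \<in> S \<Longrightarrow>
    (d ^^ n) (\<lambda>q. \<Sum>i\<in>I. F i q) q = (\<Sum>i\<in>I. (d ^^ n) (F i) q)"
proof (induction n arbitrary: q)
  case (Suc n)
  have "d ((d ^^ n) (\<lambda>q. \<Sum>i\<in>I. F i q)) q = d (\<lambda>q. \<Sum>i\<in>I. (d ^^ n) (F i) q) q"
    using Suc by (intro derivation_cong) simp_all
  then show ?case using derivation_sum[of I "\<lambda>i. (d ^^ n) (F i)"] Suc.prems derivation_iter_smooth by simp
qed simp

lemma derivation_iter_add:
  assumes "smooth S f" "smooth S g" "q \<in> S"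
  shows "(d ^^ n) (\<lambda>q. f q + g q) q = (d ^^ n) f q + (d ^^ n) g q"
  using derivation_iter_sum[of "{True, False}" "\<lambda>b. if b then f else g" q n] assms by simp

lemma derivation_leibniz:
  assumes f: "smooth S f" and g: "smooth S g" and "q \<in> S"
  shows "(d ^^ n) (\<lambda>q. f q * g q) q
       = (\<Sum>s\<le>n. real (n choose s) * ((d ^^ s) f q * (d ^^ (n - s)) g q))"
  using \<open>q \<in> S\<close>
proof (induction n arbitrary: q)
  case (Suc n)
  let ?F = "\<lambda>s q. real (n choose s) * ((d ^^ s) f q * (d ^^ (n - s)) g q)"
  have sm: "smooth S (\<lambda>q. (d ^^ s) f q * (d ^^ (n - s)) g q)" for s
    using f g by (intro smooth_mult[OF S] derivation_iter_smooth)
  then have smF: "smooth S (?F s)" for s by (rule smooth_cmult[OF S])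
  have "(d ^^ Suc n) (\<lambda>q. f q * g q) q = d (\<lambda>q. \<Sum>s\<le>n. ?F s q) q"
    using Suc by (simp add: derivation_cong[of "(d ^^ n) (\<lambda>q. f q * g q)"])
  also have "\<dots> = (\<Sum>s\<le>n. d (?F s) q)"
    using derivation_sum[of "{..n}" ?F] smF Suc.prems by simp
  also have "\<dots> = (\<Sum>s\<le>n. real (n choose s) *
      ((d ^^ Suc s) f q * (d ^^ (n - s)) g q + (d ^^ s) f q * (d ^^ Suc (n - s)) g q))"
    using d Suc.prems sm derivation_iter_smooth[OF f] derivation_iter_smooth[OF g]
    by (intro sum.cong refl) (simp add: derivation_cmult derivation_def)
  also have "\<dots> = (\<Sum>s\<le>Suc n. real (Suc n choose s) * ((d ^^ s) f q * (d ^^ (Suc n - s)) g q))"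
    by (rule binomial_convolution_Suc)
  finally show ?case .
qed simp

end

end

section \<open>Jets of the source term, Neumann data and Taylor remainders\<close>

text \<open>
  The derivatives of \<open>- div (a grad u)\<close> at a point, as a function of the jets \<open>A\<close> of \<open>a\<close> and \<open>U\<close> of \<open>u\<close>: the Leibniz rule for
  \<open>\<partial>\<^sub>x\<^sup>i\<^sup>+\<^sup>1\<partial>\<^sub>y\<^sup>j (a u\<^sub>x) + \<partial>\<^sub>x\<^sup>i\<partial>\<^sub>y\<^sup>j\<^sup>+\<^sup>1 (a u\<^sub>y)\<close>. It makes the elimination of normal derivatives a matter of linear algebra.
\<close>

definition jet_source :: "(nat \<Rightarrow> nat \<Rightarrow> real) \<Rightarrow> (nat \<Rightarrow> nat \<Rightarrow> real) \<Rightarrow> nat \<Rightarrow> nat \<Rightarrow> real" where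
  "jet_source A U i j =
     - ((\<Sum>r\<le>Suc i. \<Sum>s\<le>j. real (Suc i choose r) * real (j choose s) * (A r s * U (Suc (Suc i - r)) (j - s))) +
        (\<Sum>r\<le>i. \<Sum>s\<le>Suc j. real (i choose r) * real (Suc j choose s) * (A r s * U (i - r) (Suc (Suc j - s)))))"

lemma sum_\<Lambda>: "(\<Sum>(m, n)\<in>\<Lambda> N. g m n) = (\<Sum>n\<le>N. \<Sum>m\<le>N - n. g m n)"
proof -
  have "(\<Sum>n\<le>N. \<Sum>m\<le>N - n. g m n) = (\<Sum>(n, m)\<in>(SIGMA n:{..N}. {..N - n}). g m n)"
    by (subst sum.Sigma) auto
  also have "\<dots> = (\<Sum>(m, n)\<in>\<Lambda> N. g m n)"
    by (rule sum.reindex_bij_witness[of _ "\<lambda>(m, n). (n, m)" "\<lambda>(m, n). (n, m)"]) (auto simp: \<Lambda>_def)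
  finally show ?thesis ..
qed

context bottom_side_point
begin

lemma pd_smooth: "nbhd S \<Longrightarrow> smooth S f \<Longrightarrow> smooth S (pd D m n f)"
  unfolding pd_def
  by (intro derivation_iter_smooth[OF _ derivation_dx] derivation_iter_smooth[OF _ derivation_dy])

lemma pd_cong: "nbhd S \<Longrightarrow> (\<And>r. r \<in> S \<Longrightarrow> f r = g r) \<Longrightarrow> q \<in> S \<Longrightarrow> pd D m n f q = pd D m n g q"
  unfolding pd_def
  by (intro derivation_iter_cong[OF _ derivation_dx] derivation_iter_cong[OF _ derivation_dy])

lemma pd_add:
  assumes S: "nbhd S" and "smooth S f" "smooth S g" "q \<in> S"
  shows "pd D m n (\<lambda>q. f q + g q) q = pd D m n f q + pd D m n g q"
proof -
  have "pd D m n (\<lambda>q. f q + g q) q = (dx D ^^ m) (\<lambda>q. (dy D ^^ n) f q + (dy D ^^ n) g q) q"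
    unfolding pd_def using assms
    by (intro derivation_iter_cong[OF S derivation_dx[OF S]]
        derivation_iter_add[OF S derivation_dy[OF S]])
  then show ?thesis unfolding pd_def using assms
    by (simp add: derivation_iter_add[OF S derivation_dx[OF S]]
        derivation_iter_smooth[OF S derivation_dy[OF S]])
qed

lemma pd_cmult:
  assumes S: "nbhd S" and "smooth S f" "q \<in> S"
  shows "pd D m n (\<lambda>q. c * f q) q = c * pd D m n f q"
proof -
  have "pd D m n (\<lambda>q. c * f q) q = (dx D ^^ m) (\<lambda>q. c * (dy D ^^ n) f q) q"
    unfolding pd_def using assms
    by (intro derivation_iter_cong[OF S derivation_dx[OF S]]
        derivation_iter_cmult[OF S derivation_dy[OF S]])
  then show ?thesis unfolding pd_def using assms
    by (simp add: derivation_iter_cmult[OF S derivation_dx[OF S]]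
        derivation_iter_smooth[OF S derivation_dy[OF S]])
qed

lemma pd_mult:
  assumes S: "nbhd S" and f: "smooth S f" and g: "smooth S g" and q: "q \<in> S"
  shows "pd D m n (\<lambda>q. f q * g q) q = (\<Sum>r\<le>m. \<Sum>s\<le>n. real (m choose r) * real (n choose s) *
           (pd D r s f q * pd D (m - r) (n - s) g q))"
proof -
  note dx = derivation_dx[OF S] and dy = derivation_dy[OF S]
  let ?F = "\<lambda>s q. (dy D ^^ s) f q * (dy D ^^ (n - s)) g q"
  have sm: "smooth S ((dy D ^^ s) f)" "smooth S ((dy D ^^ s) g)" for s
    using f g derivation_iter_smooth[OF S dy] by auto
  have smF: "smooth S (?F s)" for s using sm by (rule smooth_mult[OF S])
  have "pd D m n (\<lambda>q. f q * g q) q = (dx D ^^ m) (\<lambda>q. \<Sum>s\<le>n. real (n choose s) * ?F s q) q"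
    unfolding pd_def
    by (rule derivation_iter_cong[OF S dx _ q]) (rule derivation_leibniz[OF S dy f g])
  also have "\<dots> = (\<Sum>s\<le>n. real (n choose s) * (dx D ^^ m) (?F s) q)"
    using smF by (simp add: derivation_iter_sum[OF S dx _ _ q] derivation_iter_cmult[OF S dx _ q] smooth_cmult[OF S])
  also have "\<dots> = (\<Sum>s\<le>n. \<Sum>r\<le>m. real (m choose r) * real (n choose s) *
           (pd D r s f q * pd D (m - r) (n - s) g q))"
    by (simp add: derivation_leibniz[OF S dx sm q] pd_def sum_distrib_left mult_ac)
  also have "\<dots> = (\<Sum>r\<le>m. \<Sum>s\<le>n. real (m choose r) * real (n choose s) *
           (pd D r s f q * pd D (m - r) (n - s) g q))"
    by (rule sum.swap)
  finally show ?thesis .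
qed

lemma pd_dy: "pd D m n (dy D f) = pd D m (Suc n) f"
  by (simp add: pd_def funpow_swap1)

text \<open>
  \<open>pd\<close> takes the \<open>y\<close>-derivatives first, so an inner \<open>\<partial>\<^sub>x\<close> has to be moved past all of them.
\<close>

lemma pd_dx:
  assumes S: "nbhd S" and f: "smooth S f" and q: "q \<in> S"
  shows "pd D m n (dx D f) q = pd D (Suc m) n f q"
proof -
  have "(dy D ^^ n) (dx D f) r = dx D ((dy D ^^ n) f) r" if "r \<in> S" for r
    using that
  proof (induction n arbitrary: r)
    case (Suc n)
    have "(dy D ^^ Suc n) (dx D f) r = dy D ((dy D ^^ n) (dx D f)) r" by simp
    also have "\<dots> = dy D (dx D ((dy D ^^ n) f)) r"
      by (rule dy_cong[OF S Suc.IH Suc.prems])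
    also have "\<dots> = dx D (dy D ((dy D ^^ n) f)) r"
      by (rule dx_dy_commute[OF S derivation_iter_smooth[OF S derivation_dy[OF S] f] Suc.prems, symmetric])
    finally show ?case by simp
  qed simp
  then have "pd D m n (dx D f) q = (dx D ^^ m) (dx D ((dy D ^^ n) f)) q"
    unfolding pd_def by (rule derivation_iter_cong[OF S derivation_dx[OF S] _ q])
  then show ?thesis by (simp add: pd_def funpow_swap1)
qed

lemma pd_source:
  assumes S: "nbhd S" and a: "smooth S a" and u: "smooth S u"
  shows "pd D i j (source D a u) p = jet_source (\<lambda>r s. pd D r s a p) (\<lambda>m n. pd D m n u p) i j"
proof -
  let ?v = "\<lambda>q. a q * dx D u q" and ?w = "\<lambda>q. a q * dy D u q"
  have sm: "smooth S ?v" "smooth S ?w" using a u by (auto intro!: smooth_mult S smooth_dx smooth_dy)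
  have "source D a u = (\<lambda>q. - 1 * (dx D ?v q + dy D ?w q))"
    by (rule ext) (simp add: source_def)
  then have "pd D i j (source D a u) p = pd D i j (\<lambda>q. - 1 * (dx D ?v q + dy D ?w q)) p"
    by (rule arg_cong)
  also have "\<dots> = - 1 * pd D i j (\<lambda>q. dx D ?v q + dy D ?w q) p"
    by (rule pd_cmult[OF S smooth_add[OF S smooth_dx[OF sm(1)] smooth_dy[OF sm(2)]] nbhd_p[OF S]])
  also have "pd D i j (\<lambda>q. dx D ?v q + dy D ?w q) p = pd D i j (dx D ?v) p + pd D i j (dy D ?w) p"
    by (rule pd_add[OF S smooth_dx[OF sm(1)] smooth_dy[OF sm(2)] nbhd_p[OF S]])
  also have "- 1 * \<dots> = - (pd D i j (dx D ?v) p + pd D i j (dy D ?w) p)" by simp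
  also have "\<dots> = - (pd D (Suc i) j ?v p + pd D i (Suc j) ?w p)"
    unfolding pd_dy by (subst pd_dx[OF S sm(1) nbhd_p[OF S]]) (rule refl)
  also have "\<dots> = jet_source (\<lambda>r s. pd D r s a p) (\<lambda>m n. pd D m n u p) i j"
    unfolding jet_source_def pd_mult[OF S a smooth_dx[OF u] nbhd_p[OF S]]
      pd_mult[OF S a smooth_dy[OF u] nbhd_p[OF S]] pd_dy
    by (subst pd_dx[OF S u nbhd_p[OF S]]) (rule refl)
  finally show ?thesis .
qed

text \<open>
  The outward normal points downwards, which gives the sign. The \<open>x\<close>-derivatives along the bottom side are two-sided.
\<close>

lemma higher_deriv_g3:
  assumes S: "nbhd S" and u: "smooth S u" and "(x, l\<^sub>3) \<in> S"
  shows "(deriv ^^ n) (g3 D l\<^sub>3 u) x = - pd D n 1 u (x, l\<^sub>3)"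
  using assms(3)
proof (induction n arbitrary: x)
  case 0
  then show ?case by (simp add: g3_def normal_deriv_def pd_def)
next
  case (Suc n)
  have x: "l\<^sub>1 < x" "x < l\<^sub>2" using nbhd_bounds[OF S Suc.prems] by auto
  have "eventually (\<lambda>t. t \<in> {l\<^sub>1<..<l\<^sub>2}) (nhds x)" using x by (intro eventually_nhds_in_open) auto
  then have ev: "eventually (\<lambda>t. (t, l\<^sub>3) \<in> S) (nhds x)"
    using nbhd_eventually(1)[OF S Suc.prems] by eventually_elim auto
  have "((\<lambda>t. pd D n 1 u (t, l\<^sub>3)) has_real_derivative dx D (pd D n 1 u) (x, l\<^sub>3)) (at x)"
    using smooth_has_deriv(1)[OF S pd_smooth[OF S u] Suc.prems] x by (simp add: at_within_Icc_at)
  then have "deriv (\<lambda>t. - pd D n 1 u (t, l\<^sub>3)) x = - dx D (pd D n 1 u) (x, l\<^sub>3)"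
    by (intro DERIV_imp_deriv DERIV_minus)
  moreover have "deriv ((deriv ^^ n) (g3 D l\<^sub>3 u)) x = deriv (\<lambda>t. - pd D n 1 u (t, l\<^sub>3)) x"
    using ev Suc.IH by (intro deriv_cong_ev) (auto elim!: eventually_mono)
  ultimately show ?case by (simp add: pd_def)
qed

lemma nbhd_contains_box_at_p:
  assumes "nbhd S"
  obtains \<delta> where "0 < \<delta>" "{x\<^sub>0 - \<delta>..x\<^sub>0 + \<delta>} \<times> {l\<^sub>3..l\<^sub>3 + \<delta>} \<subseteq> S"
proof -
  obtain U where U: "open U" "p \<in> U" "U \<subseteq> {l\<^sub>1<..<l\<^sub>2} \<times> {..<l\<^sub>4}" "S = U \<inter> D"
    using assms unfolding nbhd_def by blast
  obtain A B where AB: "open A" "open B" "p \<in> A \<times> B" "A \<times> B \<subseteq> U"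
    using open_prod_elim[OF U(1,2)] by blast
  then have "x\<^sub>0 \<in> A" "l\<^sub>3 \<in> B" by auto
  then obtain r1 r2 where r: "0 < r1" "cball x\<^sub>0 r1 \<subseteq> A" "0 < r2" "cball l\<^sub>3 r2 \<subseteq> B"
    using AB(1,2) unfolding open_contains_cball by blast
  let ?\<delta> = "min r1 r2"
  have "{x\<^sub>0 - ?\<delta>..x\<^sub>0 + ?\<delta>} \<subseteq> cball x\<^sub>0 r1" "{l\<^sub>3..l\<^sub>3 + ?\<delta>} \<subseteq> cball l\<^sub>3 r2"
    by (auto simp: dist_real_def)
  then have "{x\<^sub>0 - ?\<delta>..x\<^sub>0 + ?\<delta>} \<times> {l\<^sub>3..l\<^sub>3 + ?\<delta>} \<subseteq> A \<times> B"
    using r by (intro Sigma_mono) auto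
  also note AB(4)
  finally have "{x\<^sub>0 - ?\<delta>..x\<^sub>0 + ?\<delta>} \<times> {l\<^sub>3..l\<^sub>3 + ?\<delta>} \<subseteq> U" .
  moreover from this have "{x\<^sub>0 - ?\<delta>..x\<^sub>0 + ?\<delta>} \<times> {l\<^sub>3..l\<^sub>3 + ?\<delta>} \<subseteq> D"
  proof (intro subsetI)
    fix q assume q: "q \<in> {x\<^sub>0 - ?\<delta>..x\<^sub>0 + ?\<delta>} \<times> {l\<^sub>3..l\<^sub>3 + ?\<delta>}"
    then have "q \<in> {l\<^sub>1<..<l\<^sub>2} \<times> {..<l\<^sub>4}" using calculation U(3) by (meson subsetD)
    then show "q \<in> D" using q by (auto simp: D_def)
  qed
  ultimately show thesis using that[of ?\<delta>] r U(4) by simp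
qed

text \<open>
  Taylor's formula at a boundary point along a ray into the domain. Expanding first in \<open>y\<close> and then each
  \<open>y\<close>-derivative in \<open>x\<close> uses the one-dimensional formula only, and produces the derivatives in the order \<open>\<partial>\<^sub>x\<^sup>m\<partial>\<^sub>y\<^sup>n\<close>
  of \<open>pd\<close>. All \<open>N + 2\<close> remainders are controlled by a bound of the derivatives of order \<open>N + 1\<close> over a compact box.
\<close>

lemma taylor_remainder:
  fixes k l :: real
  assumes S: "nbhd S" and u: "smooth S u" and k: "\<bar>k\<bar> \<le> 1" and l: "0 \<le> l" "l \<le> 1"
  shows "(\<lambda>h. u (x\<^sub>0 + k * h, l\<^sub>3 + l * h) -
            (\<Sum>(m, n)\<in>\<Lambda> N. pd D m n u p * ((k * h) ^ m * (l * h) ^ n / (fact m * fact n))))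
         \<in> O[at_right 0](\<lambda>h. h ^ (N + 1))"
proof -
  obtain \<delta> where \<delta>: "0 < \<delta>" and box: "{x\<^sub>0 - \<delta>..x\<^sub>0 + \<delta>} \<times> {l\<^sub>3..l\<^sub>3 + \<delta>} \<subseteq> S"
    using nbhd_contains_box_at_p[OF S] .
  let ?X = "{x\<^sub>0 - \<delta>..x\<^sub>0 + \<delta>}" and ?Y = "{l\<^sub>3..l\<^sub>3 + \<delta>}"
  have sub: "?X \<subseteq> {l\<^sub>1..l\<^sub>2}" "?Y \<subseteq> {l\<^sub>3..l\<^sub>4}"
  proof -
    have "(x\<^sub>0 - \<delta>, l\<^sub>3 + \<delta>) \<in> D" "(x\<^sub>0 + \<delta>, l\<^sub>3 + \<delta>) \<in> D"
      by (rule subsetD[OF nbhd_D[OF S]], rule subsetD[OF box], use \<delta> in simp)+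
    then show "?X \<subseteq> {l\<^sub>1..l\<^sub>2}" "?Y \<subseteq> {l\<^sub>3..l\<^sub>4}" by (auto simp: D_def)
  qed
  (* The sum dominates every derivative of order N + 1 and is continuous, hence bounded on the box. *)
  let ?\<phi> = "\<lambda>q. \<Sum>n\<le>Suc N. \<bar>pd D (Suc N - n) n u q\<bar>"
  have "continuous_on (?X \<times> ?Y) ?\<phi>"
    by (intro continuous_intros continuous_on_subset[OF smooth_continuous box] pd_smooth S u)
  then have "bounded (?\<phi> ` (?X \<times> ?Y))"
    by (intro compact_imp_bounded compact_continuous_image compact_Times) auto
  then obtain B where B: "\<And>q. q \<in> ?X \<times> ?Y \<Longrightarrow> \<bar>?\<phi> q\<bar> \<le> B"
    unfolding bounded_iff by auto
  have bnd: "\<bar>pd D m n u q\<bar> \<le> B" if "m + n = Suc N" "q \<in> ?X \<times> ?Y" for m n q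
  proof -
    have m: "m = Suc N - n" "n \<le> Suc N" using that by auto
    have "\<bar>pd D m n u q\<bar> \<le> ?\<phi> q"
      unfolding m(1) by (rule member_le_sum[of n "{..Suc N}" "\<lambda>n. \<bar>pd D (Suc N - n) n u q\<bar>"]) (use m in auto)
    then show ?thesis using B[OF that(2)] by linarith
  qed
  have "0 \<le> \<bar>pd D 0 (Suc N) u p\<bar>" by simp
  also have "\<dots> \<le> B" using \<delta> by (intro bnd) auto
  finally have B0: "0 \<le> B" .
  have main: "\<bar>u (x\<^sub>0 + k * h, l\<^sub>3 + l * h) -
            (\<Sum>(m, n)\<in>\<Lambda> N. pd D m n u p * ((k * h) ^ m * (l * h) ^ n / (fact m * fact n)))\<bar>
         \<le> B * (N + 2) * h ^ (N + 1)" if h: "0 < h" "h < \<delta>" for h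
  proof -
    let ?x = "x\<^sub>0 + k * h" and ?y = "l\<^sub>3 + l * h"
    have kh: "\<bar>k * h\<bar> \<le> h" and lh: "0 \<le> l * h" "l * h \<le> h"
      using k l h by (auto simp: abs_mult intro: mult_left_le_one_le)
    then have xy: "?x \<in> ?X" "?y \<in> ?Y" "x\<^sub>0 \<in> ?X" "l\<^sub>3 \<in> ?Y"
      using h \<delta> unfolding atLeastAtMost_iff abs_le_iff by linarith+
    have 1: "norm (pd D 0 0 u (?x, ?y) - (\<Sum>n\<le>N. pd D 0 n u (?x, l\<^sub>3) * (?y - l\<^sub>3) ^ n / fact n))
        \<le> B * norm (?y - l\<^sub>3) ^ Suc N / fact N"
    proof (rule field_Taylor[where S="?Y" and f="\<lambda>i t. pd D 0 i u (?x, t)"])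
      show "((\<lambda>t. pd D 0 i u (?x, t)) has_field_derivative pd D 0 (Suc i) u (?x, t)) (at t within ?Y)"
        if "t \<in> ?Y" "i \<le> N" for t i
      proof -
        have "(?x, t) \<in> S" by (rule subsetD[OF box]) (use that xy in simp)
        from DERIV_subset[OF smooth_has_deriv(2)[OF S pd_smooth[OF S u] this] sub(2), of 0 i]
        show ?thesis by (simp add: pd_def)
      qed
    qed (use xy in \<open>auto intro!: bnd\<close>)
    have 2: "norm (pd D 0 n u (?x, l\<^sub>3) - (\<Sum>m\<le>N - n. pd D m n u p * (?x - x\<^sub>0) ^ m / fact m))
        \<le> B * norm (?x - x\<^sub>0) ^ Suc (N - n) / fact (N - n)" if "n \<le> N" for n
    proof (rule field_Taylor[where S="?X" and f="\<lambda>i t. pd D i n u (t, l\<^sub>3)"])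
      show "((\<lambda>t. pd D i n u (t, l\<^sub>3)) has_field_derivative pd D (Suc i) n u (t, l\<^sub>3)) (at t within ?X)"
        if "t \<in> ?X" "i \<le> N - n" for t i
      proof -
        have "(t, l\<^sub>3) \<in> S" by (rule subsetD[OF box]) (use that xy in simp)
        from DERIV_subset[OF smooth_has_deriv(1)[OF S pd_smooth[OF S u] this] sub(1), of i n]
        show ?thesis by (simp add: pd_def)
      qed
    qed (use xy that in \<open>auto intro!: bnd\<close>)
    (* The error of the expansion in x of the n-th y-derivative. *)
    let ?E = "\<lambda>n. pd D 0 n u (?x, l\<^sub>3) - (\<Sum>m\<le>N - n. pd D m n u p * (k * h) ^ m / fact m)"
    have fact_le: "c / fact n \<le> c" if "0 \<le> c" for c :: real and n
      using mult_left_mono[OF fact_ge_1[of n] that] by (simp add: divide_le_eq)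
    have E: "\<bar>?E n * ((l * h) ^ n / fact n)\<bar> \<le> B * h ^ (N + 1)" if "n \<le> N" for n
    proof -
      have "\<bar>?E n\<bar> \<le> B * \<bar>k * h\<bar> ^ Suc (N - n)"
        using order_trans[OF 2[OF that] fact_le] B0 unfolding real_norm_def add_diff_cancel_left' by simp
      also have "\<dots> \<le> B * h ^ Suc (N - n)"
        using kh B0 by (intro mult_left_mono power_mono) auto
      finally have e: "\<bar>?E n\<bar> \<le> B * h ^ Suc (N - n)" .
      have f: "\<bar>(l * h) ^ n / fact n\<bar> \<le> h ^ n"
      proof -
        have "\<bar>(l * h) ^ n / fact n\<bar> = (l * h) ^ n / fact n" using lh by simp
        also have "\<dots> \<le> (l * h) ^ n" using lh by (intro fact_le) simp
        also have "\<dots> \<le> h ^ n" using lh by (intro power_mono) auto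
        finally show ?thesis .
      qed
      have "\<bar>?E n * ((l * h) ^ n / fact n)\<bar> \<le> (B * h ^ Suc (N - n)) * h ^ n"
        unfolding abs_mult using e f B0 h by (intro mult_mono) auto
      also have "\<dots> = B * h ^ (N + 1)" using that by (simp flip: power_add add: mult.assoc)
      finally show ?thesis .
    qed
    have "B * norm (?y - l\<^sub>3) ^ Suc N / fact N \<le> B * norm (?y - l\<^sub>3) ^ Suc N"
      using B0 by (intro fact_le) simp
    also have "\<dots> \<le> B * h ^ Suc N" using lh B0 by (intro mult_left_mono power_mono) auto
    finally have 3: "\<bar>u (?x, ?y) - (\<Sum>n\<le>N. pd D 0 n u (?x, l\<^sub>3) * (l * h) ^ n / fact n)\<bar> \<le> B * h ^ (N + 1)"
      using 1 by (simp add: pd_def)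
    have "\<bar>\<Sum>n\<le>N. ?E n * ((l * h) ^ n / fact n)\<bar> \<le> (\<Sum>n\<le>N. \<bar>?E n * ((l * h) ^ n / fact n)\<bar>)"
      by (rule sum_abs)
    also have "\<dots> \<le> (\<Sum>n\<le>N. B * h ^ (N + 1))"
    proof (rule sum_mono)
      fix n assume "n \<in> {..N}"
      then show "\<bar>?E n * ((l * h) ^ n / fact n)\<bar> \<le> B * h ^ (N + 1)" by (intro E) simp
    qed
    finally have 5: "\<bar>\<Sum>n\<le>N. ?E n * ((l * h) ^ n / fact n)\<bar> \<le> (\<Sum>n\<le>N. B * h ^ (N + 1))" .
    have "(\<Sum>(m, n)\<in>\<Lambda> N. pd D m n u p * ((k * h) ^ m * (l * h) ^ n / (fact m * fact n)))
        = (\<Sum>n\<le>N. (\<Sum>m\<le>N - n. pd D m n u p * (k * h) ^ m / fact m) * ((l * h) ^ n / fact n))"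
      unfolding sum_\<Lambda> sum_distrib_right by (intro sum.cong refl) simp
    then have eq: "u (?x, ?y) - (\<Sum>(m, n)\<in>\<Lambda> N. pd D m n u p * ((k * h) ^ m * (l * h) ^ n / (fact m * fact n)))
        = (u (?x, ?y) - (\<Sum>n\<le>N. pd D 0 n u (?x, l\<^sub>3) * (l * h) ^ n / fact n))
          + (\<Sum>n\<le>N. ?E n * ((l * h) ^ n / fact n))"
      by (simp add: left_diff_distrib diff_divide_distrib sum_subtractf)
    have "\<bar>(u (?x, ?y) - (\<Sum>n\<le>N. pd D 0 n u (?x, l\<^sub>3) * (l * h) ^ n / fact n))
          + (\<Sum>n\<le>N. ?E n * ((l * h) ^ n / fact n))\<bar> \<le> B * h ^ (N + 1) + (\<Sum>n\<le>N. B * h ^ (N + 1))"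
      by (rule order_trans[OF abs_triangle_ineq add_mono[OF 3 5]])
    also have "\<dots> = B * h ^ (N + 1) + real (Suc N) * (B * h ^ (N + 1))" by simp
    also have "\<dots> = B * (N + 2) * h ^ (N + 1)" by (simp add: distrib_right distrib_left)
    finally show ?thesis by (simp only: eq)
  qed
  have "eventually (\<lambda>h::real. 0 < h \<and> h < \<delta>) (at_right 0)"
    using \<delta> by (auto simp: eventually_at_right_field)
  then show ?thesis
    by (intro bigoI[where c="B * (N + 2)"]) (elim eventually_mono, use main in auto)
qed

lemma smooth_power: "nbhd S \<Longrightarrow> smooth S f \<Longrightarrow> smooth S (\<lambda>q. f q ^ n)"
  by (induction n) (auto intro: smooth_const smooth_mult)

text \<open>
  Test functions whose jet at \<open>p\<close> has a single non-zero entry.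
\<close>

definition monomial_at_p :: "nat \<Rightarrow> nat \<Rightarrow> real \<times> real \<Rightarrow> real" where
  "monomial_at_p m n = (\<lambda>(x, y). (x - x\<^sub>0) ^ m * (y - l\<^sub>3) ^ n)"

lemma smooth_shift:
  assumes "nbhd S"
  shows "smooth S (\<lambda>q. fst q - c)" "smooth S (\<lambda>q. snd q - c)"
  using smooth_add[OF assms smooth_fst[OF assms] smooth_const[OF assms, of "- c"]]
    smooth_add[OF assms smooth_snd[OF assms] smooth_const[OF assms, of "- c"]] by simp_all

lemma smooth_monomial_at_p: "nbhd S \<Longrightarrow> smooth S (monomial_at_p m n)"
  unfolding monomial_at_p_def case_prod_beta
  by (intro smooth_mult smooth_power smooth_shift)

lemma pd_monomial_at_p:
  assumes S: "nbhd S"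
  shows "pd D i j (monomial_at_p m n) p = (if i = m \<and> j = n then fact m * fact n else 0)"
proof -
  note sm = smooth_monomial_at_p[OF S]
  have dx1: "dx D (monomial_at_p m n) q = real m * monomial_at_p (m - 1) n q" if q: "q \<in> S" for m n q
  proof -
    obtain x y where "q = (x, y)" by force
    with q show ?thesis
      by (auto intro!: dx_eqI D_nbhd[OF S] derivative_eq_intros simp: monomial_at_p_def)
  qed
  have dy1: "dy D (monomial_at_p m n) q = real n * monomial_at_p m (n - 1) q" if q: "q \<in> S" for m n q
  proof -
    obtain x y where "q = (x, y)" by force
    with q show ?thesis
      by (auto intro!: dy_eqI D_nbhd[OF S] derivative_eq_intros simp: monomial_at_p_def)
  qed
  have dxi: "(dx D ^^ i) (monomial_at_p m n) q =
      (if i \<le> m then fact m / fact (m - i) else 0) * monomial_at_p (m - i) n q" if "q \<in> S" for i q m n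
    using that
  proof (induction i arbitrary: q)
    case (Suc i)
    let ?c = "if i \<le> m then fact m / fact (m - i) else (0::real)"
    have "(dx D ^^ Suc i) (monomial_at_p m n) q = ?c * dx D (monomial_at_p (m - i) n) q"
      using Suc dx_cong[OF S, of "(dx D ^^ i) (monomial_at_p m n)" "\<lambda>q. ?c * monomial_at_p (m - i) n q" q]
        derivation_cmult[OF S derivation_dx[OF S] sm Suc.prems, of ?c "m - i" n] by simp
    also have "\<dots> = (if Suc i \<le> m then fact m / fact (m - Suc i) else 0) * monomial_at_p (m - Suc i) n q"
      using fact_reduce[of "m - i", where 'a=real] by (auto simp: dx1[OF Suc.prems] Suc_le_eq)
    finally show ?case .
  qed simp
  have dyj: "(dy D ^^ j) (monomial_at_p m n) q =
      (if j \<le> n then fact n / fact (n - j) else 0) * monomial_at_p m (n - j) q" if "q \<in> S" for j q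
    using that
  proof (induction j arbitrary: q)
    case (Suc j)
    let ?c = "if j \<le> n then fact n / fact (n - j) else (0::real)"
    have "(dy D ^^ Suc j) (monomial_at_p m n) q = ?c * dy D (monomial_at_p m (n - j)) q"
      using Suc dy_cong[OF S, of "(dy D ^^ j) (monomial_at_p m n)" "\<lambda>q. ?c * monomial_at_p m (n - j) q" q]
        derivation_cmult[OF S derivation_dy[OF S] sm Suc.prems, of ?c m "n - j"] by simp
    also have "\<dots> = (if Suc j \<le> n then fact n / fact (n - Suc j) else 0) * monomial_at_p m (n - Suc j) q"
      using fact_reduce[of "n - j", where 'a=real] by (auto simp: dy1[OF Suc.prems] Suc_le_eq)
    finally show ?case .
  qed simp
  have "pd D i j (monomial_at_p m n) p = (if j \<le> n then fact n / fact (n - j) else 0) *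
      ((if i \<le> m then fact m / fact (m - i) else 0) * monomial_at_p (m - i) (n - j) p)"
    unfolding pd_def
    using derivation_iter_cong[OF S derivation_dx[OF S], of "(dy D ^^ j) (monomial_at_p m n)"
        "\<lambda>q. (if j \<le> n then fact n / fact (n - j) else 0) * monomial_at_p m (n - j) q" p i]
      derivation_iter_cmult[OF S derivation_dx[OF S] sm nbhd_p[OF S], of i _ m "n - j"]
    by (simp add: dyj dxi nbhd_p[OF S])
  then show ?thesis by (auto simp: monomial_at_p_def power_0_left)
qed

lemma nbhd_exists: "nbhd ({l\<^sub>1<..<l\<^sub>2} \<times> {l\<^sub>3..<l\<^sub>4})"
  unfolding nbhd_def
  by (rule exI[of _ "{l\<^sub>1<..<l\<^sub>2} \<times> {..<l\<^sub>4}"])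
     (use left right height in \<open>auto simp: D_def open_Times\<close>)

lemma smooth_near_monomial: "smooth_near D p (monomial_at_p m n)"
  using smooth_monomial_at_p[OF nbhd_exists] nbhd_exists smooth_near_iff by blast

end

section \<open>Eliminating the second normal derivative\<close>

text \<open>
  The functional \<open>L\<close> on jets is a combination of jet entries and of source entries, identically in the jet. One bound \<open>K\<close>
  on the orders that occur serves all functionals at once, so that they can be added without adjusting index sets.
\<close>

definition represents :: "(nat \<Rightarrow> nat \<Rightarrow> real) \<Rightarrow> nat \<Rightarrow> ((nat \<Rightarrow> nat \<Rightarrow> real) \<Rightarrow> real) \<Rightarrow>
    (nat \<Rightarrow> nat \<Rightarrow> real) \<Rightarrow> (nat \<Rightarrow> nat \<Rightarrow> real) \<Rightarrow> bool" where
  "represents A K L \<alpha> \<beta> \<longleftrightarrow>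
     (\<forall>U. L U = (\<Sum>(m, n)\<in>\<Lambda> K. \<alpha> m n * U m n) + (\<Sum>(m, n)\<in>\<Lambda> K. \<beta> m n * jet_source A U m n))"

lemma represents_uminus:
  "represents A K L \<alpha> \<beta> \<Longrightarrow> represents A K (\<lambda>U. - L U) (\<lambda>m n. - \<alpha> m n) (\<lambda>m n. - \<beta> m n)"
  by (simp add: represents_def case_prod_beta sum_negf)

lemma represents_diff:
  "represents A K L \<alpha> \<beta> \<Longrightarrow> represents A K L' \<alpha>' \<beta>' \<Longrightarrow>
    represents A K (\<lambda>U. L U - L' U) (\<lambda>m n. \<alpha> m n - \<alpha>' m n) (\<lambda>m n. \<beta> m n - \<beta>' m n)"
  by (simp add: represents_def case_prod_beta left_diff_distrib sum_subtractf)

lemma represents_sum: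
  fixes I :: "(nat \<times> nat) set"
  assumes "\<And>r s. (r, s) \<in> I \<Longrightarrow> represents A K (L r s) (\<alpha> r s) (\<beta> r s)"
  shows "represents A K (\<lambda>U. \<Sum>(r, s)\<in>I. c r s * L r s U) (\<lambda>m n. \<Sum>(r, s)\<in>I. c r s * \<alpha> r s m n)
    (\<lambda>m n. \<Sum>(r, s)\<in>I. c r s * \<beta> r s m n)"
  unfolding represents_def
proof
  fix U :: "nat \<Rightarrow> nat \<Rightarrow> real"
  have swap: "(\<Sum>(r, s)\<in>I. c r s * (\<Sum>(m, n)\<in>\<Lambda> K. f r s m n * V m n))
      = (\<Sum>(m, n)\<in>\<Lambda> K. (\<Sum>(r, s)\<in>I. c r s * f r s m n) * V m n)"
    for f :: "nat \<Rightarrow> nat \<Rightarrow> nat \<Rightarrow> nat \<Rightarrow> real" and V :: "nat \<Rightarrow> nat \<Rightarrow> real"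
    unfolding case_prod_beta sum_distrib_left sum_distrib_right mult.assoc by (rule sum.swap)
  have "(\<Sum>(r, s)\<in>I. c r s * L r s U)
      = (\<Sum>(r, s)\<in>I. c r s * (\<Sum>(m, n)\<in>\<Lambda> K. \<alpha> r s m n * U m n)
          + c r s * (\<Sum>(m, n)\<in>\<Lambda> K. \<beta> r s m n * jet_source A U m n))"
    using assms by (intro sum.cong) (auto simp: represents_def distrib_left)
  also have "\<dots> = (\<Sum>(r, s)\<in>I. c r s * (\<Sum>(m, n)\<in>\<Lambda> K. \<alpha> r s m n * U m n))
      + (\<Sum>(r, s)\<in>I. c r s * (\<Sum>(m, n)\<in>\<Lambda> K. \<beta> r s m n * jet_source A U m n))"
    by (simp add: case_prod_beta sum.distrib)
  finally show "(\<Sum>(r, s)\<in>I. c r s * L r s U)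
      = (\<Sum>(m, n)\<in>\<Lambda> K. (\<Sum>(r, s)\<in>I. c r s * \<alpha> r s m n) * U m n)
      + (\<Sum>(m, n)\<in>\<Lambda> K. (\<Sum>(r, s)\<in>I. c r s * \<beta> r s m n) * jet_source A U m n)"
    unfolding swap .
qed

text \<open>
  What is known of the coefficients that express the derivative \<open>(i, j)\<close>. Only Cauchy data occur and no order is exceeded.
  At top order the reduction is that of \<open>\<partial>\<^sub>y\<^sup>2 = - \<partial>\<^sub>x\<^sup>2 - f / a\<close>. One order below, the coefficient of \<open>u\<^sup>(\<^sup>m\<^sup>,\<^sup>0\<^sup>)\<close> for even \<open>j\<close>
  is the first-order effect of \<open>a\<^sub>x / a\<close>. Odd \<open>j\<close>, where \<open>a\<^sub>y / a\<close> enters, is left open: for odd \<open>m\<close> the monomial is then odd in \<open>x\<close>,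
  and a stencil symmetric in \<open>x\<close> annihilates it.
\<close>

definition graded :: "(nat \<Rightarrow> nat \<Rightarrow> real) \<Rightarrow> nat \<Rightarrow> nat \<Rightarrow> (nat \<Rightarrow> nat \<Rightarrow> real) \<Rightarrow> (nat \<Rightarrow> nat \<Rightarrow> real) \<Rightarrow> bool" where
  "graded A i j \<alpha> \<beta> \<longleftrightarrow>
     (\<forall>m n. 2 \<le> n \<or> i + j < m + n \<longrightarrow> \<alpha> m n = 0) \<and>
     (\<forall>m n. i + j < m + n + 2 \<longrightarrow> \<beta> m n = 0) \<and>
     (\<forall>m n. m + n = i + j \<longrightarrow> \<alpha> m n = (if n = j mod 2 then (- 1) ^ (j div 2) else 0)) \<and>
     (\<forall>m n. m + n + 2 = i + j \<longrightarrow>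
        \<beta> m n = (if n + 2 \<le> j \<and> even (j - n) then (- 1) ^ ((j - n) div 2) / A 0 0 else 0)) \<and>
     (\<forall>m. even j \<longrightarrow> Suc m = i + j \<longrightarrow>
        \<alpha> m 0 = (- 1) ^ (j div 2) * real (j div 2) * (A 1 0 / A 0 0))"

lemma finite_\<Lambda> [simp]: "finite (\<Lambda> N)"
  by (rule finite_subset[of _ "{..N} \<times> {..N}"]) (auto simp: \<Lambda>_def)

lemma sum_eq_single_pair:
  assumes "finite S" "(i, j) \<in> S" "\<And>m n. (m, n) \<in> S \<Longrightarrow> (m, n) \<noteq> (i, j) \<Longrightarrow> g m n = 0"
  shows "(\<Sum>(m, n)\<in>S. g m n) = (g i j :: real)"
proof -
  have "(\<Sum>(m, n)\<in>S. g m n) = (\<Sum>(m, n)\<in>{(i, j)}. g m n)"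
    using assms by (intro sum.mono_neutral_right) auto
  then show ?thesis by simp
qed

lemma sum_pairs_eq_0:
  "(\<And>r s. (r, s) \<in> I \<Longrightarrow> f r s = 0) \<Longrightarrow> (\<Sum>(r, s)\<in>I. c r s * f r s) = (0::real)"
  by (intro sum.neutral) auto

text \<open>
  The two terms with all derivatives on \<open>u\<close> are \<open>a u\<^sup>(\<^sup>i\<^sup>+\<^sup>2\<^sup>,\<^sup>j\<^sup>)\<close> and \<open>a u\<^sup>(\<^sup>i\<^sup>,\<^sup>j\<^sup>+\<^sup>2\<^sup>)\<close>. The latter is isolated; all other terms have lower
  order or, in the case of the former, the same order and fewer \<open>y\<close>-derivatives.
\<close>

lemma jet_source_solve:
  fixes A U :: "nat \<Rightarrow> nat \<Rightarrow> real"
  defines "I1 i j \<equiv> {..Suc i} \<times> {..j} - {(0, 0)}" and "I2 i j \<equiv> {..i} \<times> {..Suc j} - {(0, 0)}"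
  assumes A: "A 0 0 \<noteq> 0"
  shows "U i (j + 2) = - U (i + 2) j - jet_source A U i j / A 0 0
     - (\<Sum>(r, s)\<in>I1 i j. real (Suc i choose r) * real (j choose s) * A r s / A 0 0 * U (i + 2 - r) (j - s))
     - (\<Sum>(r, s)\<in>I2 i j. real (i choose r) * real (Suc j choose s) * A r s / A 0 0 * U (i - r) (j + 2 - s))"
proof -
  let ?g1 = "\<lambda>(r, s). real (Suc i choose r) * real (j choose s) * A r s * U (i + 2 - r) (j - s)"
  let ?g2 = "\<lambda>(r, s). real (i choose r) * real (Suc j choose s) * A r s * U (i - r) (j + 2 - s)"
  have 1: "(\<Sum>r\<le>Suc i. \<Sum>s\<le>j. real (Suc i choose r) * real (j choose s) * (A r s * U (Suc (Suc i - r)) (j - s)))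
      = (\<Sum>x\<in>{..Suc i} \<times> {..j}. ?g1 x)"
    by (subst sum.cartesian_product[symmetric], intro sum.cong refl) (simp add: Suc_diff_le mult.assoc)
  have 2: "(\<Sum>r\<le>i. \<Sum>s\<le>Suc j. real (i choose r) * real (Suc j choose s) * (A r s * U (i - r) (Suc (Suc j - s))))
      = (\<Sum>x\<in>{..i} \<times> {..Suc j}. ?g2 x)"
    by (subst sum.cartesian_product[symmetric], intro sum.cong refl) (simp add: Suc_diff_le mult.assoc)
  have 3: "(\<Sum>x\<in>{..Suc i} \<times> {..j}. ?g1 x) = A 0 0 * U (i + 2) j + (\<Sum>x\<in>I1 i j. ?g1 x)"
    unfolding I1_def by (subst sum.remove[of _ "(0, 0)"]) auto
  have 4: "(\<Sum>x\<in>{..i} \<times> {..Suc j}. ?g2 x) = A 0 0 * U i (j + 2) + (\<Sum>x\<in>I2 i j. ?g2 x)"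
    unfolding I2_def by (subst sum.remove[of _ "(0, 0)"]) auto
  have "jet_source A U i j = - (A 0 0 * U (i + 2) j + (\<Sum>x\<in>I1 i j. ?g1 x)
      + (A 0 0 * U i (j + 2) + (\<Sum>x\<in>I2 i j. ?g2 x)))"
    unfolding jet_source_def 1 2 3 4 by simp
  then have "A 0 0 * U i (j + 2) / A 0 0 =
      (- (A 0 0 * U (i + 2) j) - jet_source A U i j - (\<Sum>x\<in>I1 i j. ?g1 x) - (\<Sum>x\<in>I2 i j. ?g2 x)) / A 0 0"
    by (intro arg_cong2[where f="(/)"]) simp_all
  then have "U i (j + 2) = - U (i + 2) j - jet_source A U i j / A 0 0
      - (\<Sum>x\<in>I1 i j. ?g1 x) / A 0 0 - (\<Sum>x\<in>I2 i j. ?g2 x) / A 0 0"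
    using A by (simp add: diff_divide_distrib)
  then show ?thesis
    by (simp add: sum_divide_distrib case_prod_beta)
qed

lemma represents_derivative:
  assumes "i + j \<le> K"
  shows "represents A K (\<lambda>U. U i j) (\<lambda>m n. if m = i \<and> n = j then 1 else 0) (\<lambda>_ _. 0)"
proof -
  have "(i, j) \<in> \<Lambda> K" using assms by (simp add: \<Lambda>_def)
  then show ?thesis
    unfolding represents_def by (intro allI, subst sum_eq_single_pair[of _ i j]) auto
qed

lemma represents_source:
  assumes "i + j \<le> K"
  shows "represents A K (\<lambda>U. jet_source A U i j / c) (\<lambda>_ _. 0) (\<lambda>m n. if m = i \<and> n = j then 1 / c else 0)"
proof -
  have "(i, j) \<in> \<Lambda> K" using assms by (simp add: \<Lambda>_def)
  then show ?thesis
    unfolding represents_def by (intro allI, subst sum_eq_single_pair[of _ i j]) auto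
qed

text \<open>
  Induction on the order \<open>N\<close> and, within it, on the number \<open>j\<close> of \<open>y\<close>-derivatives, by \<open>jet_source_solve\<close>. In top order only the
  term \<open>- u\<^sup>(\<^sup>i\<^sup>+\<^sup>2\<^sup>,\<^sup>j\<^sup>-\<^sup>2\<^sup>)\<close> and the source contribute. One order below, the terms with a first derivative of \<open>a\<close> contribute their top
  coefficients: for even \<open>j\<close> those with \<open>a\<^sub>y\<close> vanish by parity, and those with \<open>a\<^sub>x\<close> add up to a single \<open>\<plusminus> a\<^sub>x / a\<close>
  because \<open>(i + 1) - i = 1\<close>.
\<close>

lemma ex_graded_reduction:
  fixes A :: "nat \<Rightarrow> nat \<Rightarrow> real"
  assumes A: "A 0 0 \<noteq> 0"
  shows "i + j = N \<Longrightarrow> N \<le> K \<Longrightarrow> \<exists>\<alpha> \<beta>. graded A i j \<alpha> \<beta> \<and> represents A K (\<lambda>U. U i j) \<alpha> \<beta>"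
proof (induction N arbitrary: i j rule: less_induct)
  case (less N)
  note lower_order = less.IH
  show ?case using less.prems
  proof (induction j arbitrary: i rule: less_induct)
    case (less j)
    show ?case
    proof (cases "j < 2")
      case True
      then have "graded A i j (\<lambda>m n. if m = i \<and> n = j then 1 else 0) (\<lambda>_ _. 0)"
        by (auto simp: graded_def)
      then show ?thesis using represents_derivative[of i j K A] less.prems by blast
    next
      case False
      then obtain j' where j: "j = j' + 2" by (metis add.commute le_Suc_ex not_less)
      (* A choice of the coefficients provided by the two induction hypotheses. *)
      define z where "z i' j' = (SOME z. graded A i' j' (fst z) (snd z) \<and> represents A K (\<lambda>U. U i' j') (fst z) (snd z))" for i' j'
      define al where "al i' j' = fst (z i' j')" for i' j'
      define be where "be i' j' = snd (z i' j')" for i' j'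
      have z: "graded A i' j'' (al i' j'') (be i' j'') \<and> represents A K (\<lambda>U. U i' j'') (al i' j'') (be i' j'')"
        if "i' + j'' < N \<or> i' + j'' = N \<and> j'' < j" for i' j''
      proof -
        have "\<exists>\<alpha> \<beta>. graded A i' j'' \<alpha> \<beta> \<and> represents A K (\<lambda>U. U i' j'') \<alpha> \<beta>"
          using that lower_order[of "i' + j''" i' j''] less.IH[of j'' i'] less.prems by fastforce
        then have "\<exists>z. graded A i' j'' (fst z) (snd z) \<and> represents A K (\<lambda>U. U i' j'') (fst z) (snd z)" by auto
        from someI_ex[OF this] show ?thesis unfolding al_def be_def z_def .
      qed
      let ?I1 = "{..Suc i} \<times> {..j'} - {(0, 0)}" and ?I2 = "{..i} \<times> {..Suc j'} - {(0, 0)}"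
      let ?c1 = "\<lambda>r s. real (Suc i choose r) * real (j' choose s) * A r s / A 0 0"
      let ?c2 = "\<lambda>r s. real (i choose r) * real (Suc j' choose s) * A r s / A 0 0"
      define \<alpha> where "\<alpha> m n = - al (i + 2) j' m n - 0 - (\<Sum>(r, s)\<in>?I1. ?c1 r s * al (i + 2 - r) (j' - s) m n)
        - (\<Sum>(r, s)\<in>?I2. ?c2 r s * al (i - r) (j' + 2 - s) m n)" for m n
      define \<beta> where "\<beta> m n = - be (i + 2) j' m n - (if m = i \<and> n = j' then 1 / A 0 0 else 0)
        - (\<Sum>(r, s)\<in>?I1. ?c1 r s * be (i + 2 - r) (j' - s) m n)
        - (\<Sum>(r, s)\<in>?I2. ?c2 r s * be (i - r) (j' + 2 - s) m n)" for m n
      have N: "N = i + j' + 2" using less.prems j by simp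
      have z0: "graded A (i + 2) j' (al (i + 2) j') (be (i + 2) j')" "represents A K (\<lambda>U. U (i + 2) j') (al (i + 2) j') (be (i + 2) j')"
        using z[of "i + 2" j'] N j by auto
      have z1: "graded A (i + 2 - r) (j' - s) (al (i + 2 - r) (j' - s)) (be (i + 2 - r) (j' - s))"
          "represents A K (\<lambda>U. U (i + 2 - r) (j' - s)) (al (i + 2 - r) (j' - s)) (be (i + 2 - r) (j' - s))"
        if "(r, s) \<in> ?I1" for r s
      proof -
        have "r \<le> Suc i" "s \<le> j'" "0 < r + s" using that by auto
        then have "i + 2 - r + (j' - s) < N" using N by arith
        then show "graded A (i + 2 - r) (j' - s) (al (i + 2 - r) (j' - s)) (be (i + 2 - r) (j' - s))"
          "represents A K (\<lambda>U. U (i + 2 - r) (j' - s)) (al (i + 2 - r) (j' - s)) (be (i + 2 - r) (j' - s))"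
          using z by blast+
      qed
      have z2: "graded A (i - r) (j' + 2 - s) (al (i - r) (j' + 2 - s)) (be (i - r) (j' + 2 - s))"
          "represents A K (\<lambda>U. U (i - r) (j' + 2 - s)) (al (i - r) (j' + 2 - s)) (be (i - r) (j' + 2 - s))"
        if "(r, s) \<in> ?I2" for r s
      proof -
        have "r \<le> i" "s \<le> Suc j'" "0 < r + s" using that by auto
        then have "i - r + (j' + 2 - s) < N" using N by arith
        then show "graded A (i - r) (j' + 2 - s) (al (i - r) (j' + 2 - s)) (be (i - r) (j' + 2 - s))"
          "represents A K (\<lambda>U. U (i - r) (j' + 2 - s)) (al (i - r) (j' + 2 - s)) (be (i - r) (j' + 2 - s))"
          using z by blast+
      qed
      have "represents A K (\<lambda>U. - U (i + 2) j' - jet_source A U i j' / A 0 0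
            - (\<Sum>(r, s)\<in>?I1. ?c1 r s * U (i + 2 - r) (j' - s))
            - (\<Sum>(r, s)\<in>?I2. ?c2 r s * U (i - r) (j' + 2 - s))) \<alpha> \<beta>"
        unfolding \<alpha>_def \<beta>_def
        by (intro represents_diff represents_uminus represents_source represents_sum z0(2) z1(2) z2(2))
           (use less.prems N in simp)
      then have "represents A K (\<lambda>U. U i j) \<alpha> \<beta>"
        unfolding j jet_source_solve[where A=A, OF A] .
      moreover have "graded A i j \<alpha> \<beta>"
      proof -
        have z0': "2 \<le> n \<or> i + 2 + j' < m + n \<Longrightarrow> al (i + 2) j' m n = 0"
          "i + 2 + j' < m + n + 2 \<Longrightarrow> be (i + 2) j' m n = 0"
          "m + n = i + 2 + j' \<Longrightarrow> al (i + 2) j' m n = (if n = j' mod 2 then (- 1) ^ (j' div 2) else 0)"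
          "m + n + 2 = i + 2 + j' \<Longrightarrow> be (i + 2) j' m n =
             (if n + 2 \<le> j' \<and> even (j' - n) then (- 1) ^ ((j' - n) div 2) / A 0 0 else 0)"
          "even j' \<Longrightarrow> Suc m = i + 2 + j' \<Longrightarrow>
             al (i + 2) j' m 0 = (- 1) ^ (j' div 2) * real (j' div 2) * (A 1 0 / A 0 0)" for m n
          using z0(1) unfolding graded_def by blast+
        have z1': "2 \<le> n \<or> i + 2 - r + (j' - s) < m + n \<Longrightarrow> al (i + 2 - r) (j' - s) m n = 0"
          "i + 2 - r + (j' - s) < m + n + 2 \<Longrightarrow> be (i + 2 - r) (j' - s) m n = 0"
          "m + n = i + 2 - r + (j' - s) \<Longrightarrow>
             al (i + 2 - r) (j' - s) m n = (if n = (j' - s) mod 2 then (- 1) ^ ((j' - s) div 2) else 0)"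
          if "(r, s) \<in> ?I1" for r s m n
          using z1(1)[OF that] unfolding graded_def by blast+
        have z2': "2 \<le> n \<or> i - r + (j' + 2 - s) < m + n \<Longrightarrow> al (i - r) (j' + 2 - s) m n = 0"
          "i - r + (j' + 2 - s) < m + n + 2 \<Longrightarrow> be (i - r) (j' + 2 - s) m n = 0"
          "m + n = i - r + (j' + 2 - s) \<Longrightarrow>
             al (i - r) (j' + 2 - s) m n = (if n = (j' + 2 - s) mod 2 then (- 1) ^ ((j' + 2 - s) div 2) else 0)"
          if "(r, s) \<in> ?I2" for r s m n
          using z2(1)[OF that] unfolding graded_def by blast+
        have low1: "i + 2 - r + (j' - s) < i + j" if "(r, s) \<in> ?I1" for r s
        proof -
          have "r \<le> Suc i" "s \<le> j'" "0 < r + s" using that by auto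
          then show ?thesis using j by arith
        qed
        have low2: "i - r + (j' + 2 - s) < i + j" if "(r, s) \<in> ?I2" for r s
        proof -
          have "r \<le> i" "s \<le> Suc j'" "0 < r + s" using that by auto
          then show ?thesis using j by arith
        qed
        have \<alpha>_top: "\<alpha> m n = - al (i + 2) j' m n" if "2 \<le> n \<or> i + j \<le> m + n" for m n
        proof -
          have "(\<Sum>(r, s)\<in>?I1. ?c1 r s * al (i + 2 - r) (j' - s) m n) = 0"
            using that low1 by (intro sum_pairs_eq_0 z1'(1)) fastforce+
          moreover have "(\<Sum>(r, s)\<in>?I2. ?c2 r s * al (i - r) (j' + 2 - s) m n) = 0"
            using that low2 by (intro sum_pairs_eq_0 z2'(1)) fastforce+
          ultimately show ?thesis by (simp add: \<alpha>_def)
        qed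
        have \<beta>_top: "\<beta> m n = - be (i + 2) j' m n - (if m = i \<and> n = j' then 1 / A 0 0 else 0)"
          if "i + j \<le> m + n + 2" for m n
        proof -
          have "(\<Sum>(r, s)\<in>?I1. ?c1 r s * be (i + 2 - r) (j' - s) m n) = 0"
            using that low1 by (intro sum_pairs_eq_0 z1'(2)) fastforce+
          moreover have "(\<Sum>(r, s)\<in>?I2. ?c2 r s * be (i - r) (j' + 2 - s) m n) = 0"
            using that low2 by (intro sum_pairs_eq_0 z2'(2)) fastforce+
          ultimately show ?thesis by (simp add: \<beta>_def)
        qed
        have g1: "\<alpha> m n = 0" if "2 \<le> n \<or> i + j < m + n" for m n
          using that j z0'(1)[where m=m and n=n] by (subst \<alpha>_top) auto
        have g2: "\<beta> m n = 0" if "i + j < m + n + 2" for m n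
          using that j z0'(2)[where m=m and n=n] by (subst \<beta>_top) auto
        have g3: "\<alpha> m n = (if n = j mod 2 then (- 1) ^ (j div 2) else 0)" if "m + n = i + j" for m n
          using that j z0'(3)[where m=m and n=n] by (subst \<alpha>_top) auto
        have g4: "\<beta> m n = (if n + 2 \<le> j \<and> even (j - n) then (- 1) ^ ((j - n) div 2) / A 0 0 else 0)"
          if "m + n + 2 = i + j" for m n
        proof -
          have b: "\<beta> m n = - be (i + 2) j' m n - (if n = j' then 1 / A 0 0 else 0)"
            using that j by (subst \<beta>_top) auto
          consider "n = j'" | "n > j'" | "n = j' - 1" "0 < j'" | d where "j' = n + 2 + d"
            by (metis One_nat_def Suc_1 Suc_lessI Suc_pred add.commute add_2_eq_Suc' diff_Suc_1 le_Suc_ex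
                less_Suc_eq_le less_or_eq_imp_le linorder_neqE_nat not_less_eq_eq zero_less_Suc)
          then show ?thesis
            using b that z0'(4)[where m=m and n=n] j by cases auto
        qed
        have g5: "\<alpha> m 0 = (- 1) ^ (j div 2) * real (j div 2) * (A 1 0 / A 0 0)"
          if even: "even j" and m: "Suc m = i + j" for m
        proof -
          have ev: "even j'" using even j by simp
          have al1: "al (i + 2 - r) (j' - s) m 0 = 0" if "(r, s) \<in> ?I1" "(r, s) \<noteq> (1, 0)" for r s
          proof (cases "(r, s) = (0, 1)")
            case True
            then have "r = 0" "s = 1" "1 \<le> j'" using that by auto
            then have "(j' - s) mod 2 = 1" "m + 0 = i + 2 - r + (j' - s)" using ev m j by presburger+
            then show ?thesis using z1'(3)[OF that(1), where m=m and n=0] by simp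
          next
            case False
            then have "2 \<le> r + s" using that by (cases r; cases s) auto
            then show ?thesis using that(1) m j by (intro z1'(1)) auto
          qed
          have al2: "al (i - r) (j' + 2 - s) m 0 = 0" if "(r, s) \<in> ?I2" "(r, s) \<noteq> (1, 0)" for r s
          proof (cases "(r, s) = (0, 1)")
            case True
            then have "r = 0" "s = 1" using that by auto
            then have "(j' + 2 - s) mod 2 = 1" "m + 0 = i - r + (j' + 2 - s)" using ev m j by presburger+
            then show ?thesis using z2'(3)[OF that(1), where m=m and n=0] by simp
          next
            case False
            then have "2 \<le> r + s" using that by (cases r; cases s) auto
            then show ?thesis using that(1) m j by (intro z2'(1)) auto
          qed
          have "(\<Sum>(r, s)\<in>?I1. ?c1 r s * al (i + 2 - r) (j' - s) m 0)
              = ?c1 1 0 * al (i + 2 - 1) (j' - 0) m 0"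
            using al1 by (intro sum_eq_single_pair) auto
          also have "\<dots> = real (Suc i) * (A 1 0 / A 0 0) * (- 1) ^ (j' div 2)"
            using z1'(3)[of 1 0, where m=m and n=0] m j ev by auto
          finally have s1: "(\<Sum>(r, s)\<in>?I1. ?c1 r s * al (i + 2 - r) (j' - s) m 0)
              = real (Suc i) * (A 1 0 / A 0 0) * (- 1) ^ (j' div 2)" .
          have s2: "(\<Sum>(r, s)\<in>?I2. ?c2 r s * al (i - r) (j' + 2 - s) m 0)
              = - real i * (A 1 0 / A 0 0) * (- 1) ^ (j' div 2)"
          proof (cases "i = 0")
            case True
            have "(\<Sum>(r, s)\<in>?I2. ?c2 r s * al (i - r) (j' + 2 - s) m 0) = 0"
              by (rule sum_pairs_eq_0, rule al2) (use True in auto)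
            then show ?thesis using True by simp
          next
            case False
            then have "(\<Sum>(r, s)\<in>?I2. ?c2 r s * al (i - r) (j' + 2 - s) m 0)
              = ?c2 1 0 * al (i - 1) (j' + 2 - 0) m 0"
              using al2 by (intro sum_eq_single_pair) auto
            then show ?thesis using z2'(3)[of 1 0, where m=m and n=0] m j ev False by auto
          qed
          have "al (i + 2) j' m 0 = (- 1) ^ (j' div 2) * real (j' div 2) * (A 1 0 / A 0 0)"
            using ev m j by (intro z0'(5)) auto
          then show ?thesis using j unfolding \<alpha>_def s1 s2 by (simp add: algebra_simps add_divide_distrib)
        qed
        show ?thesis unfolding graded_def using g1 g2 g3 g4 g5 by blast
      qed
      ultimately show ?thesis by blast
    qed
  qed
qed

definition unit_jet :: "real \<Rightarrow> nat \<Rightarrow> nat \<Rightarrow> nat \<Rightarrow> nat \<Rightarrow> real" where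
  "unit_jet c m n = (\<lambda>i j. if i = m \<and> j = n then c else 0)"

text \<open>
  The source of a jet concentrated at \<open>(m, n + 2)\<close> starts at \<open>(m, n)\<close>, if index pairs are ordered by total order and then by
  the second index. Together with its value at \<open>(m, n)\<close> this is a triangular system, which gives uniqueness.
\<close>

lemma jet_source_unit_jet_vanishes:
  assumes "i + j < m + n \<or> i + j = m + n \<and> j < n"
  shows "jet_source A (unit_jet c m (Suc (Suc n))) i j = 0"
proof -
  have "(\<Sum>r\<le>Suc i. \<Sum>s\<le>j. real (Suc i choose r) * real (j choose s) *
      (A r s * unit_jet c m (Suc (Suc n)) (Suc (Suc i - r)) (j - s))) = 0"
    using assms by (intro sum.neutral ballI) (auto simp: unit_jet_def)
  moreover have "(\<Sum>r\<le>i. \<Sum>s\<le>Suc j. real (i choose r) * real (Suc j choose s) *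
      (A r s * unit_jet c m (Suc (Suc n)) (i - r) (Suc (Suc j - s)))) = 0"
    using assms by (intro sum.neutral ballI) (auto simp: unit_jet_def)
  ultimately show ?thesis by (simp add: jet_source_def)
qed

lemma jet_source_unit_jet_diagonal:
  "jet_source A (unit_jet c m (Suc (Suc n))) m n = - A 0 0 * c"
proof -
  have 1: "(\<Sum>r\<le>Suc m. \<Sum>s\<le>n. real (Suc m choose r) * real (n choose s) *
      (A r s * unit_jet c m (Suc (Suc n)) (Suc (Suc m - r)) (n - s))) = 0"
    by (intro sum.neutral ballI) (auto simp: unit_jet_def)
  have "(\<Sum>r\<le>m. \<Sum>s\<le>Suc n. real (m choose r) * real (Suc n choose s) *
      (A r s * unit_jet c m (Suc (Suc n)) (m - r) (Suc (Suc n - s))))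
    = (\<Sum>(r, s)\<in>{..m} \<times> {..Suc n}. real (m choose r) * real (Suc n choose s) *
      (A r s * unit_jet c m (Suc (Suc n)) (m - r) (Suc (Suc n - s))))"
    by (rule sum.cartesian_product)
  also have "\<dots> = A 0 0 * c"
    by (subst sum_eq_single_pair[of _ 0 0]) (auto simp: unit_jet_def)
  finally show ?thesis unfolding jet_source_def 1 by simp
qed

text \<open>
  Uniqueness of the reduction. Jets concentrated at \<open>(m, n + 2)\<close> have zero Cauchy data, so \<open>\<beta>\<close> vanishes by descending induction
  along the triangular system. Then jets concentrated at a Cauchy index show \<open>\<alpha> = 0\<close>. The numbers \<open>c\<close> leave room for the
  factorials in the jets of monomials.
\<close>

lemma reduction_coefficients_vanish:
  fixes c :: "nat \<Rightarrow> nat \<Rightarrow> real"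
  assumes A: "A 0 0 \<noteq> 0" and c: "\<And>m n. c m n \<noteq> 0"
    and null: "\<And>m n. (\<Sum>(i, j)\<in>\<Lambda>H1 N. \<alpha> i j * unit_jet (c m n) m n i j) +
      (\<Sum>(i, j)\<in>\<Lambda> N'. \<beta> i j * jet_source A (unit_jet (c m n) m n) i j) = 0"
  shows "(m, n) \<in> \<Lambda> N' \<Longrightarrow> \<beta> m n = 0" and "(m, n) \<in> \<Lambda>H1 N \<Longrightarrow> \<alpha> m n = 0"
proof -
  have \<beta>: "\<beta> m n = 0" if "(m, n) \<in> \<Lambda> N'" for m n
    using that
    (* The measure encodes: larger total order first, then larger second index. *)
  proof (induction "(N' - (m + n)) * Suc N' + (N' - n)" arbitrary: m n rule: less_induct)
    case less
    (* A jet at second index n + 2 has no entry among the Cauchy data. *)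
    have 1: "(\<Sum>(i, j)\<in>\<Lambda>H1 N. \<alpha> i j * unit_jet (c m (Suc (Suc n))) m (Suc (Suc n)) i j) = 0"
      by (intro sum.neutral) (auto simp: unit_jet_def \<Lambda>H1_def)
    have "\<beta> i j * jet_source A (unit_jet (c m (Suc (Suc n))) m (Suc (Suc n))) i j = 0"
      if ij: "(i, j) \<in> \<Lambda> N'" "(i, j) \<noteq> (m, n)" for i j
    proof (cases "i + j < m + n \<or> i + j = m + n \<and> j < n")
      case True
      then show ?thesis by (simp add: jet_source_unit_jet_vanishes)
    next
      case False
      then consider "m + n < i + j" | "i + j = m + n" "n < j"
        using ij(2) by (metis add_right_cancel linorder_neqE_nat)
      then have "(N' - (i + j)) * Suc N' + (N' - j) < (N' - (m + n)) * Suc N' + (N' - n)"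
      proof cases
        case 1
        then have "Suc (N' - (i + j)) \<le> N' - (m + n)" using ij(1) by (auto simp: \<Lambda>_def)
        then have "Suc (N' - (i + j)) * Suc N' \<le> (N' - (m + n)) * Suc N'" by (rule mult_le_mono1)
        then show ?thesis by simp
      next
        case 2
        then show ?thesis using ij(1) by (auto simp: \<Lambda>_def)
      qed
      then show ?thesis using less.hyps[OF _ ij(1)] by (simp only: mult_zero_left)
    qed
    then have "(\<Sum>(i, j)\<in>\<Lambda> N'. \<beta> i j * jet_source A (unit_jet (c m (Suc (Suc n))) m (Suc (Suc n))) i j)
        = \<beta> m n * jet_source A (unit_jet (c m (Suc (Suc n))) m (Suc (Suc n))) m n"
      using less.prems by (intro sum_eq_single_pair) auto
    then show ?case
      using null[of m "Suc (Suc n)"] A c[of m "Suc (Suc n)"] unfolding 1 by (simp add: jet_source_unit_jet_diagonal)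
  qed
  then show "(m, n) \<in> \<Lambda> N' \<Longrightarrow> \<beta> m n = 0" .
  assume mn: "(m, n) \<in> \<Lambda>H1 N"
  have "(\<Sum>(i, j)\<in>\<Lambda> N'. \<beta> i j * jet_source A (unit_jet (c m n) m n) i j) = 0"
    using \<beta> by (intro sum.neutral) auto
  moreover have "(\<Sum>(i, j)\<in>\<Lambda>H1 N. \<alpha> i j * unit_jet (c m n) m n i j)
      = \<alpha> m n * unit_jet (c m n) m n m n"
    using mn by (intro sum_eq_single_pair finite_subset[OF _ finite_\<Lambda>[of N]])
      (auto simp: unit_jet_def \<Lambda>H1_def)
  ultimately show "\<alpha> m n = 0" using null[of m n] c[of m n] by (simp add: unit_jet_def)
qed

section \<open>The functions G and Q as parts of the Taylor polynomial\<close>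

lemma \<Lambda>H1_subset: "\<Lambda>H1 N \<subseteq> \<Lambda> N" and \<Lambda>H2_subset: "\<Lambda>H2 N \<subseteq> \<Lambda> N"
  by (auto simp: \<Lambda>H1_def \<Lambda>H2_def)

lemma finite_\<Lambda>H [simp]: "finite (\<Lambda>H1 N)" "finite (\<Lambda>H2 N)"
  using finite_subset[OF \<Lambda>H1_subset] finite_subset[OF \<Lambda>H2_subset] by auto

lemma mem_\<Lambda>: "(m, n) \<in> \<Lambda> N \<longleftrightarrow> m + n \<le> N"
  and mem_\<Lambda>H1: "(m, n) \<in> \<Lambda>H1 N \<longleftrightarrow> m + n \<le> N \<and> n < 2"
  and mem_\<Lambda>H2: "(m, n) \<in> \<Lambda>H2 N \<longleftrightarrow> m + n \<le> N \<and> 2 \<le> n"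
  by (auto simp: \<Lambda>_def \<Lambda>H1_def \<Lambda>H2_def)

lemma sum_pairs_mono_neutral:
  fixes f :: "nat \<Rightarrow> nat \<Rightarrow> real"
  assumes "finite T" "S \<subseteq> T" "\<And>m n. (m, n) \<in> T \<Longrightarrow> (m, n) \<notin> S \<Longrightarrow> f m n = 0"
  shows "(\<Sum>(m, n)\<in>T. f m n) = (\<Sum>(m, n)\<in>S. f m n)"
  using assms by (intro sum.mono_neutral_right) auto

abbreviation taylor_monomial :: "real \<Rightarrow> real \<Rightarrow> nat \<Rightarrow> nat \<Rightarrow> real" where
  "taylor_monomial x y m n \<equiv> x ^ m * y ^ n / (fact m * fact n)"

context bottom_side_point
begin

lemma smooth_common_nbhd:
  assumes "smooth_near D p f" "smooth_near D p g"
  obtains S where "nbhd S" "smooth S f" "smooth S g"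
proof -
  obtain S T where "nbhd S" "smooth S f" "nbhd T" "smooth T g"
    using assms by (auto simp: smooth_near_iff)
  then show thesis
    using that[of "S \<inter> T"] nbhd_Int[of S T] smooth_mono[of S f "S \<inter> T"] smooth_mono[of T g "S \<inter> T"] by simp
qed

context
  fixes a :: "real \<times> real \<Rightarrow> real"
  assumes pos_smooth: "pos_smooth_near D p a"
begin

lemma a_smooth: "smooth_near D p a"
  using pos_smooth by (simp add: pos_smooth_near_def)

lemma a_pos: "0 < a p"
proof -
  obtain U where "p \<in> U" "\<forall>q\<in>U \<inter> D. 0 < a q" using pos_smooth by (auto simp: pos_smooth_near_def)
  moreover have "p \<in> D" using left right height by (auto simp: D_def)
  ultimately show ?thesis by blast
qed

abbreviation ajet :: "nat \<Rightarrow> nat \<Rightarrow> real" where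
  "ajet \<equiv> \<lambda>r s. pd D r s a p"

lemma ajet_00: "ajet 0 0 = a p"
  by (simp add: pd_def)

lemma source_jet:
  assumes "smooth_near D p u"
  shows "pd D i j (source D a u) p = jet_source ajet (\<lambda>m n. pd D m n u p) i j"
  using smooth_common_nbhd[OF a_smooth assms] pd_source by metis

lemma graded_is_reduction:
  assumes g: "graded ajet i j \<alpha> \<beta>" and r: "represents ajet (i + j) (\<lambda>U. U i j) \<alpha> \<beta>"
  shows "is_reduction D a p i j \<alpha> \<beta>"
  unfolding is_reduction_def
proof (intro conjI allI impI)
  have \<alpha>0: "\<alpha> m n = 0" if "2 \<le> n \<or> i + j < m + n" for m n using g that unfolding graded_def by blast
  have \<beta>0: "\<beta> m n = 0" if "i + j < m + n + 2" for m n using g that unfolding graded_def by blast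
  show "\<alpha> m n = 0" if "(m, n) \<notin> \<Lambda>H1 (i + j)" for m n
    using that \<alpha>0[where m=m and n=n] by (simp add: mem_\<Lambda>H1) linarith
  show "\<beta> m n = 0" if "(m, n) \<notin> \<Lambda> (i + j - 2)" for m n
    using that \<beta>0[where m=m and n=n] by (simp add: mem_\<Lambda>)
  fix u assume u: "smooth_near D p u"
  have "pd D i j u p = (\<Sum>(m, n)\<in>\<Lambda> (i + j). \<alpha> m n * pd D m n u p)
      + (\<Sum>(m, n)\<in>\<Lambda> (i + j). \<beta> m n * pd D m n (source D a u) p)"
    using r[unfolded represents_def, rule_format, of "\<lambda>m n. pd D m n u p"] unfolding source_jet[OF u] .
  also have "(\<Sum>(m, n)\<in>\<Lambda> (i + j). \<alpha> m n * pd D m n u p)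
      = (\<Sum>(m, n)\<in>\<Lambda>H1 (i + j). \<alpha> m n * pd D m n u p)"
    by (rule sum_pairs_mono_neutral[OF finite_\<Lambda> \<Lambda>H1_subset]) (auto simp: mem_\<Lambda> mem_\<Lambda>H1 \<alpha>0)
  also have "(\<Sum>(m, n)\<in>\<Lambda> (i + j). \<beta> m n * pd D m n (source D a u) p)
      = (\<Sum>(m, n)\<in>\<Lambda> (i + j - 2). \<beta> m n * pd D m n (source D a u) p)"
    by (rule sum_pairs_mono_neutral[OF finite_\<Lambda>]) (auto simp: mem_\<Lambda> \<beta>0)
  finally show "pd D i j u p = (\<Sum>(m, n)\<in>\<Lambda>H1 (i + j). \<alpha> m n * pd D m n u p) +
      (\<Sum>(m, n)\<in>\<Lambda> (i + j - 2). \<beta> m n * pd D m n (source D a u) p)" .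
qed

text \<open>
  Monomials realise all unit jets, so equality for every smooth \<open>u\<close> determines the coefficients.
\<close>

lemma is_reduction_unique:
  assumes 1: "is_reduction D a p i j \<alpha> \<beta>" and 2: "is_reduction D a p i j \<alpha>' \<beta>'"
  shows "\<alpha> = \<alpha>'" "\<beta> = \<beta>'"
proof -
  let ?\<alpha> = "\<lambda>m n. \<alpha> m n - \<alpha>' m n" and ?\<beta> = "\<lambda>m n. \<beta> m n - \<beta>' m n"
  define c where "c m n = (fact m * fact n :: real)" for m n :: nat
  have null: "(\<Sum>(k, l)\<in>\<Lambda>H1 (i + j). ?\<alpha> k l * unit_jet (c m n) m n k l) +
      (\<Sum>(k, l)\<in>\<Lambda> (i + j - 2). ?\<beta> k l * jet_source ajet (unit_jet (c m n) m n) k l) = 0" for m n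
  proof -
    note mon = smooth_near_monomial[of m n]
    have jet: "pd D k l (monomial_at_p m n) p = unit_jet (c m n) m n k l" for k l
      by (simp add: pd_monomial_at_p[OF nbhd_exists] unit_jet_def c_def)
    have "pd D i j (monomial_at_p m n) p = (\<Sum>(k, l)\<in>\<Lambda>H1 (i + j). \<alpha> k l * pd D k l (monomial_at_p m n) p) +
        (\<Sum>(k, l)\<in>\<Lambda> (i + j - 2). \<beta> k l * pd D k l (source D a (monomial_at_p m n)) p)"
      using 1 mon unfolding is_reduction_def by blast
    moreover have "pd D i j (monomial_at_p m n) p = (\<Sum>(k, l)\<in>\<Lambda>H1 (i + j). \<alpha>' k l * pd D k l (monomial_at_p m n) p) +
        (\<Sum>(k, l)\<in>\<Lambda> (i + j - 2). \<beta>' k l * pd D k l (source D a (monomial_at_p m n)) p)"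
      using 2 mon unfolding is_reduction_def by blast
    ultimately have "(\<Sum>(k, l)\<in>\<Lambda>H1 (i + j). \<alpha> k l * unit_jet (c m n) m n k l) +
        (\<Sum>(k, l)\<in>\<Lambda> (i + j - 2). \<beta> k l * jet_source ajet (unit_jet (c m n) m n) k l)
        = (\<Sum>(k, l)\<in>\<Lambda>H1 (i + j). \<alpha>' k l * unit_jet (c m n) m n k l) +
        (\<Sum>(k, l)\<in>\<Lambda> (i + j - 2). \<beta>' k l * jet_source ajet (unit_jet (c m n) m n) k l)"
      unfolding source_jet[OF mon] jet by simp
    then show ?thesis
      by (simp add: case_prod_beta left_diff_distrib sum_subtractf)
  qed
  have A: "ajet 0 0 \<noteq> 0" using a_pos ajet_00 by simp
  have c: "c m n \<noteq> 0" for m n by (simp add: c_def)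
  note van = reduction_coefficients_vanish[where A=ajet and c=c and \<alpha>="?\<alpha>" and \<beta>="?\<beta>", OF A c null]
  show "\<alpha> = \<alpha>'"
  proof (intro ext)
    fix m n show "\<alpha> m n = \<alpha>' m n"
    proof (cases "(m, n) \<in> \<Lambda>H1 (i + j)")
      case True
      then show ?thesis using van(2)[OF True] by simp
    next
      case False
      then show ?thesis using 1 2 unfolding is_reduction_def by simp
    qed
  qed
  show "\<beta> = \<beta>'"
  proof (intro ext)
    fix m n show "\<beta> m n = \<beta>' m n"
    proof (cases "(m, n) \<in> \<Lambda> (i + j - 2)")
      case True
      then show ?thesis using van(1)[OF True] by simp
    next
      case False
      then show ?thesis using 1 2 unfolding is_reduction_def by simp
    qed
  qed
qed

text \<open>
  The definite description in \<open>reduction\<close> denotes the graded coefficients found above.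
\<close>

lemma reduction_coefficients:
  shows is_reduction_AH: "is_reduction D a p i j (AHu D a p i j) (AHf D a p i j)"
    and graded_AH: "graded ajet i j (AHu D a p i j) (AHf D a p i j)"
proof -
  have "ajet 0 0 \<noteq> 0" using a_pos ajet_00 by simp
  then obtain \<alpha> \<beta> where g: "graded ajet i j \<alpha> \<beta>" and r: "represents ajet (i + j) (\<lambda>U. U i j) \<alpha> \<beta>"
    using ex_graded_reduction[of ajet i j "i + j" "i + j"] by blast
  note red = graded_is_reduction[OF g r]
  have "reduction D a p i j = (\<alpha>, \<beta>)"
    unfolding reduction_def
  proof (rule the_equality)
    show "is_reduction D a p i j (fst (\<alpha>, \<beta>)) (snd (\<alpha>, \<beta>))" using red by simp
    show "z = (\<alpha>, \<beta>)" if "is_reduction D a p i j (fst z) (snd z)" for z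
      using is_reduction_unique[OF that red] by (simp add: prod_eq_iff)
  qed
  then have "AHu D a p i j = \<alpha>" "AHf D a p i j = \<beta>" by (simp_all add: AHu_def AHf_def fun_eq_iff)
  then show "is_reduction D a p i j (AHu D a p i j) (AHf D a p i j)"
    "graded ajet i j (AHu D a p i j) (AHf D a p i j)" using red g by simp_all
qed

lemma AHu_eq_0: "2 \<le> n \<or> i + j < m + n \<Longrightarrow> AHu D a p i j m n = 0"
  and AHf_eq_0: "i + j < m + n + 2 \<Longrightarrow> AHf D a p i j m n = 0"
  and AHu_top: "m + n = i + j \<Longrightarrow> AHu D a p i j m n = (if n = j mod 2 then (- 1) ^ (j div 2) else 0)"
  and AHf_top: "m + n + 2 = i + j \<Longrightarrow>
    AHf D a p i j m n = (if n + 2 \<le> j \<and> even (j - n) then (- 1) ^ ((j - n) div 2) / a p else 0)"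
  and AHu_subtop: "even j \<Longrightarrow> Suc m = i + j \<Longrightarrow>
    AHu D a p i j m 0 = (- 1) ^ (j div 2) * real (j div 2) * (pd D 1 0 a p / a p)"
  using graded_AH[of i j] unfolding graded_def ajet_00 by blast+

text \<open>
  The terms \<open>l \<ge> 1\<close> of the explicit sum in \<open>GH\<close> are the top-order coefficients \<open>(- 1)\<^sup>l\<close> at \<open>(m - 2l, n + 2l)\<close>, and the term
  \<open>l = 0\<close> is the monomial of \<open>u\<^sup>(\<^sup>m\<^sup>,\<^sup>n\<^sup>)\<close> itself.
\<close>

lemma GH_eq:
  assumes n: "n < 2" and mn: "m + n \<le> M + 1"
  shows "taylor_monomial x y m n + (\<Sum>(i, j)\<in>\<Lambda>H2 (M + 1). AHu D a p i j m n * taylor_monomial x y i j)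
    = GH D a p M m n x y"
proof -
  let ?g = "\<lambda>i j. AHu D a p i j m n * taylor_monomial x y i j"
  let ?H = "{(i, j) \<in> \<Lambda>H2 (M + 1). m + n < i + j}" and ?T = "(\<lambda>l. (m - 2 * l, n + 2 * l)) ` {1..m div 2}"
  have fin: "finite ?H" by (rule finite_subset[of _ "\<Lambda>H2 (M + 1)"]) auto
  have "(\<Sum>(i, j)\<in>\<Lambda>H2 (M + 1). ?g i j) = (\<Sum>(i, j)\<in>?T \<union> ?H. ?g i j)"
  proof (rule sum_pairs_mono_neutral)
    show "?T \<union> ?H \<subseteq> \<Lambda>H2 (M + 1)" using mn by (auto simp: mem_\<Lambda>H2)
    fix i j assume ij: "(i, j) \<in> \<Lambda>H2 (M + 1)" "(i, j) \<notin> ?T \<union> ?H"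
    then have "\<not> m + n < i + j" by blast
    then consider "i + j < m + n" | "m + n = i + j" by linarith
    then show "?g i j = 0"
    proof cases
      case 1
      then show ?thesis using AHu_eq_0[of n i j m] by simp
    next
      case 2
      have "n \<noteq> j mod 2"
      proof
        assume *: "n = j mod 2"
        have "2 \<le> j" using ij(1) by (simp add: mem_\<Lambda>H2)
        have j: "j = n + 2 * (j div 2)" unfolding * by simp
        then have m: "m = i + 2 * (j div 2)" using 2 by linarith
        then have "i = m - 2 * (j div 2)" "j div 2 \<in> {1..m div 2}" using \<open>2 \<le> j\<close> by auto
        with j have "(i, j) \<in> ?T" by blast
        then show False using ij(2) by blast
      qed
      then show ?thesis using AHu_top[OF 2] by simp
    qed
  qed simp
  also have "\<dots> = (\<Sum>(i, j)\<in>?T. ?g i j) + (\<Sum>(i, j)\<in>?H. ?g i j)"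
    using fin by (intro sum.union_disjoint) auto
  also have "(\<Sum>(i, j)\<in>?T. ?g i j) = (\<Sum>l = 1..m div 2. ?g (m - 2 * l) (n + 2 * l))"
    by (subst sum.reindex) (auto simp: inj_on_def)
  also have "\<dots> = (\<Sum>l = 1..m div 2. (- 1) ^ l * y ^ (n + 2 * l) * x ^ (m - 2 * l) / (fact (n + 2 * l) * fact (m - 2 * l)))"
  proof (rule sum.cong)
    fix l assume "l \<in> {1..m div 2}"
    then have "m + n = (m - 2 * l) + (n + 2 * l)" by auto
    from AHu_top[OF this] show "?g (m - 2 * l) (n + 2 * l)
        = (- 1) ^ l * y ^ (n + 2 * l) * x ^ (m - 2 * l) / (fact (n + 2 * l) * fact (m - 2 * l))"
      using n by (simp add: mult_ac)
  qed simp
  finally show ?thesis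
    unfolding GH_def by (subst sum.atLeast_Suc_atMost) (simp_all add: mult_ac)
qed

text \<open>
  As for \<open>GH\<close>: the explicit sum in \<open>QH\<close> collects the top-order coefficients \<open>(- 1)\<^sup>l / a\<close>.
\<close>

lemma QH_eq:
  assumes mn: "m + n + 2 \<le> M + 1"
  shows "(\<Sum>(i, j)\<in>\<Lambda>H2 (M + 1). AHf D a p i j m n * taylor_monomial x y i j) = QH D a p M m n x y"
proof -
  let ?g = "\<lambda>i j. AHf D a p i j m n * taylor_monomial x y i j"
  let ?H = "{(i, j) \<in> \<Lambda>H2 (M + 1). m + n + 2 < i + j}"
    and ?T = "(\<lambda>l. (m + 2 - 2 * l, n + 2 * l)) ` {1..1 + m div 2}"
  have fin: "finite ?H" by (rule finite_subset[of _ "\<Lambda>H2 (M + 1)"]) auto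
  have "(\<Sum>(i, j)\<in>\<Lambda>H2 (M + 1). ?g i j) = (\<Sum>(i, j)\<in>?T \<union> ?H. ?g i j)"
  proof (rule sum_pairs_mono_neutral)
    show "?T \<union> ?H \<subseteq> \<Lambda>H2 (M + 1)" using mn by (auto simp: mem_\<Lambda>H2)
    fix i j assume ij: "(i, j) \<in> \<Lambda>H2 (M + 1)" "(i, j) \<notin> ?T \<union> ?H"
    then have "\<not> m + n + 2 < i + j" by blast
    then consider "i + j < m + n + 2" | "m + n + 2 = i + j" by linarith
    then show "?g i j = 0"
    proof cases
      case 1
      then show ?thesis using AHf_eq_0[of i j m n] by simp
    next
      case 2
      have "(n + 2 \<le> j \<and> even (j - n)) = False"
      proof (rule ccontr)
        assume "(n + 2 \<le> j \<and> even (j - n)) \<noteq> False"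
        then have *: "n + 2 \<le> j \<and> even (j - n)" by blast
        define l where "l = (j - n) div 2"
        have "j = n + 2 * l" using * by (auto simp: l_def)
        moreover from this have "i = m + 2 - 2 * l" "l \<in> {1..1 + m div 2}"
          using 2 * by auto
        ultimately have "(i, j) \<in> ?T" by blast
        then show False using ij(2) by blast
      qed
      then show ?thesis by (simp only: AHf_top[OF 2] if_False mult_zero_left)
    qed
  qed simp
  also have "\<dots> = (\<Sum>(i, j)\<in>?T. ?g i j) + (\<Sum>(i, j)\<in>?H. ?g i j)"
    using fin by (intro sum.union_disjoint) auto
  also have "(\<Sum>(i, j)\<in>?T. ?g i j) = (\<Sum>l = 1..1 + m div 2. ?g (m + 2 - 2 * l) (n + 2 * l))"
    by (subst sum.reindex) (auto simp: inj_on_def)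
  also have "\<dots> = 1 / a p * (\<Sum>l = 1..1 + m div 2.
      (- 1) ^ l * y ^ (n + 2 * l) * x ^ (m + 2 - 2 * l) / (fact (n + 2 * l) * fact (m + 2 - 2 * l)))"
    unfolding sum_distrib_left
  proof (rule sum.cong)
    fix l assume l: "l \<in> {1..1 + m div 2}"
    then have "m + n + 2 = (m + 2 - 2 * l) + (n + 2 * l)" by auto
    from AHf_top[OF this] show "?g (m + 2 - 2 * l) (n + 2 * l) = 1 / a p *
        ((- 1) ^ l * y ^ (n + 2 * l) * x ^ (m + 2 - 2 * l) / (fact (n + 2 * l) * fact (m + 2 - 2 * l)))"
      using l by (simp add: mult_ac)
  qed simp
  finally show ?thesis unfolding QH_def .
qed

text \<open>
  Substituting the reduction for all derivatives with \<open>n \<ge> 2\<close> and exchanging the sums. The index sets of the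
  individual reductions may be enlarged to common ones, since the coefficients vanish outside.
\<close>

lemma taylor_polynomial_reduced:
  assumes u: "smooth_near D p u" and M: "1 \<le> M"
  shows "(\<Sum>(m, n)\<in>\<Lambda> (M + 1). pd D m n u p * taylor_monomial x y m n)
    = (\<Sum>(m, n)\<in>\<Lambda>H1 (M + 1). pd D m n u p * GH D a p M m n x y)
    + (\<Sum>(m, n)\<in>\<Lambda> (M - 1). pd D m n (source D a u) p * QH D a p M m n x y)"
proof -
  let ?U = "\<lambda>m n. pd D m n u p" and ?F = "\<lambda>m n. pd D m n (source D a u) p"
  let ?w = "taylor_monomial x y"
  have swap: "(\<Sum>(i, j)\<in>\<Lambda>H2 (M + 1). (\<Sum>(m, n)\<in>I. A i j m n * V m n) * ?w i j)
      = (\<Sum>(m, n)\<in>I. V m n * (\<Sum>(i, j)\<in>\<Lambda>H2 (M + 1). A i j m n * ?w i j))"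
    for I :: "(nat \<times> nat) set" and A :: "nat \<Rightarrow> nat \<Rightarrow> nat \<Rightarrow> nat \<Rightarrow> real" and V :: "nat \<Rightarrow> nat \<Rightarrow> real"
  proof -
    have "(\<Sum>(i, j)\<in>\<Lambda>H2 (M + 1). (\<Sum>(m, n)\<in>I. A i j m n * V m n) * ?w i j)
      = (\<Sum>k\<in>\<Lambda>H2 (M + 1). \<Sum>x\<in>I. A (fst k) (snd k) (fst x) (snd x) * V (fst x) (snd x) * ?w (fst k) (snd k))"
      by (simp only: split_def sum_distrib_right)
    also have "\<dots> = (\<Sum>x\<in>I. \<Sum>k\<in>\<Lambda>H2 (M + 1). A (fst k) (snd k) (fst x) (snd x) * V (fst x) (snd x) * ?w (fst k) (snd k))"
      by (rule sum.swap)
    also have "\<dots> = (\<Sum>(m, n)\<in>I. V m n * (\<Sum>(i, j)\<in>\<Lambda>H2 (M + 1). A i j m n * ?w i j))"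
      by (simp only: split_def sum_distrib_left mult_ac)
    finally show ?thesis .
  qed
  have red: "?U i j = (\<Sum>(m, n)\<in>\<Lambda>H1 (M + 1). AHu D a p i j m n * ?U m n)
      + (\<Sum>(m, n)\<in>\<Lambda> (M - 1). AHf D a p i j m n * ?F m n)" if ij: "(i, j) \<in> \<Lambda>H2 (M + 1)" for i j
  proof -
    have "?U i j = (\<Sum>(m, n)\<in>\<Lambda>H1 (i + j). AHu D a p i j m n * ?U m n)
      + (\<Sum>(m, n)\<in>\<Lambda> (i + j - 2). AHf D a p i j m n * ?F m n)"
      using is_reduction_AH[of i j] u unfolding is_reduction_def by blast
    also have "(\<Sum>(m, n)\<in>\<Lambda>H1 (i + j). AHu D a p i j m n * ?U m n)
        = (\<Sum>(m, n)\<in>\<Lambda>H1 (M + 1). AHu D a p i j m n * ?U m n)"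
      using ij by (intro sum_pairs_mono_neutral[symmetric]) (auto simp: mem_\<Lambda>H1 mem_\<Lambda>H2 AHu_eq_0)
    also have "(\<Sum>(m, n)\<in>\<Lambda> (i + j - 2). AHf D a p i j m n * ?F m n)
        = (\<Sum>(m, n)\<in>\<Lambda> (M - 1). AHf D a p i j m n * ?F m n)"
      using ij by (intro sum_pairs_mono_neutral[symmetric]) (auto simp: mem_\<Lambda> mem_\<Lambda>H2 AHf_eq_0)
    finally show ?thesis .
  qed
  have split: "\<Lambda> (M + 1) = \<Lambda>H1 (M + 1) \<union> \<Lambda>H2 (M + 1)" "\<Lambda>H1 (M + 1) \<inter> \<Lambda>H2 (M + 1) = {}"
    by (auto simp: \<Lambda>H1_def \<Lambda>H2_def)
  have "(\<Sum>(m, n)\<in>\<Lambda> (M + 1). ?U m n * ?w m n)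
      = (\<Sum>(m, n)\<in>\<Lambda>H1 (M + 1). ?U m n * ?w m n) + (\<Sum>(i, j)\<in>\<Lambda>H2 (M + 1). ?U i j * ?w i j)"
    unfolding split(1) by (rule sum.union_disjoint) (use split(2) in auto)
  also have "(\<Sum>(i, j)\<in>\<Lambda>H2 (M + 1). ?U i j * ?w i j)
      = (\<Sum>(i, j)\<in>\<Lambda>H2 (M + 1). (\<Sum>(m, n)\<in>\<Lambda>H1 (M + 1). AHu D a p i j m n * ?U m n) * ?w i j
         + (\<Sum>(m, n)\<in>\<Lambda> (M - 1). AHf D a p i j m n * ?F m n) * ?w i j)"
  proof (intro sum.cong refl, clarify)
    fix i j assume ij: "(i, j) \<in> \<Lambda>H2 (M + 1)"
    show "?U i j * ?w i j = (\<Sum>(m, n)\<in>\<Lambda>H1 (M + 1). AHu D a p i j m n * ?U m n) * ?w i j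
         + (\<Sum>(m, n)\<in>\<Lambda> (M - 1). AHf D a p i j m n * ?F m n) * ?w i j"
      by (subst red[OF ij]) (rule distrib_right)
  qed
  also have "\<dots> = (\<Sum>(i, j)\<in>\<Lambda>H2 (M + 1). (\<Sum>(m, n)\<in>\<Lambda>H1 (M + 1). AHu D a p i j m n * ?U m n) * ?w i j)
      + (\<Sum>(i, j)\<in>\<Lambda>H2 (M + 1). (\<Sum>(m, n)\<in>\<Lambda> (M - 1). AHf D a p i j m n * ?F m n) * ?w i j)"
    by (simp only: split_def sum.distrib)
  also have "(\<Sum>(m, n)\<in>\<Lambda>H1 (M + 1). ?U m n * ?w m n) + \<dots>
      = ((\<Sum>(m, n)\<in>\<Lambda>H1 (M + 1). ?U m n * ?w m n)
        + (\<Sum>(m, n)\<in>\<Lambda>H1 (M + 1). ?U m n * (\<Sum>(i, j)\<in>\<Lambda>H2 (M + 1). AHu D a p i j m n * ?w i j)))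
        + (\<Sum>(m, n)\<in>\<Lambda> (M - 1). ?F m n * (\<Sum>(i, j)\<in>\<Lambda>H2 (M + 1). AHf D a p i j m n * ?w i j))"
    unfolding swap by (rule add.assoc[symmetric])
  also have "(\<Sum>(m, n)\<in>\<Lambda>H1 (M + 1). ?U m n * ?w m n)
        + (\<Sum>(m, n)\<in>\<Lambda>H1 (M + 1). ?U m n * (\<Sum>(i, j)\<in>\<Lambda>H2 (M + 1). AHu D a p i j m n * ?w i j))
      = (\<Sum>(m, n)\<in>\<Lambda>H1 (M + 1). ?U m n * (?w m n + (\<Sum>(i, j)\<in>\<Lambda>H2 (M + 1). AHu D a p i j m n * ?w i j)))"
    by (simp only: split_def distrib_left sum.distrib)
  also have "\<dots> = (\<Sum>(m, n)\<in>\<Lambda>H1 (M + 1). ?U m n * GH D a p M m n x y)"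
  proof (intro sum.cong refl, clarify)
    fix m n assume "(m, n) \<in> \<Lambda>H1 (M + 1)"
    then have "n < 2" "m + n \<le> M + 1" by (auto simp: mem_\<Lambda>H1)
    from GH_eq[OF this] show "?U m n * (?w m n + (\<Sum>(i, j)\<in>\<Lambda>H2 (M + 1). AHu D a p i j m n * ?w i j))
      = ?U m n * GH D a p M m n x y" by (rule arg_cong)
  qed
  also have "(\<Sum>(m, n)\<in>\<Lambda> (M - 1). ?F m n * (\<Sum>(i, j)\<in>\<Lambda>H2 (M + 1). AHf D a p i j m n * ?w i j))
      = (\<Sum>(m, n)\<in>\<Lambda> (M - 1). ?F m n * QH D a p M m n x y)"
  proof (intro sum.cong refl, clarify)
    fix m n assume "(m, n) \<in> \<Lambda> (M - 1)"
    then have "m + n + 2 \<le> M + 1" using M by (auto simp: mem_\<Lambda>)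
    from QH_eq[OF this] show "?F m n * (\<Sum>(i, j)\<in>\<Lambda>H2 (M + 1). AHf D a p i j m n * ?w i j)
      = ?F m n * QH D a p M m n x y" by (rule arg_cong)
  qed
  finally show ?thesis .
qed

end

end

section \<open>Schemes of order six\<close>

lemma poly_bigo_1: "poly P \<in> O[at_right 0](\<lambda>_. 1 :: real)"
proof (rule bigoI_tendsto)
  have "isCont (poly P) (0::real)" by simp
  then have "(poly P \<longlongrightarrow> poly P 0) (at_right 0)"
    unfolding isCont_def by (rule tendsto_mono[rotated]) (simp add: at_le)
  then show "((\<lambda>h. poly P h / 1) \<longlongrightarrow> poly P 0) (at_right 0)" by simp
qed simp

lemma poly_factor_power:
  fixes P :: "real poly"
  assumes "\<And>i. i < N \<Longrightarrow> coeff P i = 0"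
  shows "P = monom 1 N * poly_shift N P"
  using assms by (intro poly_eqI) (auto simp: coeff_monom_mult coeff_poly_shift)

text \<open>
  For polynomials, vanishing of order \<open>N\<close> from the right is a statement about coefficients: a first non-zero
  coefficient before \<open>h\<^sup>N\<close> would be a non-zero limit of a function that tends to zero.
\<close>

lemma poly_bigo_power_iff:
  fixes P :: "real poly"
  shows "poly P \<in> O[at_right 0](\<lambda>h. h ^ N) \<longleftrightarrow> (\<forall>i<N. coeff P i = 0)"
proof
  assume *: "\<forall>i<N. coeff P i = 0"
  have "(\<lambda>h. h ^ N * poly (poly_shift N P) h) \<in> O[at_right 0](\<lambda>h. h ^ N * 1)"
    by (intro landau_o.big_mult poly_bigo_1) simp
  moreover have "poly P = (\<lambda>h. h ^ N * poly (poly_shift N P) h)"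
    using poly_factor_power[of N P] * by (intro ext) (metis mult_cancel_right1 poly_monom poly_mult)
  ultimately show "poly P \<in> O[at_right 0](\<lambda>h. h ^ N)" by (simp only: mult_1_right)
next
  assume O: "poly P \<in> O[at_right 0](\<lambda>h. h ^ N)"
  show "\<forall>i<N. coeff P i = 0"
  proof (intro allI impI)
    fix i assume "i < N"
    then show "coeff P i = 0"
    proof (induction i rule: less_induct)
      case (less i)
      let ?Q = "poly_shift i P"
      have P: "poly P h = h ^ i * poly ?Q h" for h
        using poly_factor_power[of i P] less by (metis dual_order.strict_trans lambda_one poly_monom poly_mult)
      obtain c where c: "eventually (\<lambda>h. norm (poly P h) \<le> c * norm (h ^ N)) (at_right 0)"
        using O by (elim landau_o.bigE)
      have "eventually (\<lambda>h::real. 0 < h) (at_right 0)" by (rule eventually_at_right_less)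
      then have bound: "eventually (\<lambda>h. norm (poly ?Q h) \<le> c * h ^ (N - i)) (at_right 0)"
        using c
      proof eventually_elim
        case (elim h)
        have "h ^ N = h ^ i * h ^ (N - i)" using less.prems by (simp flip: power_add)
        then have "h ^ i * norm (poly ?Q h) \<le> h ^ i * (c * h ^ (N - i))"
          using elim by (simp add: P abs_mult mult_ac)
        then show ?case using elim(1) by simp
      qed
      have "((\<lambda>h::real. c * h ^ (N - i)) \<longlongrightarrow> c * 0 ^ (N - i)) (at_right 0)"
        by (intro tendsto_intros)
      then have "((\<lambda>h::real. c * h ^ (N - i)) \<longlongrightarrow> 0) (at_right 0)"
        using less.prems by (simp add: power_0_left)
      then have "(poly ?Q \<longlongrightarrow> 0) (at_right 0)" by (rule Lim_null_comparison[OF bound])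
      moreover have "(poly ?Q \<longlongrightarrow> poly ?Q 0) (at_right 0)"
      proof -
        have "isCont (poly ?Q) 0" by simp
        then show ?thesis unfolding isCont_def by (rule tendsto_mono[rotated]) (simp add: at_le)
      qed
      ultimately have "poly ?Q 0 = 0"
        using tendsto_unique trivial_limit_at_right_real by blast
      then show ?case by (simp add: poly_0_coeff_0 coeff_poly_shift)
    qed
  qed
qed

lemma stencil_sum_diff:
  "stencil_sum C (\<lambda>x y. v x y - w x y) h = stencil_sum C v h - stencil_sum C w h"
  by (simp add: stencil_sum_def right_diff_distrib sum_subtractf)

lemma stencil_sum_add:
  "stencil_sum C (\<lambda>x y. v x y + w x y) h = stencil_sum C v h + stencil_sum C w h"
  by (simp add: stencil_sum_def distrib_left sum.distrib)

lemma stencil_sum_lincomb: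
  assumes "finite I"
  shows "stencil_sum C (\<lambda>x y. \<Sum>(m, n)\<in>I. c m n * v m n x y) h = (\<Sum>(m, n)\<in>I. c m n * stencil_sum C (v m n) h)"
  using assms
proof (induction I rule: finite_induct)
  case empty
  then show ?case by (simp add: stencil_sum_def)
next
  case (insert i I)
  have "stencil_sum C (\<lambda>x y. c m n * v m n x y) h = c m n * stencil_sum C (v m n) h" for m n
    by (simp add: stencil_sum_def algebra_simps)
  then show ?case using insert by (simp add: stencil_sum_add case_prod_beta)
qed

context bottom_side_point
begin

text \<open>
  The residual of the scheme consists of the stencil sums of \<open>G\<^sub>n\<^sub>,\<^sub>0\<close> and of the stencil sum of a Taylor remainder; the other parts
  of the Taylor polynomial are cancelled by the right-hand side.
\<close>

lemma consistency_order:
  assumes pos: "pos_smooth_near D p a" and nontriv: "nontrivial C" and M: "1 \<le> M"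
    and G0: "\<And>n. n \<le> M + 1 \<Longrightarrow> stencil_sum C (GH D a p M n 0) \<in> O[at_right 0](\<lambda>h. h ^ (M + 2))"
  shows "scheme_has_order D a p C
          (\<Lambda> (M - 1)) (\<lambda>m n. stencil_sum C (QH D a p M m n))
          {0..M} (\<lambda>n h. - stencil_sum C (GH D a p M n 1) h)
          (M + 1)"
  unfolding scheme_has_order_def
proof (intro conjI allI impI)
  fix u assume u: "smooth_near D p u"
  then obtain S where S: "nbhd S" "smooth S u" by (auto simp: smooth_near_iff)
  let ?U = "\<lambda>m n. pd D m n u p" and ?F = "\<lambda>m n. pd D m n (source D a u) p"
  let ?u = "\<lambda>x y. u (x\<^sub>0 + x, l\<^sub>3 + y)"
  let ?T = "\<lambda>x y. \<Sum>(m, n)\<in>\<Lambda> (M + 1). ?U m n * taylor_monomial x y m n"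
  let ?G = "\<lambda>m n. stencil_sum C (GH D a p M m n)" and ?Q = "\<lambda>m n. stencil_sum C (QH D a p M m n)"
  have rem: "(\<lambda>h. stencil_sum C (\<lambda>x y. ?u x y - ?T x y) h) \<in> O[at_right 0](\<lambda>h. h ^ (M + 2))"
    unfolding stencil_sum_def
  proof (intro big_sum_in_bigo)
    fix k :: int and l :: nat assume kl: "k \<in> {-1, 0, 1}" "l \<in> {0, 1}"
    then have "(\<lambda>h. u (x\<^sub>0 + real_of_int k * h, l\<^sub>3 + real l * h) -
        (\<Sum>(m, n)\<in>\<Lambda> (M + 1). ?U m n * taylor_monomial (real_of_int k * h) (real l * h) m n))
        \<in> O[at_right 0](\<lambda>h. h ^ (M + 1 + 1))"
      by (intro taylor_remainder[OF S]) auto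
    then have "(\<lambda>h. poly (C k l) h * (u (x\<^sub>0 + real_of_int k * h, l\<^sub>3 + real l * h) -
        (\<Sum>(m, n)\<in>\<Lambda> (M + 1). ?U m n * taylor_monomial (real_of_int k * h) (real l * h) m n)))
        \<in> O[at_right 0](\<lambda>h. 1 * h ^ (M + 1 + 1))"
      by (intro landau_o.big_mult poly_bigo_1)
    then show "(\<lambda>h. poly (C k l) h * (u (x\<^sub>0 + real_of_int k * h, l\<^sub>3 + real l * h) -
        (\<Sum>(m, n)\<in>\<Lambda> (M + 1). ?U m n * taylor_monomial (real_of_int k * h) (real l * h) m n)))
        \<in> O[at_right 0](\<lambda>h. h ^ (M + 2))" by simp
  qed
  have T: "stencil_sum C ?T h = (\<Sum>(m, n)\<in>\<Lambda>H1 (M + 1). ?U m n * ?G m n h) + (\<Sum>(m, n)\<in>\<Lambda> (M - 1). ?F m n * ?Q m n h)" for h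
    unfolding taylor_polynomial_reduced[OF pos u M] stencil_sum_add
    by (simp only: stencil_sum_lincomb finite_\<Lambda>H finite_\<Lambda>)
  have H1: "\<Lambda>H1 (M + 1) = (\<lambda>n. (n, 0)) ` {..M + 1} \<union> (\<lambda>n. (n, 1)) ` {0..M}"
    by (auto simp: mem_\<Lambda>H1 less_2_cases_iff)
  have H1_sum: "(\<Sum>(m, n)\<in>\<Lambda>H1 (M + 1). ?U m n * ?G m n h)
      = (\<Sum>n\<le>M + 1. ?U n 0 * ?G n 0 h) + (\<Sum>n\<in>{0..M}. ?U n 1 * ?G n 1 h)" for h
    unfolding H1 by (subst sum.union_disjoint) (auto simp: sum.reindex inj_on_def)
  have U0: "(\<lambda>h. ?U n 0 * ?G n 0 h) \<in> O[at_right 0](\<lambda>h. h ^ (M + 2))" if "n \<in> {..M + 1}" for n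
    using landau_o.big_mult[of "\<lambda>_. ?U n 0" "at_right 0" "\<lambda>_. 1", OF _ G0[of n]] that by simp
  have g3: "(deriv ^^ n) (g3 D l\<^sub>3 u) x\<^sub>0 = - ?U n 1" for n
    by (rule higher_deriv_g3[OF S nbhd_p[OF S(1)]])
  have "stencil_sum C ?u h - ((\<Sum>(m, n)\<in>\<Lambda> (M - 1). ?F m n * ?Q m n h) +
            (\<Sum>n\<in>{0..M}. (deriv ^^ n) (g3 D l\<^sub>3 u) x\<^sub>0 * - ?G n 1 h))
      = stencil_sum C (\<lambda>x y. ?u x y - ?T x y) h + (\<Sum>n\<le>M + 1. ?U n 0 * ?G n 0 h)" for h
    unfolding stencil_sum_diff T H1_sum g3 by simp
  moreover have "(\<lambda>h. stencil_sum C (\<lambda>x y. ?u x y - ?T x y) h + (\<Sum>n\<le>M + 1. ?U n 0 * ?G n 0 h))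
      \<in> O[at_right 0](\<lambda>h. h ^ (M + 2))"
    by (intro sum_in_bigo rem big_sum_in_bigo U0) auto
  ultimately show "(\<lambda>h. stencil_sum C (\<lambda>x y. u (fst p + x, snd p + y)) h -
             ((\<Sum>(m, n)\<in>\<Lambda> (M - 1). ?F m n * ?Q m n h) +
              (\<Sum>n\<in>{0..M}. (deriv ^^ n) (g3 D (snd p) u) (fst p) * - ?G n 1 h)))
          \<in> O[at_right 0](\<lambda>h. h ^ (M + 1 + 1))"
    by simp
qed (use nontriv in auto)


text \<open>
  \<open>Re (k + il)\<^sup>n\<close>, which is \<open>n!\<close> times the leading coefficient of \<open>G\<^sub>n\<^sub>,\<^sub>0(kh, lh)\<close>: to leading order \<open>G\<^sub>n\<^sub>,\<^sub>0\<close> is harmonic and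
  even in \<open>y\<close>.
\<close>

definition harmonic_moment :: "nat \<Rightarrow> int \<Rightarrow> nat \<Rightarrow> real" where
  "harmonic_moment n k l = Re (Complex (of_int k) (of_nat l) ^ n)"

text \<open>
  For odd \<open>n\<close> only \<open>A = c\<^sub>1\<^sub>0 - c\<^sub>-\<^sub>1\<^sub>0\<close> and \<open>B = c\<^sub>1\<^sub>1 - c\<^sub>-\<^sub>1\<^sub>1\<close> enter; the equations for \<open>n = 1, 3\<close> are \<open>A + B = r\<^sub>1\<close>,
  \<open>A - 2 B = r\<^sub>3\<close>, and that for \<open>n = 5\<close> has left-hand side \<open>A - 4 B\<close>. For even \<open>n \<le> 4\<close> the equations are
  independent, and a solution with \<open>c\<^sub>1\<^sub>1 + c\<^sub>-\<^sub>1\<^sub>1 = 0\<close> is chosen.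
\<close>

lemma six_point_system_solvable:
  fixes r :: "nat \<Rightarrow> real"
  obtains c :: "int \<Rightarrow> nat \<Rightarrow> real"
  where "\<And>n. n \<le> 4 \<Longrightarrow> (\<Sum>k\<in>{-1, 0, 1}. \<Sum>l\<in>{0, 1}. c k l * harmonic_moment n k l) = r n"
    and "(\<Sum>k\<in>{-1, 0, 1}. \<Sum>l\<in>{0, 1}. c k l * harmonic_moment 5 k l) = 5 / 3 * r 3 - 2 / 3 * r 1"
proof
  define s where "s = (r 2 + r 4) / 2"
  define A where "A = (2 * r 1 + r 3) / 3"
  define c :: "int \<Rightarrow> nat \<Rightarrow> real" where
    "c k l = (if l = 0 then (if k = 0 then r 0 - r 4 else (s + of_int k * A) / 2)
      else (if k = 0 then (r 4 - r 2) / 2 else of_int k * (r 1 - r 3) / 6))" for k l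
  show "(\<Sum>k\<in>{-1, 0, 1}. \<Sum>l\<in>{0, 1}. c k l * harmonic_moment n k l) = r n" if n: "n \<le> 4" for n
  proof -
    consider "n = 0" | "n = 1" | "n = 2" | "n = 3" | "n = 4" using n by linarith
    then show ?thesis
      by cases (simp_all add: c_def harmonic_moment_def s_def A_def power_numeral_reduce field_simps)
  qed
  show "(\<Sum>k\<in>{-1, 0, 1}. \<Sum>l\<in>{0, 1}. c k l * harmonic_moment 5 k l) = 5 / 3 * r 3 - 2 / 3 * r 1"
    by (simp add: c_def harmonic_moment_def s_def A_def power_numeral_reduce field_simps)
qed

context
  fixes a :: "real \<times> real \<Rightarrow> real"
  assumes pos: "pos_smooth_near D p a"
begin

text \<open>
  \<open>G\<^sub>n\<^sub>,\<^sub>0(kh, lh)\<close> as a polynomial in \<open>h\<close>, so that conditions \<open>O(h\<^sup>7)\<close> become conditions on coefficients.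
\<close>

definition GH_poly :: "nat \<Rightarrow> nat \<Rightarrow> int \<Rightarrow> nat \<Rightarrow> real poly" where
  "GH_poly M n k l = monom (taylor_monomial (of_int k) (of_nat l) n 0) n +
     (\<Sum>(i, j)\<in>\<Lambda>H2 (M + 1). monom (AHu D a p i j n 0 * taylor_monomial (of_int k) (of_nat l) i j) (i + j))"

lemma poly_GH_poly:
  assumes "n \<le> M + 1"
  shows "poly (GH_poly M n k l) h = GH D a p M n 0 (of_int k * h) (of_nat l * h)"
proof -
  have tm: "taylor_monomial (of_int k * h) (of_nat l * h) i j
      = taylor_monomial (of_int k) (of_nat l) i j * h ^ (i + j)" for i j
    by (simp add: power_mult_distrib power_add)
  show ?thesis
    using assms GH_eq[OF pos, of 0 n M "of_int k * h" "of_nat l * h", symmetric]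
    unfolding tm GH_poly_def by (simp add: poly_sum poly_monom split_def mult.assoc)
qed

lemma coeff_GH_poly:
  assumes "d \<le> M + 1"
  shows "coeff (GH_poly M n k l) d = (if d = n then taylor_monomial (of_int k) (of_nat l) n 0 else 0) +
    (\<Sum>j = 2..d. AHu D a p (d - j) j n 0 * taylor_monomial (of_int k) (of_nat l) (d - j) j)"
proof -
  let ?g = "\<lambda>i j. AHu D a p i j n 0 * taylor_monomial (of_int k) (of_nat l) i j"
  have "(\<Sum>(i, j)\<in>\<Lambda>H2 (M + 1). if i + j = d then ?g i j else 0)
      = (\<Sum>(i, j)\<in>(\<lambda>j. (d - j, j)) ` {2..d}. if i + j = d then ?g i j else 0)"
    by (rule sum_pairs_mono_neutral) (use assms in \<open>auto simp: mem_\<Lambda>H2 image_iff\<close>)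
  also have "\<dots> = (\<Sum>j = 2..d. ?g (d - j) j)"
    by (subst sum.reindex) (auto simp: inj_on_def)
  finally have *: "(\<Sum>(i, j)\<in>\<Lambda>H2 (M + 1). if i + j = d then ?g i j else 0) = (\<Sum>j = 2..d. ?g (d - j) j)" .
  have "coeff (GH_poly M n k l) d = (if d = n then taylor_monomial (of_int k) (of_nat l) n 0 else 0) +
      (\<Sum>(i, j)\<in>\<Lambda>H2 (M + 1). if i + j = d then ?g i j else 0)"
    unfolding GH_poly_def by (simp only: coeff_add coeff_sum coeff_monom split_def eq_commute[of n d])
  then show ?thesis unfolding * .
qed

lemma coeff_GH_poly_below: "d < n \<Longrightarrow> d \<le> M + 1 \<Longrightarrow> coeff (GH_poly M n k l) d = 0"
  by (simp add: coeff_GH_poly AHu_eq_0[OF pos])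

lemma coeff_GH_poly_lead:
  assumes "n \<le> 6" "k \<in> {-1, 0, 1}" "l \<in> {0, 1}"
  shows "coeff (GH_poly 5 n k l) n = harmonic_moment n k l / fact n"
proof -
  consider "n = 0" | "n = 1" | "n = 2" | "n = 3" | "n = 4" | "n = 5" | "n = 6" using assms(1) by linarith
  then show ?thesis
    using assms(2,3)
    by cases (auto simp: coeff_GH_poly AHu_top[OF pos] harmonic_moment_def sum.atLeast_Suc_atMost power_numeral_reduce
        fact_numeral power_0_left)
qed

definition residual :: "(int \<Rightarrow> nat \<Rightarrow> real poly) \<Rightarrow> nat \<Rightarrow> real poly" where
  "residual C n = (\<Sum>k\<in>{-1, 0, 1}. \<Sum>l\<in>{0, 1}. C k l * GH_poly 5 n k l)"

text \<open>
  Adding \<open>c h\<^sup>d\<^sup>+\<^sup>1\<close> to the stencil changes the \<open>n\<close>-th residual only from the power \<open>h\<^sup>n\<^sup>+\<^sup>d\<^sup>+\<^sup>1\<close> on, and there by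
  \<open>\<Sum> c Re \<zeta>\<^sup>n / n!\<close>. For \<open>d \<ge> 1\<close> only \<open>n \<le> 4\<close> is required; for \<open>d = 0\<close> also \<open>n = 5\<close>, which demands the
  compatibility of the three odd residuals.
\<close>

lemma extend_one_order:
  assumes C: "\<And>n e. e \<le> d \<Longrightarrow> n + e \<le> 6 \<Longrightarrow> coeff (residual C n) (n + e) = 0"
    and d: "d = 0 \<Longrightarrow> fact 5 * coeff (residual C 5) 6 =
      5 / 3 * (fact 3 * coeff (residual C 3) 4) - 2 / 3 * (fact 1 * coeff (residual C 1) 2)"
  obtains C' where "\<And>k l. coeff (C' k l) 0 = coeff (C k l) 0"
    "\<And>n e. e \<le> Suc d \<Longrightarrow> n + e \<le> 6 \<Longrightarrow> coeff (residual C' n) (n + e) = 0"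
proof -
  let ?r = "\<lambda>n. - fact n * coeff (residual C n) (n + Suc d)"
  obtain c where c: "\<And>n. n \<le> 4 \<Longrightarrow> (\<Sum>k\<in>{-1, 0, 1}. \<Sum>l\<in>{0, 1}. c k l * harmonic_moment n k l) = ?r n"
    and c5: "(\<Sum>k\<in>{-1, 0, 1}. \<Sum>l\<in>{0, 1}. c k l * harmonic_moment 5 k l) = 5 / 3 * ?r 3 - 2 / 3 * ?r 1"
    by (rule six_point_system_solvable[of ?r]) blast
  define C' where "C' k l = C k l + monom (c k l) (Suc d)" for k l
  have res: "residual C' n = residual C n +
      (\<Sum>k\<in>{-1, 0, 1}. \<Sum>l\<in>{0, 1}. monom (c k l) (Suc d) * GH_poly 5 n k l)" for n
    by (simp only: residual_def C'_def distrib_right sum.distrib)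
  have "coeff (residual C' n) (n + e) = 0" if e: "e \<le> Suc d" and ne: "n + e \<le> 6" for n e
  proof (cases "e = Suc d")
    case False
    then have "coeff (monom (c k l) (Suc d) * GH_poly 5 n k l) (n + e) = 0" for k l
      using e ne by (auto simp: coeff_monom_mult intro!: coeff_GH_poly_below)
    then show ?thesis using C[of e n] False e ne by (simp add: res coeff_sum)
  next
    case True
    have "coeff (monom (c k l) (Suc d) * GH_poly 5 n k l) (n + e) = c k l * harmonic_moment n k l / fact n"
      if "k \<in> {-1, 0, 1}" "l \<in> {0, 1}" for k l
      using True ne that coeff_GH_poly_lead[of n k l] by (simp add: coeff_monom_mult)
    then have "coeff (residual C' n) (n + e) = coeff (residual C n) (n + Suc d) +
        (\<Sum>k\<in>{-1, 0, 1}. \<Sum>l\<in>{0, 1}. c k l * harmonic_moment n k l) / fact n"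
      unfolding res coeff_add coeff_sum True sum_divide_distrib by simp
    also have "(\<Sum>k\<in>{-1, 0, 1}. \<Sum>l\<in>{0, 1}. c k l * harmonic_moment n k l) = ?r n"
    proof (cases "n \<le> 4")
      case True
      then show ?thesis by (rule c)
    next
      case False
      then have "n = 5" "d = 0" using ne \<open>e = Suc d\<close> by auto
      then show ?thesis using c5 d by (simp add: numeral_2_eq_2)
    qed
    finally show ?thesis by simp
  qed
  moreover have "coeff (C' k l) 0 = coeff (C k l) 0" for k l by (simp add: C'_def)
  ultimately show thesis using that[of C'] by blast
qed

text \<open>
  The reflection in the bottom side of the nine-point stencil of the Laplacian. Up to a factor it is the only non-zero choice.
\<close>

definition leading_stencil :: "int \<Rightarrow> nat \<Rightarrow> real" where
  "leading_stencil k l = (if l = 0 then (if k = 0 then - 10 else 2) else (if k = 0 then 4 else 1))"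

lemma residual_const:
  "coeff (residual (\<lambda>k l. [:leading_stencil k l:]) n) d = (\<Sum>k\<in>{-1, 0, 1}. \<Sum>l\<in>{0, 1}. leading_stencil k l * coeff (GH_poly 5 n k l) d)"
  by (simp add: residual_def coeff_sum)

lemma residual_leading_stencil_lead:
  assumes "n \<le> 6"
  shows "coeff (residual (\<lambda>k l. [:leading_stencil k l:]) n) n = 0"
proof -
  consider "n = 0" | "n = 1" | "n = 2" | "n = 3" | "n = 4" | "n = 5" | "n = 6" using assms by linarith
  then have "(\<Sum>k\<in>{-1, 0, 1}. \<Sum>l\<in>{0, 1}. leading_stencil k l * harmonic_moment n k l) = 0"
    by cases (simp_all add: leading_stencil_def harmonic_moment_def power_numeral_reduce)
  moreover have "coeff (residual (\<lambda>k l. [:leading_stencil k l:]) n) n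
      = (\<Sum>k\<in>{-1, 0, 1}. \<Sum>l\<in>{0, 1}. leading_stencil k l * harmonic_moment n k l) / fact n"
    unfolding residual_const sum_divide_distrib
    by (intro sum.cong refl) (simp only: coeff_GH_poly_lead[OF assms] times_divide_eq_right)
  ultimately show ?thesis by simp
qed

text \<open>
  The stencil is even in \<open>k\<close> and \<open>n\<close> is odd, so only monomials with an even power of \<open>y\<close> contribute, and their
  coefficients are the known multiples of \<open>a\<^sub>x / a\<close>. With the factorials the values are \<open>-3q, 0, 2q\<close>, which satisfy
  \<open>2 = 5/3 \<cdot> 0 - 2/3 \<cdot> (-3)\<close>.
\<close>

lemma residual_leading_stencil_next:
  defines "R \<equiv> \<lambda>n. coeff (residual (\<lambda>k l. [:leading_stencil k l:]) n) (Suc n)" and "q \<equiv> pd D 1 0 a p / a p"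
  shows "R 1 = - 3 * q" "R 3 = 0" "R 5 = q / 60"
proof -
  have s: "AHu D a p i j m 0 = (- 1) ^ (j div 2) * real (j div 2) * q" if "even j" "Suc m = i + j" for i j m
    using AHu_subtop[OF pos that] by (simp add: q_def)
  show "R 1 = - 3 * q"
    unfolding R_def residual_const by (simp add: coeff_GH_poly leading_stencil_def s power_numeral_reduce fact_numeral)
  show "R 3 = 0"
    unfolding R_def residual_const
    by (simp add: coeff_GH_poly leading_stencil_def s sum.atLeast_Suc_atMost power_numeral_reduce fact_numeral)
  show "R 5 = q / 60"
    unfolding R_def residual_const
    by (simp add: coeff_GH_poly leading_stencil_def s sum.atLeast_Suc_atMost power_numeral_reduce fact_numeral)
qed

text \<open>
  Six applications of \<open>extend_one_order\<close> to the leading stencil, which solves the equations of order \<open>h\<^sup>0\<close>. The constant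
  terms never change, so the result is non-trivial.
\<close>

lemma six_point_coefficients_exist:
  obtains C where "nontrivial C"
    "\<And>n. n \<le> 6 \<Longrightarrow> stencil_sum C (GH D a p 5 n 0) \<in> O[at_right 0](\<lambda>h. h ^ 7)"
proof -
  have ex: "\<exists>C. (\<forall>k l. coeff (C k l) 0 = leading_stencil k l) \<and>
      (\<forall>n e. e \<le> Suc d \<longrightarrow> n + e \<le> 6 \<longrightarrow> coeff (residual C n) (n + e) = 0)" for d
  proof (induction d)
    case 0
    obtain C where "\<And>k l. coeff (C k l) 0 = coeff [:leading_stencil k l:] 0"
      "\<And>n e. e \<le> Suc 0 \<Longrightarrow> n + e \<le> 6 \<Longrightarrow> coeff (residual C n) (n + e) = 0"
    proof (rule extend_one_order[of 0 "\<lambda>k l. [:leading_stencil k l:]"])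
      show "coeff (residual (\<lambda>k l. [:leading_stencil k l:]) n) (n + e) = 0" if "e \<le> 0" "n + e \<le> 6" for n e
        using that residual_leading_stencil_lead[of n] by simp
      show "fact 5 * coeff (residual (\<lambda>k l. [:leading_stencil k l:]) 5) 6 =
          5 / 3 * (fact 3 * coeff (residual (\<lambda>k l. [:leading_stencil k l:]) 3) 4)
          - 2 / 3 * (fact 1 * coeff (residual (\<lambda>k l. [:leading_stencil k l:]) 1) 2)"
        using residual_leading_stencil_next by (simp add: fact_numeral numeral_eq_Suc)
    qed blast
    then show ?case by (intro exI[of _ C]) simp
  next
    case (Suc d)
    then obtain C where C: "\<And>k l. coeff (C k l) 0 = leading_stencil k l"
      "\<And>n e. e \<le> Suc d \<Longrightarrow> n + e \<le> 6 \<Longrightarrow> coeff (residual C n) (n + e) = 0" by blast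
    obtain C' where "\<And>k l. coeff (C' k l) 0 = coeff (C k l) 0"
      "\<And>n e. e \<le> Suc (Suc d) \<Longrightarrow> n + e \<le> 6 \<Longrightarrow> coeff (residual C' n) (n + e) = 0"
      by (rule extend_one_order[of "Suc d" C]) (use C(2) in auto)
    then show ?case using C(1) by (intro exI[of _ C']) simp
  qed
  have six: "Suc 5 = (6 :: nat)" by simp
  obtain C where C0: "\<And>k l. coeff (C k l) 0 = leading_stencil k l"
    and C: "\<And>n e. e \<le> 6 \<Longrightarrow> n + e \<le> 6 \<Longrightarrow> coeff (residual C n) (n + e) = 0"
    using ex[of 5] unfolding six by blast
  have "nontrivial C"
    unfolding nontrivial_def
    by (intro bexI[of _ 0]) (simp_all add: poly_0_coeff_0 C0 leading_stencil_def)
  moreover have "stencil_sum C (GH D a p 5 n 0) \<in> O[at_right 0](\<lambda>h. h ^ 7)" if n: "n \<le> 6" for n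
  proof -
    have "coeff (residual C n) i = 0" if i: "i < 7" for i
    proof (cases "i < n")
      case True
      have "coeff (C k l * GH_poly 5 n k l) i = 0" for k l
        unfolding coeff_mult using True i by (intro sum.neutral) (auto intro!: coeff_GH_poly_below)
      then show ?thesis by (simp add: residual_def coeff_sum)
    next
      case False
      then show ?thesis using C[of "i - n" n] i by simp
    qed
    then have "poly (residual C n) \<in> O[at_right 0](\<lambda>h. h ^ 7)" by (simp add: poly_bigo_power_iff)
    moreover have "poly (residual C n) = stencil_sum C (GH D a p 5 n 0)"
      using n by (intro ext) (simp add: residual_def stencil_sum_def poly_sum poly_GH_poly)
    ultimately show ?thesis by simp
  qed
  ultimately show thesis using that by blast
qed

end

lemma order_6_attainable: "order_attainable D p 6"
  unfolding order_attainable_def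
proof (intro allI impI)
  fix a assume pos: "pos_smooth_near D p a"
  obtain C where "nontrivial C"
    "\<And>n. n \<le> 6 \<Longrightarrow> stencil_sum C (GH D a p 5 n 0) \<in> O[at_right 0](\<lambda>h. h ^ 7)"
    using six_point_coefficients_exist[OF pos] by blast
  then show "\<exists>C I cf J cg. scheme_has_order D a p C I cf J cg 6"
    using consistency_order[OF pos, of C 5] by fastforce
qed

end

section \<open>A coefficient without a scheme of order seven\<close>

lemma has_vector_derivative_power:
  fixes z :: "real \<Rightarrow> complex"
  assumes "(z has_vector_derivative v) (at t within A)"
  shows "((\<lambda>t. z t ^ n) has_vector_derivative v * (of_nat n * z t ^ (n - 1))) (at t within A)"
proof -
  have "((\<lambda>w. w ^ n) has_field_derivative of_nat n * z t ^ (n - 1)) (at (z t) within z ` A)"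
    by (auto intro!: derivative_eq_intros)
  from field_vector_diff_chain_within[OF assms this] show ?thesis by (simp add: o_def)
qed

lemma has_vector_derivative_Complex:
  "((\<lambda>t. Complex (t - c) b) has_vector_derivative 1) (at t within A)"
  "((\<lambda>t. Complex b (t - c)) has_vector_derivative \<i>) (at t within A)"
proof -
  have "((\<lambda>t. complex_of_real (t - c) + \<i> * complex_of_real b) has_vector_derivative 1) (at t within A)"
    "((\<lambda>t. complex_of_real b + \<i> * complex_of_real (t - c)) has_vector_derivative \<i>) (at t within A)"
    by (auto intro!: derivative_eq_intros)
  then show "((\<lambda>t. Complex (t - c) b) has_vector_derivative 1) (at t within A)"
    "((\<lambda>t. Complex b (t - c)) has_vector_derivative \<i>) (at t within A)"
    by (simp_all add: Complex_eq)
qed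

context bottom_side_point
begin

text \<open>
  Powers of the complex coordinate centred at \<open>p\<close>; real and imaginary parts are harmonic polynomials.
\<close>

definition zpow :: "nat \<Rightarrow> real \<times> real \<Rightarrow> complex" where
  "zpow n q = Complex (fst q - x\<^sub>0) (snd q - l\<^sub>3) ^ n"

lemma has_deriv_zpow:
  "((\<lambda>t. Re (zpow n (t, y))) has_real_derivative n * Re (zpow (n - 1) (x, y))) (at x within A)"
  "((\<lambda>t. Im (zpow n (t, y))) has_real_derivative n * Im (zpow (n - 1) (x, y))) (at x within A)"
  "((\<lambda>t. Re (zpow n (x, t))) has_real_derivative - (n * Im (zpow (n - 1) (x, y)))) (at y within A)"
  "((\<lambda>t. Im (zpow n (x, t))) has_real_derivative n * Re (zpow (n - 1) (x, y))) (at y within A)"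
proof -
  note v1 = has_vector_derivative_power[where n=n, OF has_vector_derivative_Complex(1)[where c="x\<^sub>0" and b="y - l\<^sub>3" and t=x and A=A]]
  note v2 = has_vector_derivative_power[where n=n, OF has_vector_derivative_Complex(2)[where b="x - x\<^sub>0" and c="l\<^sub>3" and t=y and A=A]]
  note R = bounded_linear.has_vector_derivative[OF bounded_linear_Re]
    and I = bounded_linear.has_vector_derivative[OF bounded_linear_Im]
  show "((\<lambda>t. Re (zpow n (t, y))) has_real_derivative n * Re (zpow (n - 1) (x, y))) (at x within A)"
    using R[OF v1] by (simp add: has_real_derivative_iff_has_vector_derivative zpow_def)
  show "((\<lambda>t. Im (zpow n (t, y))) has_real_derivative n * Im (zpow (n - 1) (x, y))) (at x within A)"
    using I[OF v1] by (simp add: has_real_derivative_iff_has_vector_derivative zpow_def)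
  show "((\<lambda>t. Re (zpow n (x, t))) has_real_derivative - (n * Im (zpow (n - 1) (x, y)))) (at y within A)"
    using R[OF v2] by (simp add: has_real_derivative_iff_has_vector_derivative zpow_def)
  show "((\<lambda>t. Im (zpow n (x, t))) has_real_derivative n * Re (zpow (n - 1) (x, y))) (at y within A)"
    using I[OF v2] by (simp add: has_real_derivative_iff_has_vector_derivative zpow_def)
qed

lemma smooth_zpow: "nbhd S \<Longrightarrow> smooth S (\<lambda>q. Re (zpow n q)) \<and> smooth S (\<lambda>q. Im (zpow n q))"
proof (induction n)
  case 0
  then show ?case by (simp add: zpow_def smooth_const)
next
  case (Suc n)
  note S = Suc.prems
  note sm = Suc.IH[OF S, THEN conjunct1] Suc.IH[OF S, THEN conjunct2] smooth_shift[OF S]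
  have "smooth S (\<lambda>q. (fst q - x\<^sub>0) * Re (zpow n q) + (- 1) * ((snd q - l\<^sub>3) * Im (zpow n q)))"
    by (intro smooth_add[OF S] smooth_mult[OF S] smooth_cmult[OF S] sm)
  moreover have "smooth S (\<lambda>q. (fst q - x\<^sub>0) * Im (zpow n q) + (snd q - l\<^sub>3) * Re (zpow n q))"
    by (intro smooth_add[OF S] smooth_mult[OF S] sm)
  ultimately show ?case by (simp add: zpow_def)
qed

definition depth :: "real \<times> real \<Rightarrow> real" where
  "depth q = 1 + (snd q - l\<^sub>3)"

text \<open>
  \<open>a = 1 / Y\<^sup>2\<close> with \<open>Y = 1 + y - l\<^sub>3\<close>. The equation \<open>div (a grad u) = 0\<close> becomes \<open>\<Delta>u = (2 / Y) u\<^sub>y\<close>, which has polynomial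
  solutions.
\<close>

definition steep_coefficient :: "real \<times> real \<Rightarrow> real" where
  "steep_coefficient q = inverse (depth q * depth q)"

text \<open>
  For harmonic \<open>v\<close>, \<open>u = Y v\<^sub>y - v\<close> satisfies \<open>\<Delta>u = (2 / Y) u\<^sub>y\<close>, with \<open>u\<^sub>y = Y v\<^sub>y\<^sub>y\<close>. Here \<open>v = Im z\<^sup>n\<^sup>+\<^sup>1 / (n + 1)\<close>,
  which is odd in \<open>y - l\<^sub>3\<close>, so that \<open>v\<^sub>y\<^sub>y = - v\<^sub>x\<^sub>x\<close> vanishes on the bottom side.
\<close>

definition null_solution :: "nat \<Rightarrow> real \<times> real \<Rightarrow> real" where
  "null_solution n q = depth q * Re (zpow n q) - Im (zpow (n + 1) q) / (n + 1)"

lemma depth_pos: "q \<in> D \<Longrightarrow> 0 < depth q"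
  by (auto simp: depth_def D_def)

lemma has_deriv_depth:
  "((\<lambda>t. depth (t, y)) has_real_derivative 0) (at x within A)"
  "((\<lambda>t. depth (x, t)) has_real_derivative 1) (at y within A)"
  by (auto simp: depth_def intro!: derivative_eq_intros)

lemma smooth_depth: "nbhd S \<Longrightarrow> smooth S depth"
  using smooth_add[OF _ smooth_const[of S 1] smooth_shift(2)[of S "l\<^sub>3"]] by (simp add: depth_def[abs_def])

lemma steep_coefficient_pos_smooth: "pos_smooth_near D p steep_coefficient"
  unfolding pos_smooth_near_def
proof (intro conjI exI[of _ UNIV] ballI)
  note S = nbhd_exists
  have "smooth ({l\<^sub>1<..<l\<^sub>2} \<times> {l\<^sub>3..<l\<^sub>4}) steep_coefficient"
    unfolding steep_coefficient_def[abs_def]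
    by (intro smooth_inverse[OF S] smooth_mult[OF S] smooth_depth[OF S])
      (use depth_pos nbhd_D[OF S] in \<open>force simp del: mem_Sigma_iff\<close>)
  then show "smooth_near D p steep_coefficient" unfolding smooth_near_iff using S by blast
  show "0 < steep_coefficient q" if "q \<in> UNIV \<inter> D" for q
    using depth_pos[of q] that by (simp add: steep_coefficient_def)
qed simp_all

lemma null_solution_smooth: "smooth_near D p (null_solution n)"
proof -
  note S = nbhd_exists
  have "smooth ({l\<^sub>1<..<l\<^sub>2} \<times> {l\<^sub>3..<l\<^sub>4}) (\<lambda>q. depth q * Re (zpow n q) + (- 1 / (n + 1)) * Im (zpow (n + 1) q))"
    by (intro smooth_add[OF S] smooth_mult[OF S] smooth_cmult[OF S] smooth_depth[OF S]
        conjunct1[OF smooth_zpow[OF S]] conjunct2[OF smooth_zpow[OF S]])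
  then show ?thesis unfolding smooth_near_iff using S by (auto simp: null_solution_def[abs_def])
qed

lemma dx_null_solution: "q \<in> D \<Longrightarrow> dx D (null_solution n) q = n * depth q * Re (zpow (n - 1) q) - Im (zpow n q)"
proof -
  assume q: "q \<in> D"
  obtain x y where xy: "q = (x, y)" by force
  note d = DERIV_diff[OF DERIV_mult[OF has_deriv_depth(1)[where x=x and y=y and A="{l\<^sub>1..l\<^sub>2}"] has_deriv_zpow(1)[where n=n and x=x and y=y and A="{l\<^sub>1..l\<^sub>2}"]]
      DERIV_cdivide[OF has_deriv_zpow(2)[where n="n + 1" and x=x and y=y and A="{l\<^sub>1..l\<^sub>2}"], of "real (n + 1)"]]
  show ?thesis unfolding xy
    by (rule dx_eqI) (use q xy d in \<open>simp_all add: null_solution_def mult_ac\<close>)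
qed

lemma dy_null_solution: "q \<in> D \<Longrightarrow> dy D (null_solution n) q = - n * depth q * Im (zpow (n - 1) q)"
proof -
  assume q: "q \<in> D"
  obtain x y where xy: "q = (x, y)" by force
  note d = DERIV_diff[OF DERIV_mult[OF has_deriv_depth(2)[where x=x and y=y and A="{l\<^sub>3..l\<^sub>4}"] has_deriv_zpow(3)[where n=n and x=x and y=y and A="{l\<^sub>3..l\<^sub>4}"]]
      DERIV_cdivide[OF has_deriv_zpow(4)[where n="n + 1" and x=x and y=y and A="{l\<^sub>3..l\<^sub>4}"], of "real (n + 1)"]]
  show ?thesis unfolding xy
    by (rule dy_eqI) (use q xy d in \<open>simp_all add: null_solution_def mult_ac\<close>)
qed

lemma source_null_solution:
  assumes S: "nbhd S" and q: "q \<in> S"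
  shows "source D steep_coefficient (null_solution n) q = 0"
proof -
  obtain x y where xy: "q = (x, y)" by force
  have D: "(x, y) \<in> D" using D_nbhd[OF S] q xy by simp
  have h: "0 < depth r" if "r \<in> S" for r using that nbhd_D[OF S] depth_pos by blast
  let ?h = "depth (x, y)"
  have h0: "?h \<noteq> 0" using depth_pos[OF D] by simp
  have "dx D (\<lambda>r. steep_coefficient r * dx D (null_solution n) r) q
      = dx D (\<lambda>r. n * Re (zpow (n - 1) r) * inverse (depth r) - Im (zpow n r) * steep_coefficient r) q"
  proof (rule dx_cong[OF S _ q])
    fix r assume r: "r \<in> S"
    then have "r \<in> D" using nbhd_D[OF S] by blast
    then show "steep_coefficient r * dx D (null_solution n) r = n * Re (zpow (n - 1) r) * inverse (depth r) - Im (zpow n r) * steep_coefficient r"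
      using h[OF r] by (simp add: dx_null_solution steep_coefficient_def field_simps)
  qed
  also have "\<dots> = n * ((n - 1) * Re (zpow (n - 1 - 1) q)) * inverse ?h - n * Im (zpow (n - 1) q) * steep_coefficient q"
    unfolding xy
  proof (rule dx_eqI[OF D])
    have eq: "(\<lambda>t. n * Re (zpow (n - 1) (t, y)) * inverse (depth (t, y)) - Im (zpow n (t, y)) * steep_coefficient (t, y))
        = (\<lambda>t. n * inverse ?h * Re (zpow (n - 1) (t, y)) - steep_coefficient (x, y) * Im (zpow n (t, y)))"
      by (rule ext) (simp add: steep_coefficient_def depth_def)
    show "((\<lambda>t. n * Re (zpow (n - 1) (t, y)) * inverse (depth (t, y)) - Im (zpow n (t, y)) * steep_coefficient (t, y))
        has_real_derivative n * ((n - 1) * Re (zpow (n - 1 - 1) (x, y))) * inverse ?h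
          - n * Im (zpow (n - 1) (x, y)) * steep_coefficient (x, y)) (at x within {l\<^sub>1..l\<^sub>2})"
      unfolding eq using DERIV_diff[OF DERIV_cmult[OF has_deriv_zpow(1)[where n="n - 1" and x=x and y=y and A="{l\<^sub>1..l\<^sub>2}"], of "n * inverse ?h"]
          DERIV_cmult[OF has_deriv_zpow(2)[where n=n and x=x and y=y and A="{l\<^sub>1..l\<^sub>2}"], of "steep_coefficient (x, y)"]]
      by (simp add: mult_ac)
  qed
  finally have 1: "dx D (\<lambda>r. steep_coefficient r * dx D (null_solution n) r) q
      = n * ((n - 1) * Re (zpow (n - 1 - 1) q)) * inverse ?h - n * Im (zpow (n - 1) q) * steep_coefficient q" .
  have "dy D (\<lambda>r. steep_coefficient r * dy D (null_solution n) r) q = dy D (\<lambda>r. - n * (Im (zpow (n - 1) r) * inverse (depth r))) q"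
  proof (rule dy_cong[OF S _ q])
    fix r assume r: "r \<in> S"
    then have "r \<in> D" using nbhd_D[OF S] by blast
    then show "steep_coefficient r * dy D (null_solution n) r = - n * (Im (zpow (n - 1) r) * inverse (depth r))"
      using h[OF r] by (simp add: dy_null_solution steep_coefficient_def field_simps)
  qed
  also have "\<dots> = - n * ((n - 1) * Re (zpow (n - 1 - 1) q) * inverse ?h - Im (zpow (n - 1) q) * steep_coefficient q)"
    unfolding xy
  proof (rule dy_eqI[OF D])
    have "((\<lambda>t. inverse (depth (x, t))) has_real_derivative - (inverse ?h * 1 * inverse ?h)) (at y within {l\<^sub>3..l\<^sub>4})"
      using DERIV_inverse'[OF has_deriv_depth(2) h0] .
    from DERIV_cmult[OF DERIV_mult[OF has_deriv_zpow(4)[of "n - 1"] this], of "- real n"]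
    show "((\<lambda>t. - n * (Im (zpow (n - 1) (x, t)) * inverse (depth (x, t)))) has_real_derivative
       - n * ((n - 1) * Re (zpow (n - 1 - 1) (x, y)) * inverse ?h - Im (zpow (n - 1) (x, y)) * steep_coefficient (x, y)))
       (at y within {l\<^sub>3..l\<^sub>4})"
      by (simp add: steep_coefficient_def algebra_simps)
  qed
  finally have 2: "dy D (\<lambda>r. steep_coefficient r * dy D (null_solution n) r) q
      = - n * ((n - 1) * Re (zpow (n - 1 - 1) q) * inverse ?h - Im (zpow (n - 1) q) * steep_coefficient q)" .
  show ?thesis unfolding source_def 1 2 by (simp add: algebra_simps)
qed

text \<open>
  The source vanishes in a whole neighbourhood of \<open>p\<close>, not only to some finite order. The scheme may use
  arbitrarily high derivatives of \<open>f\<close> with arbitrarily large coefficients, so this is needed.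
\<close>

lemma pd_source_null_solution: "pd D i j (source D steep_coefficient (null_solution n)) p = 0"
proof -
  note S = nbhd_exists
  have "pd D i j (source D steep_coefficient (null_solution n)) p = pd D i j (\<lambda>q. 0 * (0::real)) p"
    using source_null_solution[OF S] nbhd_p[OF S] by (intro pd_cong[OF S]) simp_all
  also have "\<dots> = 0"
    by (subst pd_cmult[OF S smooth_const[OF S] nbhd_p[OF S]]) simp
  finally show ?thesis .
qed

lemma higher_deriv_g3_null_solution: "(deriv ^^ i) (g3 D l\<^sub>3 (null_solution n)) x\<^sub>0 = 0"
proof -
  have "eventually (\<lambda>x. x \<in> {l\<^sub>1<..<l\<^sub>2}) (nhds x\<^sub>0)"
    using left right by (intro eventually_nhds_in_open) auto
  then have "eventually (\<lambda>x. g3 D l\<^sub>3 (null_solution n) x = 0) (nhds x\<^sub>0)"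
  proof eventually_elim
    case (elim x)
    then have "(x, l\<^sub>3) \<in> D" using height by (auto simp: D_def)
    then show ?case
      by (simp add: g3_def normal_deriv_def dy_null_solution zpow_def complex_eq flip: of_real_power of_real_diff)
  qed
  then have "(deriv ^^ i) (g3 D l\<^sub>3 (null_solution n)) x\<^sub>0 = (deriv ^^ i) (\<lambda>_. 0) x\<^sub>0"
    by (intro higher_deriv_cong_ev refl)
  also have "(deriv ^^ i) (\<lambda>_. 0 :: real) = (\<lambda>_. 0)" by (induction i) auto
  finally show ?thesis .
qed

text \<open>
  On the stencil, the \<open>n\<close>-th null solution is \<open>h\<^sup>n (Re \<zeta>\<^sup>n + h (l Re \<zeta>\<^sup>n - Im \<zeta>\<^sup>n\<^sup>+\<^sup>1 / (n + 1)))\<close>, and the scheme has to reproduce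
  zero up to \<open>O(h\<^sup>8)\<close>. The resulting equations for the constant and the linear terms of the stencil force the constant
  terms to vanish.
\<close>

lemma no_scheme_of_order_7:
  assumes scheme: "scheme_has_order D steep_coefficient p C I cf J cg q" and q: "7 \<le> q"
  shows False
proof -
  let ?\<zeta> = "\<lambda>k l. Complex (of_int k) (of_nat l)"
  let ?W = "\<lambda>n k l. [:Re (?\<zeta> k l ^ n), of_nat l * Re (?\<zeta> k l ^ n) - Im (?\<zeta> k l ^ (n + 1)) / (n + 1):]"
  define P where "P n = (\<Sum>k\<in>{-1, 0, 1}. \<Sum>l\<in>{0, 1}. C k l * ?W n k l)" for n
  have val: "null_solution n (x\<^sub>0 + of_int k * h, l\<^sub>3 + of_nat l * h) = h ^ n * poly (?W n k l) h" for n k l h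
  proof -
    have z: "zpow m (x\<^sub>0 + of_int k * h, l\<^sub>3 + of_nat l * h) = of_real (h ^ m) * ?\<zeta> k l ^ m" for m
    proof -
      have "Complex (of_int k * h) (of_nat l * h) = of_real h * ?\<zeta> k l"
        by (simp add: complex_eq_iff mult.commute)
      then show ?thesis by (simp add: zpow_def power_mult_distrib)
    qed
    show ?thesis unfolding null_solution_def z depth_def by (simp add: algebra_simps)
  qed
  have small: "coeff (P n) e = 0" if ne: "n + e < 8" for n e
  proof -
    have "(\<lambda>h. stencil_sum C (\<lambda>x y. null_solution n (fst p + x, snd p + y)) h -
             ((\<Sum>(m, m')\<in>I. pd D m m' (source D steep_coefficient (null_solution n)) p * cf m m' h) +
              (\<Sum>m\<in>J. (deriv ^^ m) (g3 D (snd p) (null_solution n)) (fst p) * cg m h)))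
          \<in> O[at_right 0](\<lambda>h. h ^ (q + 1))"
      using scheme null_solution_smooth unfolding scheme_has_order_def by blast
    moreover have "(\<lambda>h. stencil_sum C (\<lambda>x y. null_solution n (fst p + x, snd p + y)) h -
             ((\<Sum>(m, m')\<in>I. pd D m m' (source D steep_coefficient (null_solution n)) p * cf m m' h) +
              (\<Sum>m\<in>J. (deriv ^^ m) (g3 D (snd p) (null_solution n)) (fst p) * cg m h)))
        = poly (monom 1 n * P n)"
    proof
      fix h
      have "stencil_sum C (\<lambda>x y. null_solution n (fst p + x, snd p + y)) h
          = (\<Sum>k\<in>{-1, 0, 1}. \<Sum>l\<in>{0, 1}. h ^ n * (poly (C k l) h * poly (?W n k l) h))"
        unfolding stencil_sum_def fst_conv snd_conv val by (intro sum.cong refl) (rule mult.left_commute)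
      also have "\<dots> = poly (monom 1 n * P n) h"
        unfolding P_def poly_mult poly_monom poly_sum sum_distrib_left mult_1_left ..
      finally show "stencil_sum C (\<lambda>x y. null_solution n (fst p + x, snd p + y)) h -
             ((\<Sum>(m, m')\<in>I. pd D m m' (source D steep_coefficient (null_solution n)) p * cf m m' h) +
              (\<Sum>m\<in>J. (deriv ^^ m) (g3 D (snd p) (null_solution n)) (fst p) * cg m h))
        = poly (monom 1 n * P n) h"
        by (simp only: fst_conv snd_conv pd_source_null_solution higher_deriv_g3_null_solution mult_zero_left
            case_prod_unfold sum.neutral_const add_0_left diff_0_right)
    qed
    ultimately have "poly (monom 1 n * P n) \<in> O[at_right 0](\<lambda>h. h ^ (q + 1))" by simp
    then have "coeff (monom 1 n * P n) (n + e) = 0"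
      using ne q unfolding poly_bigo_power_iff by simp
    then show ?thesis by (simp add: coeff_monom_mult)
  qed
  let ?c = "\<lambda>i k l. coeff (C k l) i"
  have P0: "coeff (P n) 0 = (\<Sum>k\<in>{-1, 0, 1}. \<Sum>l\<in>{0, 1}. ?c 0 k l * coeff (?W n k l) 0)" for n
    by (simp add: P_def coeff_sum coeff_mult)
  have P1: "coeff (P n) 1 = (\<Sum>k\<in>{-1, 0, 1}. \<Sum>l\<in>{0, 1}. ?c 0 k l * coeff (?W n k l) 1 + ?c 1 k l * coeff (?W n k l) 0)" for n
    by (simp add: P_def coeff_sum coeff_mult)
  note ev = power_numeral_reduce
  (* The values Re \<zeta>^n for n = 0, ..., 4 give the order h^0 equations. *)
  have e0: "?c 0 (-1) 0 + ?c 0 (-1) 1 + ?c 0 0 0 + ?c 0 0 1 + ?c 0 1 0 + ?c 0 1 1 = 0"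
    using small[of 0 0] unfolding P0 by (simp add: ev)
  have e1: "- ?c 0 (-1) 0 - ?c 0 (-1) 1 + ?c 0 1 0 + ?c 0 1 1 = 0"
    using small[of 1 0] unfolding P0 by (simp add: ev)
  have e2: "?c 0 (-1) 0 - ?c 0 0 1 + ?c 0 1 0 = 0"
    using small[of 2 0] unfolding P0 by (simp add: ev)
  have e3: "- ?c 0 (-1) 0 + 2 * ?c 0 (-1) 1 + ?c 0 1 0 - 2 * ?c 0 1 1 = 0"
    using small[of 3 0] unfolding P0 by (simp add: ev)
  have e4: "?c 0 (-1) 0 - 4 * ?c 0 (-1) 1 + ?c 0 0 1 + ?c 0 1 0 - 4 * ?c 0 1 1 = 0"
    using small[of 4 0] unfolding P0 by (simp add: ev)
  (* The order h^1 equations for n = 2 and n = 6 have the same linear terms, as Re \<zeta>^2 = Re \<zeta>^6 on the stencil. *)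
  have f2: "?c 1 (-1) 0 - ?c 1 0 1 + ?c 1 1 0 - 2 / 3 * (?c 0 (-1) 1 + ?c 0 0 1 + ?c 0 1 1) = 0"
    using small[of 2 1] unfolding P1 by (simp add: ev algebra_simps)
  have f6: "?c 1 (-1) 0 - ?c 1 0 1 + ?c 1 1 0 + 8 / 7 * (?c 0 (-1) 1 + ?c 0 1 1) - 6 / 7 * ?c 0 0 1 = 0"
    using small[of 6 1] unfolding P1 by (simp add: ev algebra_simps)
  have d: "?c 0 0 1 = 0" using e2 e4 f2 f6 by argo
  have "?c 0 1 1 = 0" using d e1 e2 e3 e4 by argo
  then have "?c 0 (-1) 0 = 0 \<and> ?c 0 (-1) 1 = 0 \<and> ?c 0 0 0 = 0 \<and> ?c 0 0 1 = 0 \<and> ?c 0 1 0 = 0 \<and> ?c 0 1 1 = 0"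
    using e0 e1 e2 e3 e4 d by argo
  then have "\<not> nontrivial C" by (simp add: nontrivial_def poly_0_coeff_0)
  then show False using scheme by (simp add: scheme_has_order_def)
qed

lemma order_attainable_le_6:
  assumes "order_attainable D p q"
  shows "q \<le> 6"
proof (rule ccontr)
  assume "\<not> q \<le> 6"
  moreover obtain C I cf J cg where "scheme_has_order D steep_coefficient p C I cf J cg q"
    using assms steep_coefficient_pos_smooth unfolding order_attainable_def by blast
  ultimately show False using no_scheme_of_order_7[of C I cf J cg q] by simp
qed

end

theorem theorem2p3:
  fixes l\<^sub>1 l\<^sub>2 l\<^sub>3 l\<^sub>4 :: real and \<Omega> \<Gamma>\<^sub>3 :: "(real \<times> real) set" and p :: "real \<times> real"
  assumes "l\<^sub>1 < l\<^sub>2" and "l\<^sub>3 < l\<^sub>4"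
    and "\<Omega> = {l\<^sub>1<..<l\<^sub>2} \<times> {l\<^sub>3<..<l\<^sub>4}"
    and "\<Gamma>\<^sub>3 = {l\<^sub>1<..<l\<^sub>2} \<times> {l\<^sub>3}"
    and "p \<in> \<Gamma>\<^sub>3"
  shows
    "(\<forall>a C. pos_smooth_near (closure \<Omega>) p a \<longrightarrow>
        (\<forall>k \<in> {-1, 0, 1}. \<forall>l \<in> {0, 1}. degree (C k l) \<le> 6) \<longrightarrow>
        nontrivial C \<longrightarrow>
        (\<forall>n \<in> {0..6}. stencil_sum C (GH (closure \<Omega>) a p 5 n 0) \<in> O[at_right 0](\<lambda>h. h ^ 7)) \<longrightarrow>
        scheme_has_order (closure \<Omega>) a p C
          (\<Lambda> 4) (\<lambda>m n. stencil_sum C (QH (closure \<Omega>) a p 5 m n))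
          {0..5} (\<lambda>n h. - stencil_sum C (GH (closure \<Omega>) a p 5 n 1) h)
          6) \<and>
     order_attainable (closure \<Omega>) p 6 \<and>
     (\<forall>q. order_attainable (closure \<Omega>) p q \<longrightarrow> q \<le> 6)"
proof -
  obtain x\<^sub>0 where p: "p = (x\<^sub>0, l\<^sub>3)" and x\<^sub>0: "l\<^sub>1 < x\<^sub>0" "x\<^sub>0 < l\<^sub>2"
    using assms(4,5) by auto
  interpret bottom_side_point l\<^sub>1 l\<^sub>2 l\<^sub>3 l\<^sub>4 x\<^sub>0
    using x\<^sub>0 assms(2) by unfold_locales
  have D: "closure \<Omega> = D"
    using assms(1,2) unfolding assms(3) D_def by (simp add: closure_Times)
  have "scheme_has_order D a (x\<^sub>0, l\<^sub>3) C
          (\<Lambda> 4) (\<lambda>m n. stencil_sum C (QH D a (x\<^sub>0, l\<^sub>3) 5 m n))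
          {0..5} (\<lambda>n h. - stencil_sum C (GH D a (x\<^sub>0, l\<^sub>3) 5 n 1) h) 6"
    if "pos_smooth_near D (x\<^sub>0, l\<^sub>3) a" "nontrivial C"
      "\<forall>n \<in> {0..6}. stencil_sum C (GH D a (x\<^sub>0, l\<^sub>3) 5 n 0) \<in> O[at_right 0](\<lambda>h. h ^ 7)" for a C
    using consistency_order[OF that(1,2), of 5] that(3) by simp
  then show ?thesis
    unfolding D p using order_6_attainable order_attainable_le_6 by blast
qed

end
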